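(* Let $\mathcal W$ be the set of bounded symmetric functions $[0,1]^2\to\mathbb R$ that are measurable with respect to the Lebesgue measurable subsets of $[0,1]^2$. For two functions $W,W'\in\mathcal W$ the following are equivalent. (a) For every finite simple graph $F$, $t(F,W')=t(F,W)$. (b) For every finite multigraph $F$, $t(F,W')=t(F,W)$. (c) There exist a function $U\in\mathcal W$ and two measure preserving maps $\varphi,\psi:[0,1]\to[0,1]$ such that $W=U^{\varphi}$ and $W'=U^{\psi}$ almost everywhere. (d) There exist two measure preserving maps $\varphi,\psi:[0,1]\to[0,1]$ such that $(W')^\varphi=W^\psi$ almost everywhere. (e) There exists a probability measure $\gamma$ on $[0,1]\times[0,1]$ such that each marginal of $\gamma$ is the Lebesgue measure, and if $(X,X')$ and $(Y,Y')$ are two independent samples from $\gamma$, then $W(X,Y)=W'(X',Y')$ with probability $1$.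
   Context: For $W\in\mathcal W$ and a finite graph or multigraph $F$ with $V(F)=\{1,\dots,k\}$, $t(F,W)=\int_{[0,1]^k}\prod_{ij\in E(F)}W(x_i,x_j)\,dx_1\cdots dx_k$, the product being over edges counted with multiplicity. Simple graphs have no loops and no multiple edges; multigraphs may have multiple edges but no loops. "Measure preserving" refers to $[0,1]$ with the Lebesgue sets and Lebesgue measure. For $U\in\mathcal W$ and $\varphi:[0,1]\to[0,1]$, the pull-back is $U^\varphi(x,y)=U(\varphi(x),\varphi(y))$. "Almost everywhere" is with respect to Lebesgue measure on $[0,1]^2$. *)

theory Defs
  imports "HOL-Analysis.Analysis" "HOL-Probability.Probability" "HOL-Library.Multiset"
begin

abbreviation unit_lebesgue :: "real measure" where
  "unit_lebesgue \<equiv> lebesgue_on {0..1}"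

abbreviation square_lebesgue :: "(real \<times> real) measure" where
  "square_lebesgue \<equiv> lebesgue_on ({0..1} \<times> {0..1})"

text \<open>
  A function on the unit square is a curried total function; only its restriction to
  the unit square is constrained, and only that restriction is used below.
\<close>

definition kernels :: "(real \<Rightarrow> real \<Rightarrow> real) set" where
  "kernels = {W. bounded (case_prod W ` ({0..1} \<times> {0..1}))
     \<and> (\<forall>x\<in>{0..1}. \<forall>y\<in>{0..1}. W x y = W y x)
     \<and> case_prod W \<in> borel_measurable square_lebesgue}"

text \<open>
  A graph on the vertex set \<open>{1..k}\<close> is given by its multiset of edges, an edge
  being a two-element set of vertices.
\<close>

definition multigraph :: "nat \<Rightarrow> nat set multiset \<Rightarrow> bool" where
  "multigraph k E \<longleftrightarrow> (\<forall>e\<in>#E. e \<subseteq> {1..k} \<and> card e = 2)"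

definition simple_graph :: "nat \<Rightarrow> nat set multiset \<Rightarrow> bool" where
  "simple_graph k E \<longleftrightarrow> multigraph k E \<and> (\<forall>e. count E e \<le> 1)"

text \<open>
  The factor of an edge \<open>e = {i, j}\<close> is \<open>W (x i) (x j)\<close>. Evaluating it with the smaller
  endpoint first is only a choice of representative, as kernels are symmetric.

  The completion of the product measure is the Lebesgue measure on the \<open>k\<close>-dimensional
  unit cube. It is needed because a kernel is only Lebesgue measurable on the square, so
  the integrand need not be measurable for the product sigma-algebra itself, and the
  integral of a non-measurable function is \<open>0\<close> by convention.
\<close>

definition hom_density :: "nat \<Rightarrow> nat set multiset \<Rightarrow> (real \<Rightarrow> real \<Rightarrow> real) \<Rightarrow> real" where
  "hom_density k E W =
     (\<integral>x. (\<Prod>e\<in>#E. W (x (Min e)) (x (Max e)))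
        \<partial>completion (\<Pi>\<^sub>M i\<in>{1..k}. unit_lebesgue))"

definition measure_preserving :: "(real \<Rightarrow> real) \<Rightarrow> bool" where
  "measure_preserving \<phi> \<longleftrightarrow> \<phi> \<in> unit_lebesgue \<rightarrow>\<^sub>M unit_lebesgue
     \<and> distr unit_lebesgue unit_lebesgue \<phi> = unit_lebesgue"

definition pullback :: "(real \<Rightarrow> real \<Rightarrow> real) \<Rightarrow> (real \<Rightarrow> real) \<Rightarrow> real \<Rightarrow> real \<Rightarrow> real" where
  "pullback U \<phi> = (\<lambda>x y. U (\<phi> x) (\<phi> y))"

definition ae_equal :: "(real \<Rightarrow> real \<Rightarrow> real) \<Rightarrow> (real \<Rightarrow> real \<Rightarrow> real) \<Rightarrow> bool" where
  "ae_equal U V \<longleftrightarrow> (AE (x, y) in square_lebesgue. U x y = V x y)"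

text \<open>
  A coupling lives on the product of the Lebesgue sigma-algebras, so that both marginals are
  defined on all Lebesgue sets. It cannot be required to measure every Lebesgue subset of
  the square: for a coupling carried by the diagonal, that would include all subsets of the
  diagonal.
\<close>

definition lebesgue_coupling :: "(real \<times> real) measure \<Rightarrow> bool" where
  "lebesgue_coupling \<gamma> \<longleftrightarrow> prob_space \<gamma>
     \<and> sets \<gamma> = sets (unit_lebesgue \<Otimes>\<^sub>M unit_lebesgue)
     \<and> distr \<gamma> unit_lebesgue fst = unit_lebesgue
     \<and> distr \<gamma> unit_lebesgue snd = unit_lebesgue"

end

theory Submission
  imports Defs
begin

text \<open>
  From (a) to (d): scale the kernels to \<open>[-1, 1]\<close>. For a sample \<open>X\<close> of \<open>n\<close> points draw independent
  signs \<open>\<sigma> {i, j}\<close> with means \<open>W (X i) (X j)\<close>. The law of the random sign pattern is a linear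
  combination of densities of simple graphs, so it is the same for \<open>W\<close> and \<open>W'\<close>, and one can find
  equidistributed samples \<open>X\<close> and \<open>X'\<close> that share a sign pattern. By a fourth-moment bound (closed
  walks of length four) the pattern is close to both sampled kernels as a bilinear form, hence so are
  the sampled kernels to each other. A weak limit of the empirical measures of the pairs \<open>(X i, X' i)\<close>
  is a coupling that identifies \<open>W\<close> with \<open>W'\<close>; lifting the pairs to a space-filling curve puts the
  limit on the line, where a quantile function represents it by two measure preserving maps.

  From (d) to (c): both kernels become one kernel \<open>V\<close> on a common space. The means of the sections of
  \<open>V\<close> over a countable generator are coded into one real function \<open>p\<close>, which factors through both
  maps, and \<open>V\<close> is a function of \<open>(p x, p y)\<close>. Ranks with respect to \<open>p\<close>, with ties broken by position,
  are measure preserving and turn the factorization into a kernel on the unit square.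
\<close>

text \<open>Densities of simple graphs are linear in the value at each edge, so they give no direct
  access to powers of a kernel, nor to multigraphs; hence (b) is reached only through (d). Random
  signs fit this limitation, since their law uses every edge at most once. Kernels are merely
  measurable, so a weak limit of samples cannot be inserted into them. Continuous L1-approximations
  are therefore fixed beforehand, and the samples are chosen so that these stay accurate on the
  sampled points too; countably many test functions, also built into the choice, force uniform
  marginals in the limit. Compactness, Skorohod's representation and quantile functions are used on
  the line only. This explains the curve: being continuous, it keeps continuous tests continuous,
  and it codes a pair of points, or a sequence of section means, by one real number. Lebesgue sets
  do not suit products and compositions, so the work is done with Borel versions that are symmetric
  and bounded everywhere.\<close>

section \<open>A continuous curve through the Hilbert cube\<close>

text \<open>
  The function \<open>cantor_bit\<close> is even and \<open>2\<close>-periodic, \<open>0\<close> on \<open>[0, 1/3]\<close> and \<open>1\<close> on \<open>[2/3, 1]\<close>, so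
  \<open>cantor_bit (3 ^ n * t)\<close> reads off a ternary digit of a point \<open>t\<close> of the Cantor set. As in
  Schoenberg's curve, the digits number \<open>prod_encode (k, m)\<close> are the binary digits of coordinate \<open>k\<close>.
\<close>

definition cantor_bit :: "real \<Rightarrow> real" where
  "cantor_bit t = max 0 (min 1 (1/2 - cos (pi * t)))"

definition cantor_sum :: "(nat \<Rightarrow> real) \<Rightarrow> real" where
  "cantor_sum b = (\<Sum>n. 2 * b n / 3 ^ Suc n)"

definition hilbert_curve :: "nat \<Rightarrow> real \<Rightarrow> real" where
  "hilbert_curve k t = (\<Sum>m. cantor_bit (3 ^ prod_encode (k, m) * t) / 2 ^ Suc m)"

text \<open>The floor formula gives \<open>0\<close> for all digits of \<open>1\<close>, which needs the expansion \<open>0.111...\<close>.\<close>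

definition binary_digit :: "real \<Rightarrow> nat \<Rightarrow> real" where
  "binary_digit x n =
     (if x = 1 then 1 else of_int \<lfloor>2 ^ Suc n * x\<rfloor> - 2 * of_int \<lfloor>2 ^ n * x\<rfloor>)"

text \<open>A right inverse of the curve on the cube. It carries finite samples and measurable
  functions to the line; limits are taken through the curve, which is the continuous one of the
  two.\<close>

definition hilbert_code :: "(nat \<Rightarrow> real) \<Rightarrow> real" where
  "hilbert_code x =
     cantor_sum (\<lambda>n. binary_digit (x (fst (prod_decode n))) (snd (prod_decode n)))"

section \<open>Ternary expansions of points of the Cantor set\<close>

lemma sums_third: "(\<lambda>n. 2 / 3 ^ Suc n :: real) sums 1"
  using sums_mult[OF geometric_sums[of "1/3::real"], of "2/3"] by (simp add: field_simps)

lemma summable_cantor: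
  assumes "\<And>n. 0 \<le> b n" "\<And>n. b n \<le> (1::real)"
  shows "summable (\<lambda>n. 2 * b n / 3 ^ Suc n)"
proof (rule summable_comparison_test[OF _ sums_summable[OF sums_third]])
  show "\<exists>N. \<forall>n\<ge>N. norm (2 * b n / 3 ^ Suc n) \<le> 2 / 3 ^ Suc n"
    using assms by (auto simp: field_simps abs_mult)
qed

lemma cantor_sum_bounds:
  assumes "\<And>n. 0 \<le> b n" "\<And>n. b n \<le> (1::real)"
  shows "0 \<le> cantor_sum b" "cantor_sum b \<le> 1"
proof -
  show "0 \<le> cantor_sum b"
    unfolding cantor_sum_def using assms by (intro suminf_nonneg summable_cantor) auto
  have "cantor_sum b \<le> (\<Sum>n. 2 / 3 ^ Suc n)"
    unfolding cantor_sum_def using assms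
    by (intro suminf_le summable_cantor sums_summable[OF sums_third]) (auto simp: field_simps)
  then show "cantor_sum b \<le> 1"
    using sums_unique[OF sums_third] by simp
qed

text \<open>For binary \<open>b\<close> the integer released by multiplication with 3 is 0 or 2;
  being even, it is absorbed by the period of \<open>cantor_bit\<close>.\<close>

lemma cantor_sum_shift:
  assumes "\<And>n. 0 \<le> b n" "\<And>n. b n \<le> (1::real)"
  shows "3 * cantor_sum b = 2 * b 0 + cantor_sum (\<lambda>n. b (Suc n))"
proof -
  have s: "summable (\<lambda>n. 2 * b (Suc n) / 3 ^ Suc n)"
    using assms by (intro summable_cantor) auto
  have "cantor_sum b = (\<Sum>n. 2 * b (Suc n) / 3 ^ Suc (Suc n)) + 2 * b 0 / 3"
    unfolding cantor_sum_def using suminf_split_head[OF summable_cantor[of b, OF assms]] by simp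
  also have "(\<Sum>n. 2 * b (Suc n) / 3 ^ Suc (Suc n)) = (\<Sum>n. (1/3) * (2 * b (Suc n) / 3 ^ Suc n))"
    by (intro suminf_cong) simp
  also have "\<dots> = (1/3) * (\<Sum>n. 2 * b (Suc n) / 3 ^ Suc n)"
    by (intro suminf_mult s)
  finally show ?thesis unfolding cantor_sum_def by simp
qed

text \<open>Modulo even integers, \<open>3 ^ n * cantor_sum b\<close> is the expansion that starts
  with the digit \<open>2 * b n\<close>, so it lies in [0, 1/3] or in [2/3, 1]. The cosine in
  \<open>cantor_bit\<close> is then at least 1/2, respectively at most -1/2, and the truncation
  yields exactly 0 or 1.\<close>

lemma cantor_bit_sum:
  assumes "\<And>n. b n = 0 \<or> b n = (1::real)"
  shows "cantor_bit (3 ^ n * cantor_sum b) = b n"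
proof -
  have b: "0 \<le> b n" "b n \<le> 1" for n using assms[of n] by auto
  have "\<exists>K::nat. 3 ^ n * cantor_sum b = 2 * real K + cantor_sum (\<lambda>i. b (i + n))"
  proof (induction n)
    case 0
    show ?case by (intro exI[of _ 0]) simp
  next
    case (Suc n)
    then obtain K :: nat where K: "3 ^ n * cantor_sum b = 2 * real K + cantor_sum (\<lambda>i. b (i + n))"
      by blast
    have "3 ^ Suc n * cantor_sum b = 6 * real K + 3 * cantor_sum (\<lambda>i. b (i + n))"
      using K by simp
    also have "3 * cantor_sum (\<lambda>i. b (i + n)) = 2 * b n + cantor_sum (\<lambda>i. b (i + Suc n))"
      using cantor_sum_shift[of "\<lambda>i. b (i + n)"] b by simp
    also have "6 * real K + \<dots> = 2 * real (3 * K + (if b n = 0 then 0 else 1)) + cantor_sum (\<lambda>i. b (i + Suc n))"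
      using assms[of n] by auto
    finally show ?case by blast
  qed
  then obtain K :: nat where K: "3 ^ n * cantor_sum b = 2 * real K + cantor_sum (\<lambda>i. b (i + n))"
    by blast
  define y where "y = cantor_sum (\<lambda>i. b (i + n))"
  have y: "3 * y = 2 * b n + cantor_sum (\<lambda>i. b (Suc i + n))"
    unfolding y_def using cantor_sum_shift[of "\<lambda>i. b (i + n)"] b by simp
  have tail: "0 \<le> cantor_sum (\<lambda>i. b (Suc i + n))" "cantor_sum (\<lambda>i. b (Suc i + n)) \<le> 1"
    using b by (intro cantor_sum_bounds; simp)+
  have "pi * (3 ^ n * cantor_sum b) = pi * y + 2 * real K * pi"
    unfolding K y_def by (simp add: algebra_simps)
  then have "cos (pi * (3 ^ n * cantor_sum b)) = cos (pi * y)"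
    by (simp only: cos_add cos_2npi sin_2npi)
  moreover have "cos (pi * y) \<ge> 1/2" if "b n = 0"
  proof -
    have "pi * y \<le> pi / 3" using y tail that by simp
    then have "cos (pi / 3) \<le> cos (pi * y)"
      using y tail that by (intro cos_monotone_0_pi_le) auto
    then show ?thesis by (simp add: cos_60)
  qed
  moreover have "cos (pi * y) \<le> - 1/2" if "b n = 1"
  proof -
    have "y \<le> 1" "y \<ge> 2/3" using y tail that by auto
    then have "pi * y \<ge> 2 * pi / 3" "pi * y \<le> pi * 1"
      by (simp_all add: field_simps)
    then have "cos (pi * y) \<le> cos (2 * pi / 3)"
      by (intro cos_monotone_0_pi_le) auto
    then show ?thesis by (simp add: cos_120)
  qed
  ultimately show ?thesis
    using assms[of n] unfolding cantor_bit_def by auto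
qed

section \<open>Binary expansions and the coordinates of the curve\<close>

lemma binary_digit_cases:
  assumes "0 \<le> x" "x \<le> 1"
  shows "binary_digit x n = 0 \<or> binary_digit x n = 1"
proof -
  have "\<lfloor>2 * (2 ^ n * x)\<rfloor> - 2 * \<lfloor>2 ^ n * x\<rfloor> = 0 \<or> \<lfloor>2 * (2 ^ n * x)\<rfloor> - 2 * \<lfloor>2 ^ n * x\<rfloor> = 1"
    by linarith
  then have "real_of_int \<lfloor>2 * (2 ^ n * x)\<rfloor> - 2 * real_of_int \<lfloor>2 ^ n * x\<rfloor> = 0
      \<or> real_of_int \<lfloor>2 * (2 ^ n * x)\<rfloor> - 2 * real_of_int \<lfloor>2 ^ n * x\<rfloor> = 1"
    by linarith
  then show ?thesis unfolding binary_digit_def by (simp add: mult.assoc)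
qed

lemma sums_half: "(\<lambda>n. 1 / 2 ^ Suc n :: real) sums 1"
  using sums_mult[OF geometric_sums[of "1/2::real"], of "1/2"] by (simp add: field_simps)

lemma binary_digit_sums:
  assumes "0 \<le> x" "x \<le> 1"
  shows "(\<lambda>n. binary_digit x n / 2 ^ Suc n) sums x"
proof (cases "x = 1")
  case True
  then show ?thesis using sums_half by (simp add: binary_digit_def)
next
  case False
  \<comment> \<open>Consecutive digits telescope, so the partial sums are the truncations of
    \<open>x\<close> to \<open>n\<close> binary places.\<close>
  have part: "(\<Sum>k<n. binary_digit x k / 2 ^ Suc k) = of_int \<lfloor>2 ^ n * x\<rfloor> / 2 ^ n" for n
  proof (induction n)
    case 0
    have "\<lfloor>x\<rfloor> = 0" using assms False by linarith
    then show ?case by simp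
  next
    case (Suc n)
    then show ?case using False by (simp add: binary_digit_def field_simps)
  qed
  have "(\<lambda>n. of_int \<lfloor>2 ^ n * x\<rfloor> / 2 ^ n) \<longlonglongrightarrow> x"
  proof (rule tendsto_sandwich[of "\<lambda>n. x - 1 / 2 ^ n" _ _ "\<lambda>_. x"])
    show "\<forall>\<^sub>F n in sequentially. x - 1 / 2 ^ n \<le> of_int \<lfloor>2 ^ n * x\<rfloor> / 2 ^ n"
    proof (intro always_eventually allI)
      fix n
      have "2 ^ n * x - 1 \<le> of_int \<lfloor>2 ^ n * x\<rfloor>" by linarith
      then have "(2 ^ n * x - 1) / 2 ^ n \<le> of_int \<lfloor>2 ^ n * x\<rfloor> / 2 ^ n"
        by (intro divide_right_mono) auto
      then show "x - 1 / 2 ^ n \<le> of_int \<lfloor>2 ^ n * x\<rfloor> / 2 ^ n" by (simp add: diff_divide_distrib)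
    qed
    show "\<forall>\<^sub>F n in sequentially. of_int \<lfloor>2 ^ n * x\<rfloor> / 2 ^ n \<le> x"
    proof (intro always_eventually allI)
      fix n
      have "of_int \<lfloor>2 ^ n * x\<rfloor> \<le> 2 ^ n * x" by linarith
      then show "of_int \<lfloor>2 ^ n * x\<rfloor> / 2 ^ n \<le> x" by (simp add: field_simps)
    qed
    have "(\<lambda>n. (1/2::real) ^ n) \<longlonglongrightarrow> 0" by (intro LIMSEQ_power_zero) simp
    then have "(\<lambda>n. 1 / 2 ^ n :: real) \<longlonglongrightarrow> 0" by (simp add: power_one_over)
    then show "(\<lambda>n. x - 1 / 2 ^ n) \<longlonglongrightarrow> x"
      using tendsto_diff[OF tendsto_const[of x]] by fastforce
  qed simp
  then show ?thesis unfolding sums_def part .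
qed

lemma cantor_bit_bounds: "0 \<le> cantor_bit t" "cantor_bit t \<le> 1"
  unfolding cantor_bit_def by auto

lemma hilbert_curve_summable:
  "summable (\<lambda>m. cantor_bit (3 ^ prod_encode (k, m) * t) / 2 ^ Suc m)"
  by (rule summable_comparison_test[OF _ sums_summable[OF sums_half]])
    (auto simp: field_simps cantor_bit_bounds abs_of_nonneg)

lemma continuous_cantor_bit: "continuous_on UNIV cantor_bit"
  unfolding cantor_bit_def[abs_def] by (intro continuous_intros)

lemma continuous_hilbert_curve: "continuous_on UNIV (hilbert_curve k)"
proof -
  have "uniform_limit UNIV (\<lambda>n t. \<Sum>m<n. cantor_bit (3 ^ prod_encode (k, m) * t) / 2 ^ Suc m)
      (hilbert_curve k) sequentially"
    unfolding hilbert_curve_def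
    by (rule Weierstrass_m_test[OF _ sums_summable[OF sums_half]])
      (auto simp: field_simps cantor_bit_bounds abs_of_nonneg)
  then show ?thesis
    by (rule uniform_limit_theorem[rotated])
      (auto intro!: always_eventually continuous_intros continuous_on_compose2[OF continuous_cantor_bit])
qed

lemma hilbert_curve_measurable [measurable]: "hilbert_curve k \<in> borel_measurable borel"
  by (rule borel_measurable_continuous_onI[OF continuous_hilbert_curve])

text \<open>The bits of different coordinates occupy disjoint digit positions of one Cantor point.
  Hence every sequence in the cube lies on the curve and is recovered coordinate by
  coordinate.\<close>

lemma hilbert_curve_code:
  assumes "\<And>k. 0 \<le> x k" "\<And>k. x k \<le> 1"
  shows "hilbert_curve k (hilbert_code x) = x k"
proof -
  have "cantor_bit (3 ^ prod_encode (k, m) * hilbert_code x) = binary_digit (x k) m" for m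
    unfolding hilbert_code_def
    by (subst cantor_bit_sum) (auto simp: binary_digit_cases[OF assms])
  then show ?thesis
    unfolding hilbert_curve_def using binary_digit_sums[OF assms, of k] by (simp add: sums_iff)
qed

lemma hilbert_code_bounds:
  assumes "\<And>k. 0 \<le> x k" "\<And>k. x k \<le> 1"
  shows "0 \<le> hilbert_code x" "hilbert_code x \<le> 1"
proof -
  have "0 \<le> binary_digit (x k) m" "binary_digit (x k) m \<le> 1" for k m
    using binary_digit_cases[OF assms, of k m] by auto
  then show "0 \<le> hilbert_code x" "hilbert_code x \<le> 1"
    unfolding hilbert_code_def by (intro cantor_sum_bounds; simp)+
qed

lemma hilbert_code_measurable [measurable]:
  assumes [measurable]: "\<And>k. x k \<in> borel_measurable M"
  shows "(\<lambda>\<omega>. hilbert_code (\<lambda>k. x k \<omega>)) \<in> borel_measurable M"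
  unfolding hilbert_code_def cantor_sum_def binary_digit_def by measurable

section \<open>Products of the uniform measure\<close>

text \<open>Equality is checked on rectangles, whose preimages are cylinders over the two
  indices.\<close>

lemma distr_PiM_pair:
  assumes M: "prob_space M" and ij: "i \<in> I" "j \<in> I" "i \<noteq> j"
  shows "distr (Pi\<^sub>M I (\<lambda>_. M)) (M \<Otimes>\<^sub>M M) (\<lambda>x. (x i, x j)) = M \<Otimes>\<^sub>M M"
proof (rule pair_measure_eqI[symmetric])
  interpret M: prob_space M by fact
  show "sigma_finite_measure M" "sigma_finite_measure M" by unfold_locales
  show "sets (M \<Otimes>\<^sub>M M) = sets (distr (Pi\<^sub>M I (\<lambda>_. M)) (M \<Otimes>\<^sub>M M) (\<lambda>x. (x i, x j)))" by simp
  fix A B assume AB: "A \<in> sets M" "B \<in> sets M"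
  define C where "C = (\<lambda>_. A)(j := B)"
  have [measurable]: "(\<lambda>x. (x i, x j)) \<in> Pi\<^sub>M I (\<lambda>_. M) \<rightarrow>\<^sub>M M \<Otimes>\<^sub>M M"
    using ij by measurable
  have "emeasure (distr (Pi\<^sub>M I (\<lambda>_. M)) (M \<Otimes>\<^sub>M M) (\<lambda>x. (x i, x j))) (A \<times> B)
      = emeasure (Pi\<^sub>M I (\<lambda>_. M)) ((\<lambda>x. (x i, x j)) -` (A \<times> B) \<inter> space (Pi\<^sub>M I (\<lambda>_. M)))"
    using AB by (intro emeasure_distr) auto
  also have "(\<lambda>x. (x i, x j)) -` (A \<times> B) \<inter> space (Pi\<^sub>M I (\<lambda>_. M))
      = prod_emb I (\<lambda>_. M) {i, j} (\<Pi>\<^sub>E k\<in>{i, j}. C k)"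
    using ij AB sets.sets_into_space by (auto simp: prod_emb_def space_PiM C_def PiE_iff)
  also have "emeasure (Pi\<^sub>M I (\<lambda>_. M)) \<dots> = (\<Prod>k\<in>{i, j}. emeasure M (C k))"
    using ij AB by (intro emeasure_PiM_emb M) (auto simp: C_def)
  also have "\<dots> = emeasure M A * emeasure M B"
    using ij by (simp add: C_def)
  finally show "emeasure M A * emeasure M B
      = emeasure (distr (Pi\<^sub>M I (\<lambda>_. M)) (M \<Otimes>\<^sub>M M) (\<lambda>x. (x i, x j))) (A \<times> B)" by simp
qed

lemma AE_PiM_pair:
  assumes M: "prob_space M" and ij: "i \<in> I" "j \<in> I" "i \<noteq> j"
    and P: "AE z in M \<Otimes>\<^sub>M M. P z"
  shows "AE x in Pi\<^sub>M I (\<lambda>_. M). P (x i, x j)"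
proof (rule AE_distrD[of "\<lambda>x. (x i, x j)" _ "M \<Otimes>\<^sub>M M" P])
  show "(\<lambda>x. (x i, x j)) \<in> Pi\<^sub>M I (\<lambda>_. M) \<rightarrow>\<^sub>M M \<Otimes>\<^sub>M M"
    using ij by measurable
  show "AE z in distr (Pi\<^sub>M I (\<lambda>_. M)) (M \<Otimes>\<^sub>M M) (\<lambda>x. (x i, x j)). P z"
    unfolding distr_PiM_pair[OF M ij] by (rule P)
qed

lemma integral_PiM_pair:
  fixes f :: "'a \<times> 'a \<Rightarrow> real"
  assumes M: "prob_space M" and ij: "i \<in> I" "j \<in> I" "i \<noteq> j"
    and [measurable]: "f \<in> borel_measurable (M \<Otimes>\<^sub>M M)"
  shows "(\<integral>x. f (x i, x j) \<partial>Pi\<^sub>M I (\<lambda>_. M)) = (\<integral>z. f z \<partial>(M \<Otimes>\<^sub>M M))"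
proof -
  have [measurable]: "(\<lambda>x. (x i, x j)) \<in> Pi\<^sub>M I (\<lambda>_. M) \<rightarrow>\<^sub>M M \<Otimes>\<^sub>M M"
    using ij by measurable
  have "(\<integral>z. f z \<partial>(M \<Otimes>\<^sub>M M))
      = (\<integral>z. f z \<partial>distr (Pi\<^sub>M I (\<lambda>_. M)) (M \<Otimes>\<^sub>M M) (\<lambda>x. (x i, x j)))"
    by (simp add: distr_PiM_pair[OF M ij])
  also have "\<dots> = (\<integral>x. f (x i, x j) \<partial>Pi\<^sub>M I (\<lambda>_. M))"
    by (rule integral_distr) measurable
  finally show ?thesis by simp
qed

section \<open>One map applied to both coordinates of a product\<close>

text \<open>\<open>L\<close> is kept apart from the target \<open>M\<close> so that a law computed
  over \<open>borel\<close> can be used when it equals a measure with the same sets, such as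
  \<open>unit_borel\<close>.\<close>

lemma distr_pair_same:
  assumes "f \<in> N \<rightarrow>\<^sub>M M" "distr N M f = L" "prob_space N" "sets L = sets M"
  shows "distr (N \<Otimes>\<^sub>M N) (L \<Otimes>\<^sub>M L) (\<lambda>z. (f (fst z), f (snd z))) = L \<Otimes>\<^sub>M L"
proof -
  interpret N: prob_space N by fact
  interpret L: prob_space "distr N M f" by (rule N.prob_space_distr) fact
  have "distr N M f \<Otimes>\<^sub>M distr N M f = distr (N \<Otimes>\<^sub>M N) (M \<Otimes>\<^sub>M M) (\<lambda>(x, y). (f x, f y))"
    by (rule pair_measure_distr[OF assms(1) assms(1)]) unfold_locales
  also have "\<dots> = distr (N \<Otimes>\<^sub>M N) (L \<Otimes>\<^sub>M L) (\<lambda>z. (f (fst z), f (snd z)))"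
    using assms(4) by (intro distr_cong sets_pair_measure_cong) auto
  finally show ?thesis unfolding assms(2) by simp
qed

lemma integral_pair_map:
  fixes K :: "'b \<times> 'b \<Rightarrow> real"
  assumes f: "f \<in> N \<rightarrow>\<^sub>M M" "distr N M f = L" "prob_space N" "sets L = sets M"
    and K: "K \<in> borel_measurable (L \<Otimes>\<^sub>M L)"
  shows "(\<integral>z. K (f (fst z), f (snd z)) \<partial>(N \<Otimes>\<^sub>M N)) = (\<integral>z. K z \<partial>(L \<Otimes>\<^sub>M L))"
proof -
  have [measurable]: "f \<in> N \<rightarrow>\<^sub>M L" using f by (simp cong: measurable_cong_sets)
  have "(\<integral>z. K z \<partial>(L \<Otimes>\<^sub>M L))
      = (\<integral>z. K z \<partial>distr (N \<Otimes>\<^sub>M N) (L \<Otimes>\<^sub>M L) (\<lambda>z. (f (fst z), f (snd z))))"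
    by (simp only: distr_pair_same[OF f])
  also have "\<dots> = (\<integral>z. K (f (fst z), f (snd z)) \<partial>(N \<Otimes>\<^sub>M N))"
    by (rule integral_distr[OF _ K]) measurable
  finally show ?thesis by simp
qed

lemma AE_pair_map:
  assumes f: "f \<in> N \<rightarrow>\<^sub>M M" "distr N M f = L" "prob_space N" "sets L = sets M"
    and P: "AE z in L \<Otimes>\<^sub>M L. P (fst z) (snd z)"
  shows "AE z in N \<Otimes>\<^sub>M N. P (f (fst z)) (f (snd z))"
proof -
  have [measurable]: "f \<in> N \<rightarrow>\<^sub>M L" using f by (simp cong: measurable_cong_sets)
  have "AE z in distr (N \<Otimes>\<^sub>M N) (L \<Otimes>\<^sub>M L) (\<lambda>z. (f (fst z), f (snd z))). P (fst z) (snd z)"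
    unfolding distr_pair_same[OF f] by (rule P)
  then have "AE z in N \<Otimes>\<^sub>M N. P (fst (f (fst z), f (snd z))) (snd (f (fst z), f (snd z)))"
    by (rule AE_distrD[rotated]) measurable
  then show ?thesis by simp
qed

section \<open>The uniform distribution on Borel sets and its Lebesgue counterpart\<close>

text \<open>The space is the whole line and the mass sits on the unit interval: Borel functions on
  the line compose without range conditions, and the product carries the Borel sets of the
  plane.\<close>

definition unit_borel :: "real measure" where
  "unit_borel = uniform_measure lborel {0..1}"

lemma sets_unit_borel [simp, measurable_cong]: "sets unit_borel = sets borel"
  by (simp add: unit_borel_def)

lemma space_unit_borel [simp]: "space unit_borel = UNIV"
  by (simp add: unit_borel_def)

lemma prob_unit_borel: "prob_space unit_borel"
  unfolding unit_borel_def by (rule prob_space_uniform_measure) auto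

interpretation unit_borel: prob_space unit_borel
  by (rule prob_unit_borel)

abbreviation square_borel :: "(real \<times> real) measure" where
  "square_borel \<equiv> unit_borel \<Otimes>\<^sub>M unit_borel"

interpretation unit_borel2: pair_prob_space unit_borel unit_borel
  by unfold_locales

lemma emeasure_unit_borel:
  "A \<in> sets borel \<Longrightarrow> emeasure unit_borel A = emeasure lborel ({0..1} \<inter> A)"
  unfolding unit_borel_def by (simp add: emeasure_uniform_measure divide_ennreal_def)

lemma AE_unit_borel: "(AE x in unit_borel. P x) \<longleftrightarrow> (AE x in lborel. x \<in> {0..1} \<longrightarrow> P x)"
  unfolding unit_borel_def by (subst AE_uniform_measure) auto

lemma AE_unit_borel_Icc: "AE x in unit_borel. x \<in> {0..1}"
  by (simp add: AE_unit_borel)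

lemma AE_unit_borel_pair:
  "(AE z in square_borel. P z) \<longleftrightarrow> (AE z in lborel. z \<in> {0..1} \<times> {0..1} \<longrightarrow> P z)"
proof -
  have *: "square_borel =
      density (lborel \<Otimes>\<^sub>M lborel) (\<lambda>(x, y). indicator {0..1} x * indicator {0..1} y)"
    unfolding unit_borel_def uniform_measure_def
    by (subst pair_measure_density)
       (auto simp: divide_ennreal_def lborel.sigma_finite_measure_axioms
          intro!: finite_measure.axioms(1) prob_space.axioms(1) prob_unit_borel[unfolded unit_borel_def uniform_measure_def, simplified])
  have m: "(\<lambda>(x, y). indicator {0..1} x * indicator {0..1} y :: ennreal)
      \<in> borel_measurable (lborel \<Otimes>\<^sub>M lborel :: (real \<times> real) measure)"
    by measurable
  show ?thesis
    unfolding * lborel_prod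
    by (subst AE_density[OF m[unfolded lborel_prod]]) (auto simp: indicator_def case_prod_beta split: if_splits intro!: AE_cong)
qed

text \<open>Completion does not change which properties hold almost everywhere, so statements about
  Lebesgue measure on the square can be handled with the product of Borel measures.\<close>

lemma AE_square_lebesgue:
  "(AE z in square_lebesgue. P z) \<longleftrightarrow> (AE z in square_borel. P z)"
  unfolding AE_unit_borel_pair
  by (subst AE_restrict_space_iff)
    (auto simp: AE_completion_iff intro!: sets_completionI_sets borel_Times)

lemma AE_unit_lebesgue:
  "(AE x in unit_lebesgue. P x) \<longleftrightarrow> (AE x in unit_borel. P x)"
  unfolding AE_unit_borel
  by (subst AE_restrict_space_iff) (auto simp: AE_completion_iff)

lemma prob_unit_lebesgue: "prob_space unit_lebesgue"
  by (rule prob_space_restrict_space) auto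

interpretation unit_lebesgue: prob_space unit_lebesgue
  by (rule prob_unit_lebesgue)

lemma measurable_unit_lebesgue_id: "(\<lambda>x. x) \<in> borel_measurable unit_lebesgue"
  by (intro measurable_restrict_space1 measurable_completion) simp

text \<open>Along this identity map, almost everywhere statements and integrals for Borel sets pass
  to \<open>unit_lebesgue\<close> and to its powers.\<close>

lemma distr_unit_lebesgue_id: "distr unit_lebesgue borel (\<lambda>x. x) = unit_borel"
proof (rule measure_eqI)
  fix A assume "A \<in> sets (distr unit_lebesgue borel (\<lambda>x. x))"
  then have A: "A \<in> sets borel" by simp
  then have "emeasure (distr unit_lebesgue borel (\<lambda>x. x)) A = emeasure unit_lebesgue (A \<inter> {0..1})"
    by (subst emeasure_distr) (auto simp: space_restrict_space measurable_unit_lebesgue_id)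
  also have "\<dots> = emeasure lebesgue (A \<inter> {0..1})"
    using A by (subst emeasure_restrict_space) auto
  also have "\<dots> = emeasure unit_borel A"
    using A by (simp add: emeasure_unit_borel Int_commute)
  finally show "emeasure (distr unit_lebesgue borel (\<lambda>x. x)) A = emeasure unit_borel A" .
qed simp

section \<open>Random signs\<close>

text \<open>Extensional functions make the set finite and let sums over patterns factor over the
  edges.\<close>

definition sign_functions :: "'a set \<Rightarrow> ('a \<Rightarrow> real) set" where
  "sign_functions P = (\<Pi>\<^sub>E e\<in>P. {-1, 1})"

text \<open>
  The probability of the pattern \<open>\<sigma>\<close> when independent signs with means \<open>w e\<close> are drawn.
\<close>

definition sign_weight :: "'a set \<Rightarrow> ('a \<Rightarrow> real) \<Rightarrow> ('a \<Rightarrow> real) \<Rightarrow> real" where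
  "sign_weight P w \<sigma> = (\<Prod>e\<in>P. (1 + \<sigma> e * w e) / 2)"

lemma finite_sign_functions: "finite P \<Longrightarrow> finite (sign_functions P)"
  unfolding sign_functions_def by (intro finite_PiE) auto

lemma sign_functions_value: "\<sigma> \<in> sign_functions P \<Longrightarrow> e \<in> P \<Longrightarrow> \<sigma> e = -1 \<or> \<sigma> e = 1"
  unfolding sign_functions_def by (auto dest: PiE_mem)

lemma sign_weight_nonneg:
  assumes "\<sigma> \<in> sign_functions P" "\<And>e. e \<in> P \<Longrightarrow> \<bar>w e\<bar> \<le> 1"
  shows "0 \<le> sign_weight P w \<sigma>"
  unfolding sign_weight_def
proof (intro prod_nonneg ballI)
  fix e assume "e \<in> P"
  then show "0 \<le> (1 + \<sigma> e * w e) / 2"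
    using assms(2)[of e] sign_functions_value[OF assms(1), of e] by auto
qed

text \<open>Signs on different elements are independent, so the sum factors over \<open>P\<close>.
  An element outside \<open>D\<close> contributes total mass 1, an element of \<open>D\<close> the
  mean of a centred error, which is 0.\<close>

lemma sum_sign_weight_prod:
  assumes "finite P" "D \<subseteq> P"
  shows "(\<Sum>\<sigma>\<in>sign_functions P. sign_weight P w \<sigma> * (\<Prod>e\<in>D. \<sigma> e - w e)) = (if D = {} then 1 else 0)"
proof -
  have "(\<Sum>\<sigma>\<in>sign_functions P. sign_weight P w \<sigma> * (\<Prod>e\<in>D. \<sigma> e - w e))
      = (\<Sum>\<sigma>\<in>sign_functions P. \<Prod>e\<in>P. (1 + \<sigma> e * w e) / 2 * (if e \<in> D then \<sigma> e - w e else 1))"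
    unfolding sign_weight_def prod.distrib using assms
    by (intro sum.cong refl arg_cong2[where f="(*)"]) (simp add: prod.If_cases Int_absorb1)
  also have "\<dots> = (\<Prod>e\<in>P. \<Sum>s\<in>{-1, 1}. (1 + s * w e) / 2 * (if e \<in> D then s - w e else 1))"
    unfolding sign_functions_def using assms by (intro prod_sum_PiE[symmetric]) auto
  also have "\<dots> = (\<Prod>e\<in>P. if e \<in> D then 0 else 1)"
    by (intro prod.cong) (auto simp: field_simps)
  also have "\<dots> = (if D = {} then 1 else 0)"
  proof (cases "D = {}")
    case False
    then obtain e where "e \<in> D" by blast
    then have "\<exists>e\<in>P. (if e \<in> D then 0 else 1) = (0::real)" using assms by auto
    then show ?thesis using False assms by (simp add: prod_zero_iff)
  qed simp
  finally show ?thesis .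
qed

lemma sum_sign_weight: "finite P \<Longrightarrow> (\<Sum>\<sigma>\<in>sign_functions P. sign_weight P w \<sigma>) = 1"
  using sum_sign_weight_prod[of P "{}" w] by simp

text \<open>As a polynomial in the values \<open>w e\<close> the weight is linear in each of them.
  Its monomials are indexed by sets of edges without repetition, and this is why simple graphs are
  enough.\<close>

lemma sign_weight_expand:
  assumes "finite P"
  shows "sign_weight P w \<sigma> = (\<Sum>H\<in>Pow P. (\<Prod>e\<in>H. \<sigma> e) * (\<Prod>e\<in>H. w e)) / 2 ^ card P"
proof -
  have "sign_weight P w \<sigma> = (\<Prod>e\<in>P. \<sigma> e * w e + 1) / 2 ^ card P"
    unfolding sign_weight_def prod_dividef by (simp add: add.commute)
  then show ?thesis
    by (simp add: prod_add[OF assms] prod.distrib)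
qed

section \<open>Fourth-moment bound for the sign errors\<close>

definition vertex_pairs :: "nat \<Rightarrow> nat set set" where
  "vertex_pairs n = {e. e \<subseteq> {1..n} \<and> card e = 2}"

lemma finite_vertex_pairs [simp]: "finite (vertex_pairs n)"
  unfolding vertex_pairs_def by (rule finite_subset[of _ "Pow {1..n}"]) auto

lemma vertex_pairsI: "i \<in> {1..n} \<Longrightarrow> j \<in> {1..n} \<Longrightarrow> i \<noteq> j \<Longrightarrow> {i, j} \<in> vertex_pairs n"
  unfolding vertex_pairs_def by auto

text \<open>Loops carry no sign, hence the zero diagonal; indexing by the unordered pair makes the
  matrix symmetric.\<close>

definition sign_error :: "(nat set \<Rightarrow> real) \<Rightarrow> (nat set \<Rightarrow> real) \<Rightarrow> nat \<Rightarrow> nat \<Rightarrow> real" where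
  "sign_error w \<sigma> i j = (if i = j then 0 else \<sigma> {i, j} - w {i, j})"

text \<open>The squared Frobenius norm of the Gram matrix of the columns of \<open>N\<close>. For
  symmetric \<open>N\<close> it is the trace of the fourth power, a weighted count of closed walks
  of length four.\<close>

definition cycle_sum :: "nat \<Rightarrow> (nat \<Rightarrow> nat \<Rightarrow> real) \<Rightarrow> real" where
  "cycle_sum n N = (\<Sum>j=1..n. \<Sum>k=1..n. (\<Sum>i=1..n. N i j * N i k)\<^sup>2)"

lemma cycle_sum_expand:
  "cycle_sum n N = (\<Sum>j=1..n. \<Sum>k=1..n. \<Sum>i=1..n. \<Sum>l=1..n. N i j * N i k * (N l j * N l k))"
  unfolding cycle_sum_def power2_eq_square by (simp add: sum_product)

lemma cycle_sum_nonneg: "0 \<le> cycle_sum n N"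
  unfolding cycle_sum_def by (intro sum_nonneg) auto

text \<open>
  The four edges of a nondegenerate closed walk \<open>j, i, k, l\<close> are distinct, so that the errors on them
  are independent and centred.
\<close>

lemma sum_sign_weight_cycle:
  assumes w: "\<And>e. e \<in> vertex_pairs n \<Longrightarrow> \<bar>w e\<bar> \<le> 1"
    and I: "i \<in> {1..n}" "j \<in> {1..n}" "k \<in> {1..n}" "l \<in> {1..n}"
  shows "(\<Sum>\<sigma>\<in>sign_functions (vertex_pairs n). sign_weight (vertex_pairs n) w \<sigma> *
      (sign_error w \<sigma> i j * sign_error w \<sigma> i k * (sign_error w \<sigma> l j * sign_error w \<sigma> l k)))
    \<le> (if i = l then 16 else 0) + (if j = k then 16 else 0)" (is "?S \<le> _")
proof (cases "i = l \<or> j = k")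
  case True
  \<comment> \<open>No cancellation is available on a degenerate walk: each of the four errors is at
    most 2 in absolute value, whence 16.\<close>
  have N: "\<bar>sign_error w \<sigma> a b\<bar> \<le> 2"
    if "\<sigma> \<in> sign_functions (vertex_pairs n)" "a \<in> {1..n}" "b \<in> {1..n}" for \<sigma> a b
    using sign_functions_value[OF that(1), of "{a, b}"] w[of "{a, b}"] vertex_pairsI[of a n b] that
    unfolding sign_error_def by auto
  have "?S \<le> (\<Sum>\<sigma>\<in>sign_functions (vertex_pairs n). sign_weight (vertex_pairs n) w \<sigma> * 16)"
  proof (intro sum_mono mult_left_mono sign_weight_nonneg w)
    fix \<sigma> assume \<sigma>: "\<sigma> \<in> sign_functions (vertex_pairs n)"
    have "\<bar>sign_error w \<sigma> i j * sign_error w \<sigma> i k * (sign_error w \<sigma> l j * sign_error w \<sigma> l k)\<bar>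
        \<le> 2 * 2 * (2 * 2)"
      unfolding abs_mult using N[OF \<sigma>] I by (intro mult_mono) auto
    then show "sign_error w \<sigma> i j * sign_error w \<sigma> i k * (sign_error w \<sigma> l j * sign_error w \<sigma> l k) \<le> 16"
      by simp
  qed
  also have "\<dots> = 16"
    by (simp add: sum_distrib_right[symmetric] sum_sign_weight)
  finally show ?thesis using True by auto
next
  case False
  \<comment> \<open>A walk that uses a loop vanishes by the zero diagonal; otherwise the four edges
    are pairwise distinct and independence applies.\<close>
  show ?thesis
  proof (cases "i = j \<or> i = k \<or> l = j \<or> l = k")
    case True
    then have "?S = 0" by (intro sum.neutral) (auto simp: sign_error_def)
    then show ?thesis by simp
  next
    case F: False
    have d: "{i, j} \<noteq> {i, k}" "{i, j} \<noteq> {l, j}" "{i, j} \<noteq> {l, k}" "{i, k} \<noteq> {l, j}"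
        "{i, k} \<noteq> {l, k}" "{l, j} \<noteq> {l, k}"
      using False F by (auto simp: doubleton_eq_iff)
    have "?S = (\<Sum>\<sigma>\<in>sign_functions (vertex_pairs n). sign_weight (vertex_pairs n) w \<sigma> *
        (\<Prod>e\<in>{{i, j}, {i, k}, {l, j}, {l, k}}. \<sigma> e - w e))"
      using d F by (intro sum.cong refl) (simp add: sign_error_def)
    also have "\<dots> = 0"
      using I F by (subst sum_sign_weight_prod) (auto intro!: vertex_pairsI)
    finally show ?thesis by simp
  qed
qed

text \<open>Only quadruples with \<open>i = l\<close> or with \<open>j = k\<close> contribute,
  \<open>n ^ 3\<close> of each kind and at most 16 apiece. The gain of one power of \<open>n\<close>
  over the trivial order \<open>n ^ 4\<close> makes the errors negligible as bilinear forms.\<close>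

lemma sum_sign_weight_cycle_sum:
  assumes w: "\<And>e. e \<in> vertex_pairs n \<Longrightarrow> \<bar>w e\<bar> \<le> 1"
  shows "(\<Sum>\<sigma>\<in>sign_functions (vertex_pairs n).
      sign_weight (vertex_pairs n) w \<sigma> * cycle_sum n (sign_error w \<sigma>)) \<le> 32 * real n ^ 3"
proof -
  let ?S = "\<lambda>i j k l. \<Sum>\<sigma>\<in>sign_functions (vertex_pairs n). sign_weight (vertex_pairs n) w \<sigma> *
      (sign_error w \<sigma> i j * sign_error w \<sigma> i k * (sign_error w \<sigma> l j * sign_error w \<sigma> l k))"
  have "(\<Sum>\<sigma>\<in>sign_functions (vertex_pairs n).
      sign_weight (vertex_pairs n) w \<sigma> * cycle_sum n (sign_error w \<sigma>))
    = (\<Sum>j=1..n. \<Sum>k=1..n. \<Sum>i=1..n. \<Sum>l=1..n. ?S i j k l)"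
    unfolding cycle_sum_expand sum_distrib_left
    by (subst sum.swap, intro sum.cong refl)+
  also have "\<dots> \<le> (\<Sum>j=1..n. \<Sum>k=1..n. \<Sum>i=1..n. \<Sum>l=1..n.
      (if i = l then 16 else 0) + (if j = k then 16 else 0))"
    by (intro sum_mono sum_sign_weight_cycle w) auto
  also have "\<dots> = 32 * real n ^ 3"
    by (simp add: sum.distrib sum.delta sum_distrib_left[symmetric] power3_eq_cube)
  finally show ?thesis .
qed

text \<open>The Cauchy-Schwarz inequality is applied twice: the first time it removes
  \<open>a\<close> and leaves a quadratic form in \<open>b\<close> with the Gram matrix
  \<open>M\<close>, the second time it removes \<open>b\<close>. Each costs a factor that depends on
  \<open>n\<close> alone, so the bound is uniform in the coefficients.\<close>

lemma bilinear_le_cycle_sum: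
  fixes N :: "nat \<Rightarrow> nat \<Rightarrow> real"
  assumes a: "\<And>i. i \<in> {1..n} \<Longrightarrow> \<bar>a i\<bar> \<le> 1" and b: "\<And>i. i \<in> {1..n} \<Longrightarrow> \<bar>b i\<bar> \<le> 1"
  shows "(\<Sum>i=1..n. \<Sum>j=1..n. a i * b j * N i j) ^ 4 \<le> real n ^ 4 * cycle_sum n N"
proof -
  define u where "u i = (\<Sum>j=1..n. b j * N i j)" for i
  define M where "M j k = (\<Sum>i=1..n. N i j * N i k)" for j k
  have sq: "x\<^sup>2 \<le> 1" if "\<bar>x\<bar> \<le> 1" for x :: real
    using that by (simp add: abs_square_le_1)
  have "(\<Sum>i=1..n. \<Sum>j=1..n. a i * b j * N i j)\<^sup>2 = (\<Sum>i=1..n. a i * u i)\<^sup>2"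
    unfolding u_def by (simp add: sum_distrib_left mult.assoc)
  also have "\<dots> \<le> (\<Sum>i=1..n. (a i)\<^sup>2) * (\<Sum>i=1..n. (u i)\<^sup>2)"
    by (rule Cauchy_Schwarz_ineq_sum)
  also have "\<dots> \<le> real n * (\<Sum>i=1..n. (u i)\<^sup>2)"
  proof (intro mult_right_mono sum_nonneg)
    have "(\<Sum>i=1..n. (a i)\<^sup>2) \<le> (\<Sum>i=1..n. 1)" by (intro sum_mono sq a) auto
    then show "(\<Sum>i=1..n. (a i)\<^sup>2) \<le> real n" by simp
  qed auto
  finally have 1: "(\<Sum>i=1..n. \<Sum>j=1..n. a i * b j * N i j)\<^sup>2 \<le> real n * (\<Sum>i=1..n. (u i)\<^sup>2)" .
  have "(\<Sum>i=1..n. (u i)\<^sup>2) = (\<Sum>i=1..n. \<Sum>j=1..n. \<Sum>k=1..n. b j * N i j * (b k * N i k))"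
    unfolding u_def power2_eq_square by (simp add: sum_product)
  also have "\<dots> = (\<Sum>j=1..n. \<Sum>i=1..n. \<Sum>k=1..n. b j * N i j * (b k * N i k))"
    by (rule sum.swap)
  also have "\<dots> = (\<Sum>j=1..n. \<Sum>k=1..n. \<Sum>i=1..n. b j * N i j * (b k * N i k))"
    by (intro sum.cong refl sum.swap)
  also have "\<dots> = (\<Sum>j=1..n. \<Sum>k=1..n. b j * b k * M j k)"
    unfolding M_def by (simp add: sum_distrib_left mult_ac)
  also have "\<dots> = (\<Sum>z\<in>{1..n}\<times>{1..n}. (b (fst z) * b (snd z)) * M (fst z) (snd z))"
    by (simp add: sum.cartesian_product case_prod_beta)
  finally have "(\<Sum>i=1..n. (u i)\<^sup>2)\<^sup>2
      = (\<Sum>z\<in>{1..n}\<times>{1..n}. (b (fst z) * b (snd z)) * M (fst z) (snd z))\<^sup>2" by simp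
  also have "\<dots> \<le> (\<Sum>z\<in>{1..n}\<times>{1..n}. (b (fst z) * b (snd z))\<^sup>2) *
      (\<Sum>z\<in>{1..n}\<times>{1..n}. (M (fst z) (snd z))\<^sup>2)"
    by (rule Cauchy_Schwarz_ineq_sum)
  also have "\<dots> \<le> (real n)\<^sup>2 * (\<Sum>z\<in>{1..n}\<times>{1..n}. (M (fst z) (snd z))\<^sup>2)"
  proof (intro mult_right_mono sum_nonneg)
    have "(\<Sum>z\<in>{1..n}\<times>{1..n}. (b (fst z) * b (snd z))\<^sup>2) \<le> (\<Sum>z\<in>{1..n}\<times>{1..n}. 1)"
    proof (intro sum_mono sq)
      fix z assume "z \<in> {1..n}\<times>{1..n}"
      then have "\<bar>b (fst z)\<bar> * \<bar>b (snd z)\<bar> \<le> 1 * 1" by (intro mult_mono b) auto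
      then show "\<bar>b (fst z) * b (snd z)\<bar> \<le> 1" by (simp add: abs_mult)
    qed
    then show "(\<Sum>z\<in>{1..n}\<times>{1..n}. (b (fst z) * b (snd z))\<^sup>2) \<le> (real n)\<^sup>2"
      by (simp add: power2_eq_square)
  qed auto
  also have "(\<Sum>z\<in>{1..n}\<times>{1..n}. (M (fst z) (snd z))\<^sup>2) = cycle_sum n N"
    unfolding cycle_sum_def M_def by (simp add: sum.cartesian_product case_prod_beta)
  finally have 2: "(\<Sum>i=1..n. (u i)\<^sup>2)\<^sup>2 \<le> (real n)\<^sup>2 * cycle_sum n N" .
  have "(\<Sum>i=1..n. \<Sum>j=1..n. a i * b j * N i j) ^ 4
      = ((\<Sum>i=1..n. \<Sum>j=1..n. a i * b j * N i j)\<^sup>2)\<^sup>2"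
    by simp
  also have "\<dots> \<le> (real n * (\<Sum>i=1..n. (u i)\<^sup>2))\<^sup>2"
    by (intro power_mono 1) auto
  also have "\<dots> \<le> (real n)\<^sup>2 * ((real n)\<^sup>2 * cycle_sum n N)"
    unfolding power_mult_distrib by (intro mult_left_mono 2) auto
  also have "\<dots> = real n ^ 4 * cycle_sum n N"
    by (simp add: power2_eq_square power4_eq_xxxx mult.assoc)
  finally show ?thesis .
qed

section \<open>Samples with a common sign pattern\<close>

text \<open>Symmetry and the bound are required at all points of the plane, which spares side
  conditions; the bound 1 makes \<open>(1 + w x y) / 2\<close> a probability.\<close>

definition borel_kernel :: "(real \<Rightarrow> real \<Rightarrow> real) \<Rightarrow> bool" where
  "borel_kernel w \<longleftrightarrow> case_prod w \<in> borel_measurable (borel \<Otimes>\<^sub>M borel) \<and>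
     (\<forall>x y. w x y = w y x) \<and> (\<forall>x y. \<bar>w x y\<bar> \<le> 1)"

definition edge_value :: "(real \<Rightarrow> real \<Rightarrow> real) \<Rightarrow> (nat \<Rightarrow> real) \<Rightarrow> nat set \<Rightarrow> real" where
  "edge_value w x e = w (x (Min e)) (x (Max e))"

abbreviation cube_borel :: "nat \<Rightarrow> (nat \<Rightarrow> real) measure" where
  "cube_borel n \<equiv> \<Pi>\<^sub>M i\<in>{1..n}. unit_borel"

definition borel_hom_density :: "nat \<Rightarrow> nat set multiset \<Rightarrow> (real \<Rightarrow> real \<Rightarrow> real) \<Rightarrow> real" where
  "borel_hom_density k E w = (\<integral>x. (\<Prod>e\<in>#E. edge_value w x e) \<partial>cube_borel k)"

lemma prob_cube_borel: "prob_space (cube_borel n)"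
  by (intro prob_space_PiM prob_unit_borel)

lemma borel_kernelD:
  assumes "borel_kernel w"
  shows "case_prod w \<in> borel_measurable (borel \<Otimes>\<^sub>M borel)" "w x y = w y x" "\<bar>w x y\<bar> \<le> 1"
  using assms unfolding borel_kernel_def by blast+

lemma borel_kernel_measurable:
  assumes "borel_kernel w" and [measurable]: "f \<in> borel_measurable M" "g \<in> borel_measurable M"
  shows "(\<lambda>x. w (f x) (g x)) \<in> borel_measurable M"
proof -
  note [measurable] = borel_kernelD(1)[OF assms(1)]
  have "(\<lambda>x. case_prod w (f x, g x)) \<in> borel_measurable M" by measurable
  then show ?thesis by simp
qed

lemma cube_component_measurable:
  "i \<in> {1..n} \<Longrightarrow> (\<lambda>x. x i) \<in> borel_measurable (cube_borel n)"
  using measurable_component_singleton[of i "{1..n}" "\<lambda>_. unit_borel"] by simp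

lemma two_set_Min_Max:
  fixes e :: "nat set"
  assumes "card e = 2"
  shows "Min e \<in> e" "Max e \<in> e" "Min e \<noteq> Max e" "e = {Min e, Max e}"
proof -
  obtain a b where e: "e = {a, b}" "a < b"
    using assms by (auto simp: card_2_iff) (metis insert_commute linorder_neqE_nat)
  then have "Min e = a" "Max e = b" by auto
  with e show "Min e \<in> e" "Max e \<in> e" "Min e \<noteq> Max e" "e = {Min e, Max e}" by auto
qed

lemma edge_value_doubleton:
  assumes "borel_kernel w"
  shows "edge_value w x {i, j} = w (x i) (x j)"
proof (cases "i \<le> j")
  case True
  then show ?thesis by (simp add: edge_value_def)
next
  case False
  then show ?thesis using borel_kernelD(2)[OF assms, of "x i" "x j"]
    by (simp add: edge_value_def min_def max_def)
qed

lemma edge_value_le: "borel_kernel w \<Longrightarrow> \<bar>edge_value w x e\<bar> \<le> 1"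
  unfolding edge_value_def by (rule borel_kernelD)

lemma edge_value_measurable:
  assumes "borel_kernel w" "e \<subseteq> {1..n}" "card e = 2"
  shows "(\<lambda>x. edge_value w x e) \<in> borel_measurable (cube_borel n)"
proof -
  have "Min e \<in> {1..n}" "Max e \<in> {1..n}"
    using two_set_Min_Max[OF assms(3)] assms(2) by auto
  then have [measurable]: "(\<lambda>x. x (Min e)) \<in> borel_measurable (cube_borel n)"
      "(\<lambda>x. x (Max e)) \<in> borel_measurable (cube_borel n)"
    by (intro cube_component_measurable; simp)+
  show ?thesis
    unfolding edge_value_def by (rule borel_kernel_measurable[OF assms(1)]) measurable
qed

lemma sign_weight_measurable:
  assumes "borel_kernel w"
  shows "(\<lambda>x. sign_weight (vertex_pairs n) (edge_value w x) \<sigma>) \<in> borel_measurable (cube_borel n)"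
  unfolding sign_weight_def
  by (intro borel_measurable_prod borel_measurable_divide borel_measurable_add
      borel_measurable_times borel_measurable_const edge_value_measurable assms)
    (auto simp: vertex_pairs_def)

lemma sign_weight_le_1:
  assumes "finite P" "\<sigma> \<in> sign_functions P" "\<And>e. e \<in> P \<Longrightarrow> \<bar>w e\<bar> \<le> 1"
  shows "sign_weight P w \<sigma> \<le> 1"
proof -
  have "sign_weight P w \<sigma> \<le> (\<Sum>\<sigma>\<in>sign_functions P. sign_weight P w \<sigma>)"
    using assms by (intro member_le_sum finite_sign_functions sign_weight_nonneg) auto
  then show ?thesis by (simp add: sum_sign_weight assms)
qed

lemma expected_sign_weight:
  assumes w: "borel_kernel w"
  shows "(\<integral>x. sign_weight (vertex_pairs n) (edge_value w x) \<sigma> \<partial>cube_borel n)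
    = (\<Sum>H\<in>Pow (vertex_pairs n). (\<Prod>e\<in>H. \<sigma> e) * borel_hom_density n (mset_set H) w) / 2 ^ card (vertex_pairs n)"
proof -
  interpret C: prob_space "cube_borel n" by (rule prob_cube_borel)
  have int: "integrable (cube_borel n) (\<lambda>x. \<Prod>e\<in>H. edge_value w x e)" if "H \<subseteq> vertex_pairs n" for H
  proof (rule C.integrable_const_bound[where B=1])
    show "AE x in cube_borel n. norm (\<Prod>e\<in>H. edge_value w x e) \<le> 1"
      by (intro always_eventually allI)
        (simp add: abs_prod prod_le_1 edge_value_le[OF w])
    show "(\<lambda>x. \<Prod>e\<in>H. edge_value w x e) \<in> borel_measurable (cube_borel n)"
      using that by (intro borel_measurable_prod edge_value_measurable w) (auto simp: vertex_pairs_def)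
  qed
  show ?thesis
    unfolding sign_weight_expand[OF finite_vertex_pairs] borel_hom_density_def
    using int
    by (simp add: Bochner_Integration.integral_sum prod_unfold_prod_mset[symmetric]
        finite_subset[OF _ finite_vertex_pairs])
qed

text \<open>
  The sign pattern has the same law for \<open>w\<close> and \<open>w'\<close>. If each kernel is bad on average with weight
  below \<open>1/2\<close>, some pattern is therefore compatible with a good sample of either kernel.
\<close>

lemma select_samples:
  assumes w: "borel_kernel w" "borel_kernel w'"
    and eq: "\<And>E. simple_graph n E \<Longrightarrow> borel_hom_density n E w = borel_hom_density n E w'"
    and B: "\<And>\<sigma>. \<sigma> \<in> sign_functions (vertex_pairs n) \<Longrightarrow> integrable (cube_borel n)
        (\<lambda>x. sign_weight (vertex_pairs n) (edge_value w x) \<sigma> * B x \<sigma>)"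
      "\<And>\<sigma>. \<sigma> \<in> sign_functions (vertex_pairs n) \<Longrightarrow> integrable (cube_borel n)
        (\<lambda>x. sign_weight (vertex_pairs n) (edge_value w' x) \<sigma> * B' x \<sigma>)"
    and nonneg: "\<And>x \<sigma>. 0 \<le> B x \<sigma>" "\<And>x \<sigma>. 0 \<le> B' x \<sigma>"
    and small: "(\<integral>x. (\<Sum>\<sigma>\<in>sign_functions (vertex_pairs n).
          sign_weight (vertex_pairs n) (edge_value w x) \<sigma> * B x \<sigma>) \<partial>cube_borel n) < 1 / 2"
      "(\<integral>x. (\<Sum>\<sigma>\<in>sign_functions (vertex_pairs n).
          sign_weight (vertex_pairs n) (edge_value w' x) \<sigma> * B' x \<sigma>) \<partial>cube_borel n) < 1 / 2"
  shows "\<exists>x x' \<sigma>. \<sigma> \<in> sign_functions (vertex_pairs n) \<and>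
      (\<forall>i\<in>{1..n}. x i \<in> {0..1}) \<and> (\<forall>i\<in>{1..n}. x' i \<in> {0..1}) \<and> B x \<sigma> < 1 \<and> B' x' \<sigma> < 1"
proof -
  interpret C: prob_space "cube_borel n" by (rule prob_cube_borel)
  let ?S = "sign_functions (vertex_pairs n)"
  let ?p = "\<lambda>w x \<sigma>. sign_weight (vertex_pairs n) (edge_value w x) \<sigma>"
  define q where "q \<sigma> = (\<integral>x. ?p w x \<sigma> \<partial>cube_borel n)" for \<sigma>
  have simple: "simple_graph n (mset_set H)" if "H \<subseteq> vertex_pairs n" for H
    using that finite_subset[OF that finite_vertex_pairs]
    unfolding simple_graph_def multigraph_def vertex_pairs_def by (auto simp: count_mset_set')
  have q': "q \<sigma> = (\<integral>x. ?p w' x \<sigma> \<partial>cube_borel n)" for \<sigma>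
    unfolding q_def expected_sign_weight[OF w(1)] expected_sign_weight[OF w(2)]
    using eq simple by (intro arg_cong2[where f="(/)"] sum.cong) auto
  have intp: "integrable (cube_borel n) (\<lambda>x. ?p w x \<sigma>)" if "borel_kernel w" "\<sigma> \<in> ?S" for w \<sigma>
    using that
    by (intro C.integrable_const_bound[where B=1] always_eventually allI sign_weight_measurable)
      (simp add: abs_of_nonneg sign_weight_nonneg sign_weight_le_1 edge_value_le)
  have "(\<Sum>\<sigma>\<in>?S. q \<sigma>) = (\<integral>x. (\<Sum>\<sigma>\<in>?S. ?p w x \<sigma>) \<partial>cube_borel n)"
    unfolding q_def by (intro Bochner_Integration.integral_sum[symmetric] intp w)
  also have "\<dots> = 1"
    using C.prob_space by (simp add: sum_sign_weight)
  finally have q1: "(\<Sum>\<sigma>\<in>?S. q \<sigma>) = 1" .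
  \<comment> \<open>The two bad parts together have mass below 1, the total of \<open>q\<close>.
    Hence for some pattern the bad masses of both kernels add up to less than the probability of
    that pattern.\<close>
  have "(\<Sum>\<sigma>\<in>?S. (\<integral>x. ?p w x \<sigma> * B x \<sigma> \<partial>cube_borel n) + (\<integral>x. ?p w' x \<sigma> * B' x \<sigma> \<partial>cube_borel n)) < 1"
    using small
      Bochner_Integration.integral_sum[of ?S "cube_borel n" "\<lambda>\<sigma> x. ?p w x \<sigma> * B x \<sigma>", OF B(1)]
      Bochner_Integration.integral_sum[of ?S "cube_borel n" "\<lambda>\<sigma> x. ?p w' x \<sigma> * B' x \<sigma>", OF B(2)]
    unfolding sum.distrib by linarith
  then have "\<not> (\<forall>\<sigma>\<in>?S. q \<sigma>
      \<le> (\<integral>x. ?p w x \<sigma> * B x \<sigma> \<partial>cube_borel n) + (\<integral>x. ?p w' x \<sigma> * B' x \<sigma> \<partial>cube_borel n))"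
    using sum_mono[of ?S q "\<lambda>\<sigma>. (\<integral>x. ?p w x \<sigma> * B x \<sigma> \<partial>cube_borel n)
      + (\<integral>x. ?p w' x \<sigma> * B' x \<sigma> \<partial>cube_borel n)"] q1 by fastforce
  then obtain \<sigma> where \<sigma>: "\<sigma> \<in> ?S"
    and lt: "(\<integral>x. ?p w x \<sigma> * B x \<sigma> \<partial>cube_borel n) + (\<integral>x. ?p w' x \<sigma> * B' x \<sigma> \<partial>cube_borel n) < q \<sigma>"
    by (meson not_le)
  have pos: "0 \<le> ?p w x \<sigma>" if "borel_kernel w" for w x
    using that \<sigma> by (intro sign_weight_nonneg edge_value_le)
  have nn: "0 \<le> (\<integral>x. ?p w x \<sigma> * B x \<sigma> \<partial>cube_borel n)" "0 \<le> (\<integral>x. ?p w' x \<sigma> * B' x \<sigma> \<partial>cube_borel n)"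
    by (intro Bochner_Integration.integral_nonneg mult_nonneg_nonneg pos w nonneg)+
  have I: "AE x in cube_borel n. \<forall>i\<in>{1..n}. x i \<in> {0..1}"
    by (intro AE_finite_allI AE_PiM_component prob_unit_borel AE_unit_borel_Icc) auto
  \<comment> \<open>If no sample in the cube had badness below 1, the weighted badness of the
    pattern would be at least its probability. Almost every sample lies in the unit cube, so the
    points can be required to do so.\<close>
  have ex: "\<exists>x. (\<forall>i\<in>{1..n}. x i \<in> {0..1}) \<and> D x < 1"
    if v: "borel_kernel v" and qv: "q \<sigma> = (\<integral>x. ?p v x \<sigma> \<partial>cube_borel n)"
      and iv: "integrable (cube_borel n) (\<lambda>x. ?p v x \<sigma> * D x)"
      and lv: "(\<integral>x. ?p v x \<sigma> * D x \<partial>cube_borel n) < q \<sigma>" for v D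
  proof (rule ccontr)
    assume "\<not> ?thesis"
    then have *: "1 \<le> D x" if "\<forall>i\<in>{1..n}. x i \<in> {0..1}" for x using that by force
    have "q \<sigma> \<le> (\<integral>x. ?p v x \<sigma> * D x \<partial>cube_borel n)"
      unfolding qv
    proof (intro integral_mono_AE intp v \<sigma> iv)
      show "AE x in cube_borel n. ?p v x \<sigma> \<le> ?p v x \<sigma> * D x"
        using I
      proof eventually_elim
        case (elim x)
        then show ?case using mult_left_mono[OF *[OF elim] pos[OF v, of x]] by simp
      qed
    qed
    with lv show False by simp
  qed
  obtain x where "\<forall>i\<in>{1..n}. x i \<in> {0..1}" "B x \<sigma> < 1"
    using ex[OF w(1) q_def B(1)[OF \<sigma>]] lt nn by auto
  moreover obtain x' where "\<forall>i\<in>{1..n}. x' i \<in> {0..1}" "B' x' \<sigma> < 1"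
    using ex[OF w(2) q' B(2)[OF \<sigma>]] lt nn by auto
  ultimately show ?thesis using \<sigma> by blast
qed

section \<open>Badness of a sample and its expectation\<close>

text \<open>The first \<open>n\<close> tests enter, so each fixed test is controlled from some
  \<open>n\<close> on; the weights keep the total variance of order \<open>1 / n\<close>.\<close>

definition discrepancy :: "nat \<Rightarrow> (nat \<Rightarrow> real \<Rightarrow> real) \<Rightarrow> (nat \<Rightarrow> real) \<Rightarrow> (nat \<Rightarrow> real) \<Rightarrow> real" where
  "discrepancy n e c x = (\<Sum>j<n. (1/2) ^ j * ((\<Sum>i=1..n. e j (x i)) / real n - c j)\<^sup>2)"

text \<open>The diagonal is left out: a repeated point does not have the law of two independent
  points, so closeness in L1 on the square says nothing there.\<close>

definition pair_average :: "nat \<Rightarrow> (real \<Rightarrow> real \<Rightarrow> real) \<Rightarrow> (nat \<Rightarrow> real) \<Rightarrow> real" where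
  "pair_average n g x = (\<Sum>i=1..n. \<Sum>j\<in>{1..n} - {i}. g (x i) (x j)) / (real n)\<^sup>2"

text \<open>
  The scaling makes the three parts contribute at most \<open>1/32\<close>, \<open>1/16\<close> and \<open>1/8\<close> to the expectation,
  while a value below \<open>1\<close> still forces all of them to vanish in the limit.
\<close>

definition sample_badness where
  "sample_badness n e c g w x \<sigma> =
     real n / 64 * discrepancy n e c x + (\<Sum>m<n. 2 ^ m * pair_average n (g m) x) +
     cycle_sum n (sign_error (edge_value w x) \<sigma>) / (256 * real n ^ 3)"

text \<open>The variance of an empirical mean: by independence the mixed products of centred values
  integrate to 0, and the \<open>n\<close> diagonal terms are at most 1 each, against a division by
  the square of \<open>n\<close>.\<close>

lemma expected_square_discrepancy:
  fixes e :: "real \<Rightarrow> real"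
  assumes [measurable]: "e \<in> borel_measurable borel" and e: "\<And>x. 0 \<le> e x" "\<And>x. e x \<le> 1"
    and c: "c = (\<integral>x. e x \<partial>unit_borel)" and n: "0 < n"
  shows "integrable (cube_borel n) (\<lambda>x. ((\<Sum>i=1..n. e (x i)) / real n - c)\<^sup>2)"
    and "(\<integral>x. ((\<Sum>i=1..n. e (x i)) / real n - c)\<^sup>2 \<partial>cube_borel n) \<le> 1 / real n"
proof -
  interpret C: prob_space "cube_borel n" by (rule prob_cube_borel)
  have inte: "integrable unit_borel e"
    by (rule unit_borel.integrable_const_bound[where B=1]) (auto simp: e)
  have c01: "0 \<le> c" "c \<le> 1"
    using unit_borel.integral_ge_const[OF inte, of 0] unit_borel.integral_le_const[OF inte, of 1] e
    by (auto simp: c)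
  define f where "f x = e x - c" for x
  have [measurable]: "f \<in> borel_measurable borel" unfolding f_def by measurable
  have f: "\<bar>f x\<bar> \<le> 1" for x using e[of x] c01 by (auto simp: f_def)
  have ff: "\<bar>f x * f y\<bar> \<le> 1" for x y
    using mult_mono[OF f[of x] f[of y]] by (simp add: abs_mult)
  have f0: "(\<integral>x. f x \<partial>unit_borel) = 0"
    unfolding f_def using inte unit_borel.prob_space by (simp add: c)
  have expand: "((\<Sum>i=1..n. e (x i)) / real n - c)\<^sup>2
      = (\<Sum>i=1..n. \<Sum>l=1..n. f (x i) * f (x l)) / (real n)\<^sup>2" for x
  proof -
    have "(\<Sum>i=1..n. e (x i)) / real n - c = (\<Sum>i=1..n. f (x i)) / real n"
      using n by (simp add: f_def sum_subtractf diff_divide_distrib)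
    then show ?thesis by (simp add: power_divide power2_eq_square sum_product)
  qed
  have int: "integrable (cube_borel n) (\<lambda>x. f (x i) * f (x l))" if "i \<in> {1..n}" "l \<in> {1..n}" for i l
  proof (rule C.integrable_const_bound[where B=1])
    note [measurable] = cube_component_measurable[OF that(1)] cube_component_measurable[OF that(2)]
    show "(\<lambda>x. f (x i) * f (x l)) \<in> borel_measurable (cube_borel n)"
      by measurable
  qed (use ff in auto)
  show "integrable (cube_borel n) (\<lambda>x. ((\<Sum>i=1..n. e (x i)) / real n - c)\<^sup>2)"
    unfolding expand by (intro integrable_divide Bochner_Integration.integrable_sum int)
  have off: "(\<integral>x. f (x i) * f (x l) \<partial>cube_borel n) \<le> (if i = l then 1 else 0)"
    if il: "i \<in> {1..n}" "l \<in> {1..n}" for i l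
  proof (cases "i = l")
    case True
    have "(\<integral>x. f (x i) * f (x l) \<partial>cube_borel n) \<le> 1"
      by (intro C.integral_le_const int il always_eventually allI order_trans[OF abs_ge_self ff])
    then show ?thesis using True by simp
  next
    case False
    have "(\<integral>x. f (x i) * f (x l) \<partial>cube_borel n)
        = (\<integral>z. f (fst z) * f (snd z) \<partial>square_borel)"
      using integral_PiM_pair[OF prob_unit_borel il False, of "\<lambda>z. f (fst z) * f (snd z)"] by simp
    also have "\<dots> = (\<integral>x. \<integral>y. f x * f y \<partial>unit_borel \<partial>unit_borel)"
      by (subst unit_borel2.integral_fst'[symmetric])
        (auto intro!: unit_borel2.integrable_const_bound[where B=1] ff)
    also have "\<dots> = 0" by (simp add: f0)
    finally show ?thesis using False by simp
  qed
  have "(\<integral>x. ((\<Sum>i=1..n. e (x i)) / real n - c)\<^sup>2 \<partial>cube_borel n)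
      = (\<Sum>i=1..n. \<Sum>l=1..n. \<integral>x. f (x i) * f (x l) \<partial>cube_borel n) / (real n)\<^sup>2"
  proof -
    have "(\<integral>x. (\<Sum>i=1..n. \<Sum>l=1..n. f (x i) * f (x l)) \<partial>cube_borel n)
        = (\<Sum>i=1..n. \<integral>x. (\<Sum>l=1..n. f (x i) * f (x l)) \<partial>cube_borel n)"
      by (intro Bochner_Integration.integral_sum Bochner_Integration.integrable_sum int)
    also have "\<dots> = (\<Sum>i=1..n. \<Sum>l=1..n. \<integral>x. f (x i) * f (x l) \<partial>cube_borel n)"
      by (intro sum.cong refl Bochner_Integration.integral_sum int)
    finally show ?thesis unfolding expand by simp
  qed
  also have "\<dots> \<le> (\<Sum>i=1..n. \<Sum>l=1..n. if i = l then 1 else 0) / (real n)\<^sup>2"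
    by (intro divide_right_mono sum_mono off) auto
  also have "\<dots> = 1 / real n"
    using n by (simp add: power2_eq_square)
  finally show "(\<integral>x. ((\<Sum>i=1..n. e (x i)) / real n - c)\<^sup>2 \<partial>cube_borel n) \<le> 1 / real n" .
qed

lemma sum_half_powers: "(\<Sum>j<n. (1/2::real) ^ j) \<le> 2"
  by (subst geometric_sum) (auto simp: field_simps)

lemma expected_discrepancy:
  assumes e: "\<And>j. e j \<in> borel_measurable borel" "\<And>j x. 0 \<le> e j x" "\<And>j x. e j x \<le> 1"
    and c: "\<And>j. c j = (\<integral>x. e j x \<partial>unit_borel)" and n: "0 < n"
  shows "integrable (cube_borel n) (discrepancy n e c)"
    and "(\<integral>x. discrepancy n e c x \<partial>cube_borel n) \<le> 2 / real n"
proof -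
  note * = expected_square_discrepancy[OF e c n]
  show "integrable (cube_borel n) (discrepancy n e c)"
    unfolding discrepancy_def by (intro Bochner_Integration.integrable_sum integrable_mult_right *)
  have "(\<integral>x. discrepancy n e c x \<partial>cube_borel n)
      = (\<Sum>j<n. (1/2) ^ j * (\<integral>x. ((\<Sum>i=1..n. e j (x i)) / real n - c j)\<^sup>2 \<partial>cube_borel n))"
    unfolding discrepancy_def using * by (simp add: Bochner_Integration.integral_sum)
  also have "\<dots> \<le> (\<Sum>j<n. (1/2) ^ j * (1 / real n))"
    by (intro sum_mono mult_left_mono *) auto
  also have "\<dots> = (\<Sum>j<n. (1/2) ^ j) * (1 / real n)" by (simp only: sum_distrib_right)
  also have "\<dots> \<le> 2 * (1 / real n)"
    by (intro mult_right_mono sum_half_powers) auto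
  finally show "(\<integral>x. discrepancy n e c x \<partial>cube_borel n) \<le> 2 / real n" by simp
qed

text \<open>Every off-diagonal pair is a pair of independent uniform points, and the normalization
  is at least the number of such pairs.\<close>

lemma expected_pair_average:
  assumes g: "case_prod g \<in> borel_measurable (borel \<Otimes>\<^sub>M borel)" "\<And>x y. 0 \<le> g x y" "\<And>x y. g x y \<le> 2"
  shows "integrable (cube_borel n) (pair_average n g)"
    and "(\<integral>x. pair_average n g x \<partial>cube_borel n)
      \<le> (\<integral>z. g (fst z) (snd z) \<partial>square_borel)"
proof -
  interpret C: prob_space "cube_borel n" by (rule prob_cube_borel)
  let ?c = "\<integral>z. g (fst z) (snd z) \<partial>square_borel"
  note [measurable] = g(1)
  have gm[measurable]: "(\<lambda>z. g (fst z) (snd z)) \<in> borel_measurable (borel \<Otimes>\<^sub>M borel)"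
    using g(1) by (simp add: case_prod_beta')
  have int: "integrable (cube_borel n) (\<lambda>x. g (x i) (x j))"
    if "i \<in> {1..n}" "j \<in> {1..n} - {i}" for i j
  proof (rule C.integrable_const_bound[where B=2])
    have [measurable]: "(\<lambda>x. (x i, x j)) \<in> cube_borel n \<rightarrow>\<^sub>M borel \<Otimes>\<^sub>M borel"
      using that by (intro measurable_Pair cube_component_measurable) auto
    have "(\<lambda>x. case_prod g (x i, x j)) \<in> borel_measurable (cube_borel n)"
      by measurable
    then show "(\<lambda>x. g (x i) (x j)) \<in> borel_measurable (cube_borel n)" by simp
  qed (use g in auto)
  show "integrable (cube_borel n) (pair_average n g)"
    unfolding pair_average_def by (intro integrable_divide Bochner_Integration.integrable_sum int)
  have c0: "0 \<le> ?c" using g by (intro Bochner_Integration.integral_nonneg) auto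
  have "(\<integral>x. pair_average n g x \<partial>cube_borel n)
      = (\<Sum>i=1..n. \<Sum>j\<in>{1..n}-{i}. \<integral>x. g (x i) (x j) \<partial>cube_borel n) / (real n)\<^sup>2"
  proof -
    have "(\<integral>x. (\<Sum>i=1..n. \<Sum>j\<in>{1..n} - {i}. g (x i) (x j)) \<partial>cube_borel n)
        = (\<Sum>i=1..n. \<integral>x. (\<Sum>j\<in>{1..n} - {i}. g (x i) (x j)) \<partial>cube_borel n)"
      by (intro Bochner_Integration.integral_sum Bochner_Integration.integrable_sum int)
    also have "\<dots> = (\<Sum>i=1..n. \<Sum>j\<in>{1..n}-{i}. \<integral>x. g (x i) (x j) \<partial>cube_borel n)"
      by (intro sum.cong refl Bochner_Integration.integral_sum int)
    finally show ?thesis unfolding pair_average_def by simp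
  qed
  also have "\<dots> = (\<Sum>i=1..n. \<Sum>j\<in>{1..n}-{i}. ?c) / (real n)\<^sup>2"
    using integral_PiM_pair[OF prob_unit_borel, of _ "{1..n}" _ "\<lambda>z. g (fst z) (snd z)"]
    by (intro arg_cong2[where f="(/)"] sum.cong refl) auto
  also have "\<dots> \<le> (\<Sum>i=1..n. \<Sum>j\<in>{1..n}. ?c) / (real n)\<^sup>2"
    by (intro divide_right_mono sum_mono sum_mono2 c0) auto
  also have "\<dots> \<le> ?c"
    using c0 by (cases "n = 0") (auto simp: power2_eq_square)
  finally show "(\<integral>x. pair_average n g x \<partial>cube_borel n) \<le> ?c" .
qed

lemma cycle_sum_integrable:
  assumes w: "borel_kernel w" and \<sigma>: "\<sigma> \<in> sign_functions (vertex_pairs n)"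
  shows "integrable (cube_borel n) (\<lambda>x. cycle_sum n (sign_error (edge_value w x) \<sigma>))"
proof -
  interpret C: prob_space "cube_borel n" by (rule prob_cube_borel)
  have N: "\<bar>sign_error (edge_value w x) \<sigma> a b\<bar> \<le> 2" if "a \<in> {1..n}" "b \<in> {1..n}" for a b x
    using sign_functions_value[OF \<sigma>, of "{a, b}"] edge_value_le[OF w, of x "{a, b}"] vertex_pairsI[of a n b] that
    unfolding sign_error_def by auto
  have Nm: "(\<lambda>x. sign_error (edge_value w x) \<sigma> a b) \<in> borel_measurable (cube_borel n)"
    if "a \<in> {1..n}" "b \<in> {1..n}" for a b
    unfolding sign_error_def
    using edge_value_measurable[OF w, of "{a, b}" n] that by (cases "a = b") auto
  show ?thesis
    unfolding cycle_sum_expand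
  proof (intro Bochner_Integration.integrable_sum)
    fix i j k l assume I: "i \<in> {1..n}" "j \<in> {1..n}" "k \<in> {1..n}" "l \<in> {1..n}"
    let ?N = "\<lambda>x. sign_error (edge_value w x) \<sigma>"
    show "integrable (cube_borel n) (\<lambda>x. ?N x i j * ?N x i k * (?N x l j * ?N x l k))"
    proof (rule C.integrable_const_bound[where B=16])
      show "AE x in cube_borel n. norm (?N x i j * ?N x i k * (?N x l j * ?N x l k)) \<le> 16"
      proof (intro always_eventually allI)
        fix x
        have "\<bar>?N x i j * ?N x i k * (?N x l j * ?N x l k)\<bar> \<le> 2 * 2 * (2 * 2)"
          unfolding abs_mult using N I by (intro mult_mono) auto
        then show "norm (?N x i j * ?N x i k * (?N x l j * ?N x l k)) \<le> 16" by simp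
      qed
    qed (intro borel_measurable_times Nm I)
  qed
qed

lemma expected_badness:
  assumes w: "borel_kernel w" and n: "0 < n"
    and e: "\<And>j. e j \<in> borel_measurable borel" "\<And>j x. 0 \<le> e j x" "\<And>j x. e j x \<le> 1"
    and c: "\<And>j. c j = (\<integral>x. e j x \<partial>unit_borel)"
    and g: "\<And>m. case_prod (g m) \<in> borel_measurable (borel \<Otimes>\<^sub>M borel)"
      "\<And>m x y. 0 \<le> g m x y" "\<And>m x y. g m x y \<le> 2"
      "\<And>m. (\<integral>z. g m (fst z) (snd z) \<partial>square_borel) \<le> (1/4) ^ m / 32"
  shows "\<And>x \<sigma>. 0 \<le> sample_badness n e c g w x \<sigma>"
    and "\<And>\<sigma>. \<sigma> \<in> sign_functions (vertex_pairs n) \<Longrightarrow> integrable (cube_borel n)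
        (\<lambda>x. sign_weight (vertex_pairs n) (edge_value w x) \<sigma> * sample_badness n e c g w x \<sigma>)"
    and "(\<integral>x. (\<Sum>\<sigma>\<in>sign_functions (vertex_pairs n).
      sign_weight (vertex_pairs n) (edge_value w x) \<sigma> * sample_badness n e c g w x \<sigma>) \<partial>cube_borel n) < 1 / 2"
proof -
  interpret C: prob_space "cube_borel n" by (rule prob_cube_borel)
  let ?S = "sign_functions (vertex_pairs n)"
  let ?p = "\<lambda>x \<sigma>. sign_weight (vertex_pairs n) (edge_value w x) \<sigma>"
  let ?A = "\<lambda>x. real n / 64 * discrepancy n e c x + (\<Sum>m<n. 2 ^ m * pair_average n (g m) x)"
  let ?R = "\<lambda>x \<sigma>. cycle_sum n (sign_error (edge_value w x) \<sigma>) / (256 * real n ^ 3)"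
  have nn1: "0 \<le> discrepancy n e c x" for x
    unfolding discrepancy_def by (intro sum_nonneg) auto
  have nn2: "0 \<le> pair_average n (g m) x" for x m
    unfolding pair_average_def by (intro divide_nonneg_nonneg sum_nonneg g) auto
  show nn: "0 \<le> sample_badness n e c g w x \<sigma>" for x \<sigma>
    unfolding sample_badness_def
    by (intro add_nonneg_nonneg mult_nonneg_nonneg divide_nonneg_nonneg sum_nonneg nn1 nn2 cycle_sum_nonneg) auto
  have intA: "integrable (cube_borel n) ?A"
    by (intro Bochner_Integration.integrable_add integrable_mult_right Bochner_Integration.integrable_sum
        expected_discrepancy expected_pair_average e c g n)
  have intB: "integrable (cube_borel n) (\<lambda>x. sample_badness n e c g w x \<sigma>)" if "\<sigma> \<in> ?S" for \<sigma>
    unfolding sample_badness_def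
    by (intro Bochner_Integration.integrable_add[OF intA] integrable_divide cycle_sum_integrable w that)
  show int: "integrable (cube_borel n) (\<lambda>x. ?p x \<sigma> * sample_badness n e c g w x \<sigma>)" if \<sigma>: "\<sigma> \<in> ?S" for \<sigma>
  proof (rule Bochner_Integration.integrable_bound[OF intB[OF \<sigma>]])
    show "(\<lambda>x. ?p x \<sigma> * sample_badness n e c g w x \<sigma>) \<in> borel_measurable (cube_borel n)"
      using intB[OF \<sigma>] by (intro borel_measurable_times sign_weight_measurable w) auto
    show "AE x in cube_borel n. norm (?p x \<sigma> * sample_badness n e c g w x \<sigma>)
        \<le> norm (sample_badness n e c g w x \<sigma>)"
    proof (intro always_eventually allI)
      fix x
      have "\<bar>?p x \<sigma>\<bar> * \<bar>sample_badness n e c g w x \<sigma>\<bar> \<le> 1 * \<bar>sample_badness n e c g w x \<sigma>\<bar>"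
        using \<sigma> by (intro mult_right_mono)
          (auto simp: abs_of_nonneg sign_weight_nonneg sign_weight_le_1 edge_value_le[OF w])
      then show "norm (?p x \<sigma> * sample_badness n e c g w x \<sigma>) \<le> norm (sample_badness n e c g w x \<sigma>)"
        by (simp add: abs_mult)
    qed
  qed
  \<comment> \<open>Averaging over the signs precedes integration over \<open>x\<close>: the weights
    add up to 1 on the two parts without signs, and the fourth-moment bound holds for every fixed
    sample.\<close>
  have pw: "(\<Sum>\<sigma>\<in>?S. ?p x \<sigma> * sample_badness n e c g w x \<sigma>) \<le> ?A x + 1/8" for x
  proof -
    have "(\<Sum>\<sigma>\<in>?S. ?p x \<sigma> * sample_badness n e c g w x \<sigma>)
        = (\<Sum>\<sigma>\<in>?S. ?p x \<sigma> * ?A x + (?p x \<sigma> * cycle_sum n (sign_error (edge_value w x) \<sigma>)) / (256 * real n ^ 3))"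
      unfolding sample_badness_def by (intro sum.cong refl) (simp add: distrib_left)
    also have "\<dots> = ?A x + (\<Sum>\<sigma>\<in>?S. ?p x \<sigma> * cycle_sum n (sign_error (edge_value w x) \<sigma>)) / (256 * real n ^ 3)"
      unfolding sum.distrib sum_divide_distrib[symmetric] sum_distrib_right[symmetric]
      by (simp add: sum_sign_weight)
    also have "\<dots> \<le> ?A x + 32 * real n ^ 3 / (256 * real n ^ 3)"
      by (intro add_left_mono divide_right_mono sum_sign_weight_cycle_sum edge_value_le w) auto
    also have "\<dots> = ?A x + 1/8" using n by simp
    finally show ?thesis .
  qed
  have "(\<integral>x. (\<Sum>\<sigma>\<in>?S. ?p x \<sigma> * sample_badness n e c g w x \<sigma>) \<partial>cube_borel n)
      \<le> (\<integral>x. ?A x + 1/8 \<partial>cube_borel n)"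
    by (intro integral_mono[OF _ _ pw] Bochner_Integration.integrable_sum int
        Bochner_Integration.integrable_add[OF intA] C.integrable_const)
  also have "\<dots> = (\<integral>x. ?A x \<partial>cube_borel n) + 1/8"
    using C.prob_space by (subst Bochner_Integration.integral_add[OF intA C.integrable_const]) simp
  also have "(\<integral>x. ?A x \<partial>cube_borel n) = real n / 64 * (\<integral>x. discrepancy n e c x \<partial>cube_borel n)
      + (\<Sum>m<n. 2 ^ m * (\<integral>x. pair_average n (g m) x \<partial>cube_borel n))"
  proof -
    have i1: "integrable (cube_borel n) (\<lambda>x. real n / 64 * discrepancy n e c x)"
      by (intro integrable_mult_right expected_discrepancy e c n)
    have i2: "integrable (cube_borel n) (\<lambda>x. 2 ^ m * pair_average n (g m) x)" for m
      by (intro integrable_mult_right expected_pair_average g)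
    show ?thesis
      by (subst Bochner_Integration.integral_add[OF i1 Bochner_Integration.integrable_sum[OF i2]],
          subst Bochner_Integration.integral_sum[OF i2]) simp
  qed
  also have "\<dots> \<le> real n / 64 * (2 / real n) + (\<Sum>m<n. 2 ^ m * ((1/4) ^ m / 32))"
    by (intro add_mono mult_left_mono sum_mono expected_discrepancy e c n
        order_trans[OF expected_pair_average(2) g(4)] g) auto
  also have "(\<Sum>m<n. 2 ^ m * ((1/4) ^ m / 32)) = (\<Sum>m<n. (1/2::real) ^ m) / 32"
    by (simp add: sum_divide_distrib power_mult_distrib[symmetric])
  also have "\<dots> \<le> 2 / 32"
    by (intro divide_right_mono sum_half_powers) auto
  finally show "(\<integral>x. (\<Sum>\<sigma>\<in>?S. ?p x \<sigma> * sample_badness n e c g w x \<sigma>) \<partial>cube_borel n) < 1 / 2"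
    using n by simp
qed

text \<open>All three parts are nonnegative, so each is at most 1 and can be unscaled separately.
  For fixed \<open>j\<close> the first bound tends to 0 with growing \<open>n\<close>; the second is
  uniform in \<open>n\<close>.\<close>

lemma badness_lt_1:
  assumes B: "sample_badness n e c g w x \<sigma> < 1" and n: "0 < n" and g: "\<And>m x y. 0 \<le> g m x y"
  shows "\<And>j. j < n \<Longrightarrow> ((\<Sum>i=1..n. e j (x i)) / real n - c j)\<^sup>2 \<le> 64 * 2 ^ j / real n"
    and "\<And>m. m < n \<Longrightarrow> pair_average n (g m) x \<le> (1/2) ^ m"
    and "cycle_sum n (sign_error (edge_value w x) \<sigma>) \<le> 256 * real n ^ 3"
proof -
  have nn1: "0 \<le> real n / 64 * discrepancy n e c x"
    unfolding discrepancy_def by (intro mult_nonneg_nonneg sum_nonneg) auto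
  have nn2: "0 \<le> pair_average n (g m) x" for m
    unfolding pair_average_def by (intro divide_nonneg_nonneg sum_nonneg g) auto
  then have nn3: "0 \<le> (\<Sum>m<n. 2 ^ m * pair_average n (g m) x)"
    by (intro sum_nonneg) auto
  have nn4: "0 \<le> cycle_sum n (sign_error (edge_value w x) \<sigma>) / (256 * real n ^ 3)"
    by (intro divide_nonneg_nonneg cycle_sum_nonneg) auto
  have 1: "real n / 64 * discrepancy n e c x \<le> 1"
    and 2: "(\<Sum>m<n. 2 ^ m * pair_average n (g m) x) \<le> 1"
    and 3: "cycle_sum n (sign_error (edge_value w x) \<sigma>) / (256 * real n ^ 3) \<le> 1"
    using B nn1 nn3 nn4 unfolding sample_badness_def by linarith+
  show "cycle_sum n (sign_error (edge_value w x) \<sigma>) \<le> 256 * real n ^ 3"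
    using 3 n by (simp add: field_simps)
  show "pair_average n (g m) x \<le> (1/2) ^ m" if "m < n" for m
  proof -
    have "2 ^ m * pair_average n (g m) x \<le> (\<Sum>m<n. 2 ^ m * pair_average n (g m) x)"
      using that nn2 by (intro member_le_sum) auto
    then have "2 ^ m * pair_average n (g m) x \<le> 1" using 2 by simp
    then show ?thesis by (simp add: field_simps)
  qed
  show "((\<Sum>i=1..n. e j (x i)) / real n - c j)\<^sup>2 \<le> 64 * 2 ^ j / real n" if "j < n" for j
  proof -
    have "(1/2) ^ j * ((\<Sum>i=1..n. e j (x i)) / real n - c j)\<^sup>2 \<le> discrepancy n e c x"
      unfolding discrepancy_def using that by (intro member_le_sum) auto
    also have "\<dots> \<le> 64 / real n" using 1 n by (simp add: field_simps)
    finally have "2 ^ j * ((1/2) ^ j * ((\<Sum>i=1..n. e j (x i)) / real n - c j)\<^sup>2) \<le> 2 ^ j * (64 / real n)"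
      by (intro mult_left_mono) auto
    also have "2 ^ j * ((1/2) ^ j * ((\<Sum>i=1..n. e j (x i)) / real n - c j)\<^sup>2) = ((\<Sum>i=1..n. e j (x i)) / real n - c j)\<^sup>2"
      by (simp add: power_one_over)
    finally show ?thesis by (simp add: mult.commute)
  qed
qed

section \<open>Weak limits of samples\<close>

text \<open>A measurable function is an almost everywhere limit of continuous ones. Clamping these
  to [-1, 1] preserves the limit, as \<open>w\<close> takes its values there, and makes dominated
  convergence applicable.\<close>

lemma borel_kernel_continuous_approx:
  assumes w: "borel_kernel w" and "0 < \<epsilon>"
  shows "\<exists>v. continuous_on UNIV (case_prod v) \<and> (\<forall>x y. \<bar>v x y\<bar> \<le> (1::real)) \<and>
      (\<integral>z. \<bar>w (fst z) (snd z) - v (fst z) (snd z)\<bar> \<partial>square_borel) \<le> \<epsilon>"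
proof -
  have wm[measurable]: "case_prod w \<in> borel_measurable borel"
    using borel_kernelD(1)[OF w] by (simp add: borel_prod)
  then have "case_prod w \<in> borel_measurable lebesgue"
    by (intro measurable_completion) simp
  then have "case_prod w measurable_on UNIV"
    by (intro lebesgue_measurable_imp_measurable_on) auto
  then obtain N g where N: "negligible N" and g: "\<And>n. continuous_on UNIV (g n :: real \<times> real \<Rightarrow> real)"
    and lim: "\<And>z. z \<notin> N \<Longrightarrow> (\<lambda>n. g n z) \<longlonglongrightarrow> case_prod w z"
    unfolding measurable_on_def by auto
  define h where "h n z = max (-1) (min 1 (g n z))" for n z
  have h: "continuous_on UNIV (h n)" for n
    unfolding h_def using g by (intro continuous_intros)
  have hm[measurable]: "h n \<in> borel_measurable borel" for n
    by (rule borel_measurable_continuous_onI[OF h])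
  have hb: "\<bar>h n z\<bar> \<le> 1" for n z unfolding h_def by auto
  have wb: "\<bar>case_prod w z\<bar> \<le> 1" for z
    using borel_kernelD(3)[OF w] by (cases z) auto
  have "AE z in lebesgue. z \<notin> N"
    using N by (intro AE_not_in) (simp add: negligible_iff_null_sets)
  then have AE: "AE z in square_borel. z \<notin> N"
    unfolding AE_unit_borel_pair AE_completion_iff by auto
  have "(\<lambda>n. \<integral>z. \<bar>case_prod w z - h n z\<bar> \<partial>square_borel) \<longlonglongrightarrow>
      (\<integral>z. 0 \<partial>square_borel)"
  proof (rule integral_dominated_convergence[where w="\<lambda>_. 2"])
    show "AE z in square_borel. (\<lambda>n. \<bar>case_prod w z - h n z\<bar>) \<longlonglongrightarrow> 0"
      using AE
    proof eventually_elim
      case (elim z)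
      have "(\<lambda>n. h n z) \<longlonglongrightarrow> max (-1) (min 1 (case_prod w z))"
        unfolding h_def using lim[OF elim] by (intro tendsto_intros)
      also have "max (-1) (min 1 (case_prod w z)) = case_prod w z"
        using wb[of z] by auto
      finally have "(\<lambda>n. case_prod w z - h n z) \<longlonglongrightarrow> case_prod w z - case_prod w z"
        by (intro tendsto_intros)
      then show ?case using tendsto_rabs_zero by auto
    qed
    show "AE z in square_borel. norm \<bar>case_prod w z - h n z\<bar> \<le> 2" for n
    proof (intro always_eventually allI)
      fix z show "norm \<bar>case_prod w z - h n z\<bar> \<le> 2"
        using wb[of z] hb[of n z] by (simp add: abs_le_iff)
    qed
  qed (auto simp: measurable_cong_sets[OF sets_pair_measure_cong[OF sets_unit_borel sets_unit_borel] refl] borel_prod)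
  then have "eventually (\<lambda>n. (\<integral>z. \<bar>case_prod w z - h n z\<bar> \<partial>square_borel) < \<epsilon>) sequentially"
    using \<open>0 < \<epsilon>\<close> by (intro order_tendstoD(2)) auto
  then obtain n where "(\<integral>z. \<bar>case_prod w z - h n z\<bar> \<partial>square_borel) < \<epsilon>"
    by (auto simp: eventually_sequentially)
  then show ?thesis
    using h[of n] hb[of n]
    by (intro exI[of _ "\<lambda>x y. h n (x, y)"]) (auto simp: case_prod_beta' curry_def)
qed

text \<open>All points lie in [0, 1], so the empirical measures are tight and have a weakly
  convergent subsequence. Skorohod's representation replaces it by pointwise convergent variables,
  and two independent copies of these give the double averages by dominated convergence. The size
  \<open>Suc n\<close> keeps the samples nonempty.\<close>

lemma empirical_weak_limit:
  fixes t :: "nat \<Rightarrow> nat \<Rightarrow> real"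
  assumes t: "\<And>n i. i \<in> {1..Suc n} \<Longrightarrow> t n i \<in> {0..1}"
  shows "\<exists>r \<mu>. strict_mono r \<and> real_distribution \<mu> \<and>
    (\<forall>F b. continuous_on UNIV F \<longrightarrow> (\<forall>x. \<bar>F x\<bar> \<le> b) \<longrightarrow>
      (\<lambda>n. (\<Sum>i=1..Suc (r n). F (t (r n) i)) / real (Suc (r n))) \<longlonglongrightarrow> (\<integral>x. F x \<partial>\<mu>)) \<and>
    (\<forall>K b. continuous_on UNIV K \<longrightarrow> (\<forall>z. \<bar>K z\<bar> \<le> b) \<longrightarrow>
      (\<lambda>n. (\<Sum>i=1..Suc (r n). \<Sum>j=1..Suc (r n). K (t (r n) i, t (r n) j)) / (real (Suc (r n)))\<^sup>2)
        \<longlonglongrightarrow> (\<integral>z. K z \<partial>(\<mu> \<Otimes>\<^sub>M \<mu>)))"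
proof -
  define U where "U n = uniform_count_measure {1..Suc n}" for n
  define \<nu> where "\<nu> n = distr (U n) borel (t n)" for n
  have pU: "prob_space (U n)" for n
    unfolding U_def by (rule prob_space_uniform_count_measure) auto
  have tm[measurable]: "t n \<in> U n \<rightarrow>\<^sub>M borel" for n
    unfolding U_def by (simp add: uniform_count_measure_def point_measure_def)
  have rd: "real_distribution (\<nu> n)" for n
    unfolding \<nu>_def real_distribution_def real_distribution_axioms_def
    using prob_space.prob_space_distr[OF pU tm] by simp
  have int\<nu>: "(\<integral>x. F x \<partial>\<nu> n) = (\<Sum>i=1..Suc n. F (t n i)) / real (Suc n)"
    if [measurable]: "F \<in> borel_measurable borel" for F :: "real \<Rightarrow> real" and n
    unfolding \<nu>_def
    by (subst integral_distr[OF tm that]) (simp add: U_def integral_uniform_count_measure)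
  \<comment> \<open>Tightness is stated with intervals open on the left, so the left end is -1 in
    order to include the point 0.\<close>
  have supp: "measure (\<nu> n) {-1<..1} = 1" for n
  proof -
    interpret \<nu>: real_distribution "\<nu> n" by (rule rd)
    have "AE x in \<nu> n. x \<in> {-1<..1}"
      unfolding \<nu>_def
    proof (subst AE_distr_iff[OF tm])
      show "AE x in U n. t n x \<in> {-1<..1}"
      proof (rule AE_I2)
        fix i assume "i \<in> space (U n)"
        then have "i \<in> {1..Suc n}" unfolding U_def by (simp add: space_uniform_count_measure)
        from t[OF this] show "t n i \<in> {-1<..1}" by auto
      qed
    qed auto
    then show ?thesis by (subst (asm) \<nu>.prob_eq_1[symmetric]) auto
  qed
  have "tight \<nu>"
    unfolding tight_def
  proof (intro conjI allI impI rd)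
    fix \<epsilon> :: real assume "0 < \<epsilon>"
    then show "\<exists>a b. a < b \<and> (\<forall>n. 1 - \<epsilon> < measure (\<nu> n) {a<..b})"
      using supp by (intro exI[of _ "-1"] exI[of _ 1]) auto
  qed
  from tight_imp_convergent_subsubsequence[OF this, of "\<lambda>n. n"]
  obtain r \<mu> where r: "strict_mono r" and \<mu>: "real_distribution \<mu>" and wc: "weak_conv_m (\<nu> \<circ> r) \<mu>"
    by (auto simp: strict_mono_def comp_def)
  interpret \<mu>: real_distribution \<mu> by (rule \<mu>)
  have rdr: "real_distribution ((\<nu> \<circ> r) n)" for n using rd by simp
  obtain \<Omega> :: "real measure" and Ys Y where sk: "prob_space \<Omega>"
    "\<forall>n. Ys n \<in> \<Omega> \<rightarrow>\<^sub>M borel" "\<forall>n. distr \<Omega> borel (Ys n) = (\<nu> \<circ> r) n"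
    "Y \<in> \<Omega> \<rightarrow>\<^sub>M lborel" "distr \<Omega> borel Y = \<mu>"
    "\<forall>x\<in>space \<Omega>. (\<lambda>n. Ys n x) \<longlonglongrightarrow> Y x"
    using Skorohod[OF rdr \<mu> wc] by blast
  have \<Omega>: "prob_space \<Omega>" and Ysm[measurable]: "\<And>n. Ys n \<in> \<Omega> \<rightarrow>\<^sub>M borel"
    and dYs: "\<And>n. distr \<Omega> borel (Ys n) = \<nu> (r n)"
    and Ym[measurable]: "Y \<in> \<Omega> \<rightarrow>\<^sub>M borel" and dY: "distr \<Omega> borel Y = \<mu>"
    and lim: "\<And>x. x \<in> space \<Omega> \<Longrightarrow> (\<lambda>n. Ys n x) \<longlonglongrightarrow> Y x"
    using sk by auto
  interpret \<Omega>: prob_space \<Omega> by (rule \<Omega>)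
  interpret \<Omega>2: pair_prob_space \<Omega> \<Omega> ..
  have one: "(\<lambda>n. (\<Sum>i=1..Suc (r n). F (t (r n) i)) / real (Suc (r n))) \<longlonglongrightarrow> (\<integral>x. F x \<partial>\<mu>)"
    if F: "continuous_on UNIV F" and b: "\<And>x. \<bar>F x\<bar> \<le> b" for F :: "real \<Rightarrow> real" and b
  proof -
    have Fm[measurable]: "F \<in> borel_measurable borel"
      by (rule borel_measurable_continuous_onI[OF F])
    have "(\<lambda>n. \<integral>x. F (Ys n x) \<partial>\<Omega>) \<longlonglongrightarrow> (\<integral>x. F (Y x) \<partial>\<Omega>)"
    proof (rule integral_dominated_convergence[where w="\<lambda>_. b"])
      show "AE x in \<Omega>. (\<lambda>n. F (Ys n x)) \<longlonglongrightarrow> F (Y x)"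
        using continuous_on_tendsto_compose[OF F lim] by (intro AE_I2) auto
    qed (auto simp: b)
    also have "(\<integral>x. F (Y x) \<partial>\<Omega>) = (\<integral>x. F x \<partial>\<mu>)"
      unfolding dY[symmetric] by (simp add: integral_distr)
    also have "(\<lambda>n. \<integral>x. F (Ys n x) \<partial>\<Omega>) = (\<lambda>n. (\<Sum>i=1..Suc (r n). F (t (r n) i)) / real (Suc (r n)))"
    proof
      fix n
      have "(\<integral>x. F (Ys n x) \<partial>\<Omega>) = (\<integral>x. F x \<partial>\<nu> (r n))"
        unfolding dYs[symmetric] by (simp add: integral_distr)
      then show "(\<integral>x. F (Ys n x) \<partial>\<Omega>) = (\<Sum>i=1..Suc (r n). F (t (r n) i)) / real (Suc (r n))"
        by (simp add: int\<nu>)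
    qed
    finally show ?thesis .
  qed
  have two: "(\<lambda>n. (\<Sum>i=1..Suc (r n). \<Sum>j=1..Suc (r n). K (t (r n) i, t (r n) j)) / (real (Suc (r n)))\<^sup>2)
        \<longlonglongrightarrow> (\<integral>z. K z \<partial>(\<mu> \<Otimes>\<^sub>M \<mu>))"
    if K: "continuous_on UNIV K" and b: "\<And>z. \<bar>K z\<bar> \<le> b" for K :: "real \<times> real \<Rightarrow> real" and b
  proof -
    have Km[measurable]: "K \<in> borel_measurable (borel \<Otimes>\<^sub>M borel)"
      using borel_measurable_continuous_onI[OF K] by (simp add: borel_prod)
    have "(\<lambda>n. \<integral>z. K (Ys n (fst z), Ys n (snd z)) \<partial>(\<Omega> \<Otimes>\<^sub>M \<Omega>))
        \<longlonglongrightarrow> (\<integral>z. K (Y (fst z), Y (snd z)) \<partial>(\<Omega> \<Otimes>\<^sub>M \<Omega>))"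
    proof (rule integral_dominated_convergence[where w="\<lambda>_. b"])
      show "AE z in \<Omega> \<Otimes>\<^sub>M \<Omega>. (\<lambda>n. K (Ys n (fst z), Ys n (snd z))) \<longlonglongrightarrow> K (Y (fst z), Y (snd z))"
        by (intro AE_I2 continuous_on_tendsto_compose[OF K] tendsto_Pair lim)
          (auto simp: space_pair_measure)
    qed (auto simp: b)
    also have "(\<integral>z. K (Y (fst z), Y (snd z)) \<partial>(\<Omega> \<Otimes>\<^sub>M \<Omega>)) = (\<integral>z. K z \<partial>(\<mu> \<Otimes>\<^sub>M \<mu>))"
      by (rule integral_pair_map[OF Ym dY \<Omega> \<mu>.events_eq_borel]) measurable
    also have "(\<lambda>n. \<integral>z. K (Ys n (fst z), Ys n (snd z)) \<partial>(\<Omega> \<Otimes>\<^sub>M \<Omega>))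
      = (\<lambda>n. (\<Sum>i=1..Suc (r n). \<Sum>j=1..Suc (r n). K (t (r n) i, t (r n) j)) / (real (Suc (r n)))\<^sup>2)"
    proof
      fix n
      interpret \<nu>: real_distribution "\<nu> (r n)" by (rule rd)
      interpret \<nu>2: pair_prob_space "\<nu> (r n)" "\<nu> (r n)" ..
      have m[measurable]: "(\<lambda>s. K (s, y)) \<in> borel_measurable borel" "(\<lambda>s. K (y, s)) \<in> borel_measurable borel" for y
        by measurable
      have "(\<integral>z. K (Ys n (fst z), Ys n (snd z)) \<partial>(\<Omega> \<Otimes>\<^sub>M \<Omega>)) = (\<integral>z. K z \<partial>(\<nu> (r n) \<Otimes>\<^sub>M \<nu> (r n)))"
        by (rule integral_pair_map[OF Ysm dYs \<Omega> \<nu>.events_eq_borel]) measurable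
      also have "\<dots> = (\<integral>x. \<integral>y. K (x, y) \<partial>\<nu> (r n) \<partial>\<nu> (r n))"
        by (subst \<nu>2.integral_fst'[symmetric]) (auto intro!: \<nu>2.integrable_const_bound[where B=b] b)
      also have "\<dots> = (\<integral>x. (\<Sum>j=1..Suc (r n). K (x, t (r n) j)) / real (Suc (r n)) \<partial>\<nu> (r n))"
        by (intro Bochner_Integration.integral_cong refl int\<nu> m)
      also have "\<dots> = (\<Sum>i=1..Suc (r n). (\<Sum>j=1..Suc (r n). K (t (r n) i, t (r n) j)) / real (Suc (r n)))
          / real (Suc (r n))"
        by (intro int\<nu>) measurable
      also have "\<dots> = (\<Sum>i=1..Suc (r n). \<Sum>j=1..Suc (r n). K (t (r n) i, t (r n) j)) / (real (Suc (r n)))\<^sup>2"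
        by (simp only: sum_divide_distrib[symmetric] power2_eq_square divide_divide_eq_left)
      finally show "(\<integral>z. K (Ys n (fst z), Ys n (snd z)) \<partial>(\<Omega> \<Otimes>\<^sub>M \<Omega>))
        = (\<Sum>i=1..Suc (r n). \<Sum>j=1..Suc (r n). K (t (r n) i, t (r n) j)) / (real (Suc (r n)))\<^sup>2" .
    qed
    finally show ?thesis .
  qed
  show ?thesis
    using r \<mu> one two by blast
qed

section \<open>Ramps as test functions\<close>

lemma cts_step_bounds: "0 < d \<Longrightarrow> 0 \<le> cts_step a (a + d) x" "0 < d \<Longrightarrow> cts_step a (a + d) x \<le> 1"
  unfolding cts_step_def by (auto simp: field_simps)

lemma continuous_cts_step: "a < b \<Longrightarrow> continuous_on UNIV (cts_step a b)"
  by (intro uniformly_continuous_imp_continuous cts_step_uniformly_continuous)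

lemma cts_step_tendsto_indicator:
  "(\<lambda>k. cts_step a (a + 1 / real (Suc k)) x) \<longlonglongrightarrow> indicator {..a} x"
proof (cases "x \<le> a")
  case True
  then show ?thesis by (simp add: cts_step_def)
next
  case False
  have "(\<lambda>k. a + 1 / real (Suc k)) \<longlonglongrightarrow> a + 0"
    by (intro tendsto_intros LIMSEQ_Suc lim_1_over_n)
  then have "eventually (\<lambda>k. a + 1 / real (Suc k) < x) sequentially"
    using False by (intro order_tendstoD(2)[where y="a + 0"]) auto
  then have "eventually (\<lambda>k. cts_step a (a + 1 / real (Suc k)) x = 0) sequentially"
    by eventually_elim (use False in \<open>auto simp: cts_step_def\<close>)
  then show ?thesis using False by (auto intro: tendsto_eventually)
qed

text \<open>Ramps converging to indicators show that \<open>D\<close> has integral 0 over every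
  quadrant. Quadrants are closed under intersection and generate the Borel sets of the plane, so the
  integral of \<open>D\<close> over every Borel set vanishes.\<close>

lemma AE_zero_of_continuous_tests:
  fixes D :: "real \<times> real \<Rightarrow> real"
  assumes \<mu>: "real_distribution \<mu>"
    and Dm[measurable]: "D \<in> borel_measurable (borel \<Otimes>\<^sub>M borel)" and Db: "\<And>z. \<bar>D z\<bar> \<le> b"
    and zero: "\<And>f g. continuous_on UNIV f \<Longrightarrow> continuous_on UNIV g \<Longrightarrow>
      (\<And>x. 0 \<le> f x \<and> f x \<le> (1::real)) \<Longrightarrow> (\<And>x. 0 \<le> g x \<and> g x \<le> (1::real)) \<Longrightarrow>
      (\<integral>z. f (fst z) * g (snd z) * D z \<partial>(\<mu> \<Otimes>\<^sub>M \<mu>)) = 0"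
  shows "AE z in \<mu> \<Otimes>\<^sub>M \<mu>. D z = 0"
proof -
  interpret \<mu>: real_distribution \<mu> by (rule \<mu>)
  interpret \<mu>2: pair_prob_space \<mu> \<mu> ..
  let ?M = "\<mu> \<Otimes>\<^sub>M \<mu>"
  have sets: "sets ?M = sets borel"
    by (simp add: borel_prod[symmetric] cong: sets_pair_measure_cong)
  have intD: "integrable ?M D"
    by (rule \<mu>2.integrable_const_bound[where B=b]) (auto simp: Db)
  have setint: "set_integrable ?M A D" if "A \<in> sets borel" for A
    unfolding set_integrable_def using that intD sets by (intro integrable_mult_indicator) auto
  have rect: "(LINT z:{..a}|?M. D z) = 0" for a
  proof -
    define f where "f i k x = cts_step i (i + 1 / real (Suc k)) x" for i k x
    have f: "continuous_on UNIV (f i k)" "0 \<le> f i k x \<and> f i k x \<le> 1" for i k x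
      unfolding f_def by (auto intro!: continuous_cts_step cts_step_bounds)
    have fm[measurable]: "f i k \<in> borel_measurable borel" for i k
      by (rule borel_measurable_continuous_onI[OF f(1)])
    have "(\<lambda>k. \<integral>z. f (fst a) k (fst z) * f (snd a) k (snd z) * D z \<partial>?M)
      \<longlonglongrightarrow> (\<integral>z. indicator {..fst a} (fst z) * indicator {..snd a} (snd z) * D z \<partial>?M)"
    proof (rule integral_dominated_convergence[where w="\<lambda>_. b"])
      show "AE z in ?M. (\<lambda>k. f (fst a) k (fst z) * f (snd a) k (snd z) * D z) \<longlonglongrightarrow>
          indicator {..fst a} (fst z) * indicator {..snd a} (snd z) * D z"
        unfolding f_def by (intro always_eventually allI tendsto_intros cts_step_tendsto_indicator)
      show "AE z in ?M. norm (f (fst a) k (fst z) * f (snd a) k (snd z) * D z) \<le> b" for k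
      proof (intro always_eventually allI)
        fix z
        have "\<bar>f (fst a) k (fst z)\<bar> * \<bar>f (snd a) k (snd z)\<bar> * \<bar>D z\<bar> \<le> 1 * 1 * b"
          using f(2)[of "fst a" k "fst z"] f(2)[of "snd a" k "snd z"] Db[of z]
          by (intro mult_mono) auto
        then show "norm (f (fst a) k (fst z) * f (snd a) k (snd z) * D z) \<le> b"
          by (simp add: abs_mult)
      qed
    qed auto
    moreover have "(\<integral>z. f (fst a) k (fst z) * f (snd a) k (snd z) * D z \<partial>?M) = 0" for k
      by (intro zero f)
    ultimately have "(\<integral>z. indicator {..fst a} (fst z) * indicator {..snd a} (snd z) * D z \<partial>?M) = 0"
      by (simp add: LIMSEQ_const_iff)
    also have "(\<lambda>z. indicator {..fst a} (fst z) * indicator {..snd a} (snd z) * D z)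
        = (\<lambda>z. indicator {..a} z *\<^sub>R D z)"
      by (auto simp: indicator_def less_eq_prod_def fun_eq_iff)
    finally show ?thesis unfolding set_lebesgue_integral_def .
  qed
  have all: "(LINT z:A|?M. D z) = 0" if "A \<in> sets borel" for A
  proof -
    have A: "A \<in> sigma_sets UNIV (range (\<lambda>a::real \<times> real. {..a}))"
      using that by (simp add: borel_eq_atMost)
    have "Int_stable (range (\<lambda>a::real \<times> real. {..a}))"
    proof (rule Int_stableI)
      fix A B :: "(real \<times> real) set"
      assume "A \<in> range (\<lambda>a. {..a})" "B \<in> range (\<lambda>a. {..a})"
      then obtain a b where "A = {..a}" "B = {..b}" by auto
      then have "A \<inter> B = {..(min (fst a) (fst b), min (snd a) (snd b))}"
        by (auto simp: less_eq_prod_def)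
      then show "A \<inter> B \<in> range (\<lambda>a. {..a})" by blast
    qed
    moreover have "range (\<lambda>a::real \<times> real. {..a}) \<subseteq> Pow UNIV" by simp
    moreover note A
    ultimately show ?thesis
    proof (induction rule: sigma_sets_induct_disjoint)
      fix A assume "A \<in> range (\<lambda>a::real \<times> real. {..a})"
      then show "(LINT z:A|?M. D z) = 0" using rect by auto
    next
      show "(LINT z:{}|?M. D z) = 0" by (simp add: set_lebesgue_integral_def)
    next
      fix A assume A: "A \<in> sigma_sets UNIV (range (\<lambda>a::real \<times> real. {..a}))"
        and IH: "(LINT z:A|?M. D z) = 0"
      then have Ab: "A \<in> sets borel" by (simp add: borel_eq_atMost)
      \<comment> \<open>Constant tests give the whole plane, from which complements are
        subtracted.\<close>
      have "(LINT z:UNIV|?M. D z) = 0"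
        using zero[of "\<lambda>_. 1" "\<lambda>_. 1"] by (simp add: set_lebesgue_integral_def)
      moreover have "(LINT z:(UNIV - A) \<union> A|?M. D z) = (LINT z:UNIV - A|?M. D z) + (LINT z:A|?M. D z)"
        using Ab by (intro set_integral_Un setint) auto
      ultimately show "(LINT z:UNIV - A|?M. D z) = 0" using IH by simp
    next
      fix A :: "nat \<Rightarrow> (real \<times> real) set" assume d: "disjoint_family A"
        and A: "range A \<subseteq> sigma_sets UNIV (range (\<lambda>a::real \<times> real. {..a}))"
        and IH: "\<And>i. (LINT z:A i|?M. D z) = 0"
      have Ab: "A i \<in> sets borel" for i
        using A by (auto simp: borel_eq_atMost)
      have "(LINT z:(\<Union>i. A i)|?M. D z) = (\<Sum>i. LINT z:A i|?M. D z)"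
        using d Ab sets by (intro lebesgue_integral_countable_add setint)
          (auto simp: disjoint_family_on_def)
      then show "(LINT z:(\<Union>i. A i)|?M. D z) = 0" by (simp add: IH)
    qed
  qed
  have "(LINT z:A|?M. D z) = (LINT z:A|?M. 0)" if "A \<in> sets ?M" for A
    using all[of A] that unfolding sets by (simp add: set_lebesgue_integral_def)
  then show ?thesis
    by (intro density_unique_real[OF intD, of "\<lambda>_. 0"]) auto
qed

section \<open>Comparison of two sampled kernels that share a sign pattern\<close>

lemma cycle_sum_cong:
  assumes "\<And>i j. i \<in> {1..n} \<Longrightarrow> j \<in> {1..n} \<Longrightarrow> N i j = N' i j"
  shows "cycle_sum n N = cycle_sum n N'"
  unfolding cycle_sum_def using assms by (intro sum.cong refl arg_cong[where f="\<lambda>x. x\<^sup>2"]) auto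

lemma sign_error_edge_value:
  "borel_kernel w \<Longrightarrow> sign_error (edge_value w x) \<sigma> i j = (if i = j then 0 else \<sigma> {i, j} - w (x i) (x j))"
  unfolding sign_error_def by (simp add: edge_value_doubleton)

lemma sample_badness_cong:
  assumes w: "borel_kernel w" and xy: "\<And>i. i \<in> {1..n} \<Longrightarrow> x i = y i"
  shows "sample_badness n e c g w x \<sigma> = sample_badness n e c g w y \<sigma>"
proof -
  have "discrepancy n e c x = discrepancy n e c y"
    unfolding discrepancy_def using xy by simp
  moreover have "pair_average n (g m) x = pair_average n (g m) y" for m
    unfolding pair_average_def using xy by simp
  moreover have "cycle_sum n (sign_error (edge_value w x) \<sigma>) = cycle_sum n (sign_error (edge_value w y) \<sigma>)"
    using xy by (intro cycle_sum_cong) (simp add: sign_error_edge_value[OF w])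
  ultimately show ?thesis unfolding sample_badness_def by simp
qed

text \<open>The constant 256 is the threshold that a badness below 1 guarantees. The fourth power of
  the form is at most \<open>n ^ 8 * (256 / n)\<close>, so the form is of smaller order than its
  \<open>n ^ 2\<close> summands would allow.\<close>

lemma bilinear_le_root:
  fixes N :: "nat \<Rightarrow> nat \<Rightarrow> real"
  assumes n: "0 < n" and a: "\<And>i. \<bar>a i\<bar> \<le> 1" and b: "\<And>i. \<bar>b i\<bar> \<le> 1"
    and N: "cycle_sum n N \<le> 256 * real n ^ 3"
  shows "\<bar>\<Sum>i=1..n. \<Sum>j=1..n. a i * b j * N i j\<bar> \<le> (real n)\<^sup>2 * root 4 (256 / real n)"
\<comment> \<open>The rule compares powers with exponent \<open>Suc n\<close>, hence 3 for fourth
  powers.\<close>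
proof (rule power_le_imp_le_base[where n=3])
  have "(\<Sum>i=1..n. \<Sum>j=1..n. a i * b j * N i j) ^ 4 \<le> real n ^ 4 * cycle_sum n N"
    by (intro bilinear_le_cycle_sum a b)
  also have "\<dots> \<le> real n ^ 4 * (256 * real n ^ 3)"
    by (intro mult_left_mono N) auto
  also have "\<dots> = (real n) ^ 8 * (256 / real n)"
    using n by (simp add: field_simps power_numeral_reduce)
  also have "\<dots> = ((real n)\<^sup>2 * root 4 (256 / real n)) ^ 4"
    by (simp add: power_mult_distrib real_root_pow_pos2)
  finally show "\<bar>\<Sum>i=1..n. \<Sum>j=1..n. a i * b j * N i j\<bar> ^ Suc 3
      \<le> ((real n)\<^sup>2 * root 4 (256 / real n)) ^ Suc 3"
    by (simp add: power_even_abs)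
qed auto

text \<open>Off the diagonal, \<open>V - V'\<close> is
  \<open>(V - W) - (s - W) + (s - W') + (W' - V')\<close>, in which the shared signs cancel. The
  outer terms are small on average by \<open>p\<close>, the inner ones as bilinear forms. The
  diagonal has \<open>n\<close> entries of size at most 2, which gives \<open>2 / n\<close>.\<close>

lemma sample_estimate:
  fixes V V' W W' s :: "nat \<Rightarrow> nat \<Rightarrow> real"
  assumes n: "0 < n" and a: "\<And>i. \<bar>a i\<bar> \<le> 1" and b: "\<And>i. \<bar>b i\<bar> \<le> 1"
    and V: "\<And>i j. \<bar>V i j\<bar> \<le> 1" "\<And>i j. \<bar>V' i j\<bar> \<le> 1"
    and N: "cycle_sum n (\<lambda>i j. if i = j then 0 else s i j - W i j) \<le> 256 * real n ^ 3"
      "cycle_sum n (\<lambda>i j. if i = j then 0 else s i j - W' i j) \<le> 256 * real n ^ 3"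
    and p: "(\<Sum>i=1..n. \<Sum>j\<in>{1..n} - {i}. \<bar>W i j - V i j\<bar>) / (real n)\<^sup>2 \<le> p"
      "(\<Sum>i=1..n. \<Sum>j\<in>{1..n} - {i}. \<bar>W' i j - V' i j\<bar>) / (real n)\<^sup>2 \<le> p"
  shows "\<bar>(\<Sum>i=1..n. \<Sum>j=1..n. a i * b j * (V i j - V' i j)) / (real n)\<^sup>2\<bar>
    \<le> 2 * p + 2 / real n + 2 * root 4 (256 / real n)"
proof -
  let ?N = "\<lambda>i j. if i = j then 0 else s i j - W i j"
  let ?N' = "\<lambda>i j. if i = j then 0 else s i j - W' i j"
  let ?R = "(real n)\<^sup>2 * root 4 (256 / real n)"
  \<comment> \<open>What remains besides the two sign errors: the approximation errors off the
    diagonal, and the full difference on it, where the sign errors are 0.\<close>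
  define r where "r i j = V i j - V' i j - ?N' i j + ?N i j" for i j
  have ab: "\<bar>a i * b j\<bar> \<le> 1" for i j
    using mult_mono[OF a[of i] b[of j]] by (simp add: abs_mult)
  have r: "\<bar>r i j\<bar> \<le> (if i = j then 2 else \<bar>W i j - V i j\<bar> + \<bar>W' i j - V' i j\<bar>)" for i j
    unfolding r_def using V(1)[of i j] V(2)[of i j] by auto
  have "\<bar>\<Sum>i=1..n. \<Sum>j=1..n. a i * b j * r i j\<bar> \<le> (\<Sum>i=1..n. \<Sum>j=1..n. \<bar>a i * b j * r i j\<bar>)"
    by (intro order_trans[OF sum_abs] sum_mono sum_abs)
  also have "\<dots> \<le> (\<Sum>i=1..n. \<Sum>j=1..n. if i = j then 2 else \<bar>W i j - V i j\<bar> + \<bar>W' i j - V' i j\<bar>)"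
  proof (intro sum_mono)
    fix i j
    have "\<bar>a i * b j * r i j\<bar> \<le> 1 * \<bar>r i j\<bar>"
      unfolding abs_mult[of _ "r i j"] by (intro mult_right_mono ab) auto
    then show "\<bar>a i * b j * r i j\<bar> \<le> (if i = j then 2 else \<bar>W i j - V i j\<bar> + \<bar>W' i j - V' i j\<bar>)"
      using r[of i j] by linarith
  qed
  also have "\<dots> = (\<Sum>i=1..n. 2 + (\<Sum>j\<in>{1..n} - {i}. \<bar>W i j - V i j\<bar> + \<bar>W' i j - V' i j\<bar>))"
  proof (intro sum.cong refl)
    fix i assume "i \<in> {1..n}"
    then have "(\<Sum>j=1..n. if i = j then 2 else \<bar>W i j - V i j\<bar> + \<bar>W' i j - V' i j\<bar>)
        = 2 + (\<Sum>j\<in>{1..n} - {i}. if i = j then 2 else \<bar>W i j - V i j\<bar> + \<bar>W' i j - V' i j\<bar>)"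
      by (subst sum.remove[of _ i]) auto
    also have "(\<Sum>j\<in>{1..n} - {i}. if i = j then 2 else \<bar>W i j - V i j\<bar> + \<bar>W' i j - V' i j\<bar>)
        = (\<Sum>j\<in>{1..n} - {i}. \<bar>W i j - V i j\<bar> + \<bar>W' i j - V' i j\<bar>)"
      by (intro sum.cong) auto
    finally show "(\<Sum>j=1..n. if i = j then 2 else \<bar>W i j - V i j\<bar> + \<bar>W' i j - V' i j\<bar>)
        = 2 + (\<Sum>j\<in>{1..n} - {i}. \<bar>W i j - V i j\<bar> + \<bar>W' i j - V' i j\<bar>)" .
  qed
  also have "\<dots> = 2 * real n + (\<Sum>i=1..n. \<Sum>j\<in>{1..n} - {i}. \<bar>W i j - V i j\<bar>)
      + (\<Sum>i=1..n. \<Sum>j\<in>{1..n} - {i}. \<bar>W' i j - V' i j\<bar>)"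
    by (simp add: sum.distrib)
  also have "\<dots> \<le> 2 * real n + p * (real n)\<^sup>2 + p * (real n)\<^sup>2"
    using p n by (intro add_mono) (auto simp: field_simps)
  finally have R: "\<bar>\<Sum>i=1..n. \<Sum>j=1..n. a i * b j * r i j\<bar> \<le> 2 * real n + 2 * p * (real n)\<^sup>2"
    by simp
  have "(\<Sum>i=1..n. \<Sum>j=1..n. a i * b j * (V i j - V' i j))
      = (\<Sum>i=1..n. \<Sum>j=1..n. a i * b j * ?N' i j - a i * b j * ?N i j + a i * b j * r i j)"
    unfolding r_def by (intro sum.cong refl) (simp add: algebra_simps)
  also have "\<dots> = (\<Sum>i=1..n. \<Sum>j=1..n. a i * b j * ?N' i j) - (\<Sum>i=1..n. \<Sum>j=1..n. a i * b j * ?N i j)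
      + (\<Sum>i=1..n. \<Sum>j=1..n. a i * b j * r i j)"
    by (simp only: sum.distrib sum_subtractf)
  finally have "\<bar>\<Sum>i=1..n. \<Sum>j=1..n. a i * b j * (V i j - V' i j)\<bar>
      \<le> 2 * ?R + (2 * real n + 2 * p * (real n)\<^sup>2)"
    using bilinear_le_root[of n a b, OF n a b N(1)] bilinear_le_root[of n a b, OF n a b N(2)] R
    by linarith
  then have "\<bar>\<Sum>i=1..n. \<Sum>j=1..n. a i * b j * (V i j - V' i j)\<bar> / (real n)\<^sup>2
      \<le> (2 * ?R + (2 * real n + 2 * p * (real n)\<^sup>2)) / (real n)\<^sup>2"
    by (intro divide_right_mono) auto
  also have "\<dots> = 2 * p + 2 / real n + 2 * root 4 (256 / real n)"
    using n by (simp add: field_simps power2_eq_square)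
  finally show ?thesis by (simp add: abs_divide)
qed

section \<open>Laws determined by countably many tests, and quantile functions\<close>

text \<open>Ramps that descend from a rational point over a width \<open>1 / (k + 1)\<close>,
  numbered by a single index because the badness of a sample involves a sequence of tests.\<close>

definition step_test :: "nat \<Rightarrow> real \<Rightarrow> real" where
  "step_test j = cts_step (of_rat (fst (from_nat j :: rat \<times> nat)))
     (of_rat (fst (from_nat j :: rat \<times> nat)) + 1 / real (Suc (snd (from_nat j :: rat \<times> nat))))"

lemma step_test_props:
  "continuous_on UNIV (step_test j)" "0 \<le> step_test j x" "step_test j x \<le> 1"
  "step_test j \<in> borel_measurable borel"
proof -
  show "continuous_on UNIV (step_test j)"
    unfolding step_test_def by (intro continuous_cts_step) auto
  then show "step_test j \<in> borel_measurable borel"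
    by (rule borel_measurable_continuous_onI)
qed (auto simp: step_test_def intro!: cts_step_bounds)

text \<open>For \<open>x < y\<close> some ramp descends between them and lies between the indicators
  of the two rays, which gives \<open>cdf M x \<le> cdf L y\<close>. Right continuity of
  \<open>cdf L\<close> then lets \<open>y\<close> decrease to \<open>x\<close>.\<close>

lemma cdf_le_of_step_tests:
  assumes M: "real_distribution M" and L: "real_distribution L"
    and eq: "\<And>j. (\<integral>x. step_test j x \<partial>M) = (\<integral>x. step_test j x \<partial>L)"
  shows "cdf M x \<le> cdf L x"
proof -
  interpret M: real_distribution M by fact
  interpret L: real_distribution L by fact
  have lt: "cdf M x \<le> cdf L y" if xy: "x < y" for y
  proof -
    obtain a where a: "x < of_rat a" "of_rat a < y" using of_rat_dense[OF xy] by blast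
    obtain k where k: "1 / real (Suc k) < y - of_rat a"
      using a reals_Archimedean[of "y - of_rat a"] by (auto simp: inverse_eq_divide)
    have st: "step_test (to_nat (a, k)) = cts_step (of_rat a) (of_rat a + 1 / real (Suc k))"
      by (simp add: step_test_def)
    have "cdf M x \<le> cdf M (of_rat a)" using a by (intro M.cdf_nondecreasing) auto
    also have "\<dots> \<le> (\<integral>x. step_test (to_nat (a, k)) x \<partial>M)"
      unfolding st by (intro M.cdf_cts_step) auto
    also have "\<dots> = (\<integral>x. step_test (to_nat (a, k)) x \<partial>L)" by (rule eq)
    also have "\<dots> \<le> cdf L (of_rat a + 1 / real (Suc k))"
      unfolding st by (intro L.cdf_cts_step) auto
    also have "\<dots> \<le> cdf L y" using k by (intro L.cdf_nondecreasing) auto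
    finally show ?thesis .
  qed
  have "(cdf L \<longlongrightarrow> cdf L x) (at_right x)"
    using L.cdf_is_right_cont by (simp add: continuous_within)
  moreover have "eventually (\<lambda>y. cdf M x \<le> cdf L y) (at_right x)"
    using lt by (subst eventually_at_right[of _ "x + 1"]) (auto intro!: exI[of _ "x + 1"])
  ultimately show ?thesis
    by (intro tendsto_lowerbound[of "cdf L" _ "at_right x"]) auto
qed

lemma eq_of_step_tests:
  assumes "real_distribution M" "real_distribution L"
    and "\<And>j. (\<integral>x. step_test j x \<partial>M) = (\<integral>x. step_test j x \<partial>L)"
  shows "M = L"
  using assms by (intro cdf_unique ext antisym cdf_le_of_step_tests) auto

text \<open>The pseudoinverse of the distribution function lives on the open unit interval; the end
  points are null, so its extension by 0 has the same law. The equivalence with \<open>cdf\<close>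
  is recorded because \<open>Q\<close> later has to invert ranks.\<close>

lemma ex_quantile_function:
  assumes "real_distribution \<mu>"
  shows "\<exists>Q. Q \<in> borel_measurable borel \<and> distr unit_borel borel Q = \<mu> \<and>
    (\<forall>s x. 0 < s \<longrightarrow> s < 1 \<longrightarrow> (s \<le> cdf \<mu> x \<longleftrightarrow> Q s \<le> x))"
proof -
  interpret cdf_distribution \<mu> unfolding cdf_distribution_def by fact
  define Q where "Q s = (if s \<in> {0<..<1} then I s else 0)" for s
  have Im: "I \<in> borel_measurable (restrict_space borel {0<..<1})"
    by (rule measurable_CI)
  then have Q[measurable]: "Q \<in> borel_measurable borel"
    unfolding Q_def by (subst (asm) measurable_restrict_space_iff[where c=0]) auto
  have "distr unit_borel borel Q = distr (restrict_space lborel {0<..<1::real}) borel I"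
  proof (rule measure_eqI)
    fix A assume "A \<in> sets (distr unit_borel borel Q)"
    then have A: "A \<in> sets borel" by simp
    have QA: "Q -` A \<in> sets borel" using measurable_sets[OF Q A] by simp
    have "emeasure (distr unit_borel borel Q) A = emeasure lborel ({0..1} \<inter> Q -` A)"
      using A QA by (subst emeasure_distr) (auto simp: emeasure_unit_borel)
    also have "\<dots> = emeasure lborel ({0<..<1} \<inter> Q -` A)"
    proof (rule emeasure_eq_AE)
      show "AE x in lborel. x \<in> {0..1} \<inter> Q -` A \<longleftrightarrow> x \<in> {0<..<1} \<inter> Q -` A"
        using AE_lborel_singleton[of 0] AE_lborel_singleton[of 1] by eventually_elim auto
    qed (use QA in auto)
    also have "{0<..<1} \<inter> Q -` A = I -` A \<inter> {0<..<1}"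
      by (auto simp: Q_def)
    also have "emeasure lborel \<dots> = emeasure (distr (restrict_space lborel {0<..<1::real}) borel I) A"
    proof -
      have Im': "I \<in> borel_measurable (restrict_space lborel {0<..<1})"
        using Im by (simp add: measurable_def sets_restrict_space space_restrict_space)
      show ?thesis
        using A Im' by (subst emeasure_distr) (auto simp: emeasure_restrict_space space_restrict_space Int_commute)
    qed
    finally show "emeasure (distr unit_borel borel Q) A
      = emeasure (distr (restrict_space lborel {0<..<1::real}) borel I) A" .
  qed simp
  then have "distr unit_borel borel Q = \<mu>" by (simp add: distr_I_eq_M)
  moreover have "s \<le> cdf \<mu> x \<longleftrightarrow> Q s \<le> x" if "0 < s" "s < 1" for s x
    using pseudoinverse[of s x] that by (simp add: Q_def)
  ultimately show ?thesis using Q by blast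
qed

lemma real_distribution_unit_borel: "real_distribution unit_borel"
  unfolding real_distribution_def real_distribution_axioms_def
  by (simp add: prob_unit_borel)

section \<open>Realignment of the two kernels by a limit of samples\<close>

lemma kernels_realign:
  assumes w: "borel_kernel w" and w': "borel_kernel w'"
    and eq: "\<And>n E. simple_graph n E \<Longrightarrow> borel_hom_density n E w = borel_hom_density n E w'"
  shows "\<exists>\<phi> \<psi>. \<phi> \<in> borel_measurable borel \<and> \<psi> \<in> borel_measurable borel \<and>
    distr unit_borel borel \<phi> = unit_borel \<and> distr unit_borel borel \<psi> = unit_borel \<and>
    (AE z in square_borel. w (\<psi> (fst z)) (\<psi> (snd z)) = w' (\<phi> (fst z)) (\<phi> (snd z)))"
proof -
  have "\<exists>v. \<forall>m. continuous_on UNIV (case_prod (v m)) \<and> (\<forall>x y. \<bar>v m x y\<bar> \<le> (1::real)) \<and>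
      (\<integral>z. \<bar>u (fst z) (snd z) - v m (fst z) (snd z)\<bar> \<partial>square_borel) \<le> (1/4) ^ m / 32"
    if "borel_kernel u" for u
    by (rule choice, rule allI, rule borel_kernel_continuous_approx[OF that]) simp
  note approx = this
  obtain v where vv: "\<forall>m. continuous_on UNIV (case_prod (v m)) \<and> (\<forall>x y. \<bar>v m x y\<bar> \<le> (1::real)) \<and>
      (\<integral>z. \<bar>w (fst z) (snd z) - v m (fst z) (snd z)\<bar> \<partial>square_borel) \<le> (1/4) ^ m / 32"
    using approx[OF w] by (elim exE)
  obtain v' where vv': "\<forall>m. continuous_on UNIV (case_prod (v' m)) \<and> (\<forall>x y. \<bar>v' m x y\<bar> \<le> (1::real)) \<and>
      (\<integral>z. \<bar>w' (fst z) (snd z) - v' m (fst z) (snd z)\<bar> \<partial>square_borel) \<le> (1/4) ^ m / 32"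
    using approx[OF w'] by (elim exE)
  note v = vv[rule_format, THEN conjunct1] vv[rule_format, THEN conjunct2, THEN conjunct1, rule_format]
    vv[rule_format, THEN conjunct2, THEN conjunct2]
  note v' = vv'[rule_format, THEN conjunct1] vv'[rule_format, THEN conjunct2, THEN conjunct1, rule_format]
    vv'[rule_format, THEN conjunct2, THEN conjunct2]
  define c where "c j = (\<integral>x. step_test j x \<partial>unit_borel)" for j
  define g where "g m x y = \<bar>w x y - v m x y\<bar>" for m x y
  define g' where "g' m x y = \<bar>w' x y - v' m x y\<bar>" for m x y
  have vm: "case_prod (v m) \<in> borel_measurable (borel \<Otimes>\<^sub>M borel)"
    "case_prod (v' m) \<in> borel_measurable (borel \<Otimes>\<^sub>M borel)" for m
    using borel_measurable_continuous_onI[OF v(1)] borel_measurable_continuous_onI[OF v'(1)]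
    by (simp_all add: borel_prod)
  note wm = borel_kernelD(1)[OF w] borel_kernelD(1)[OF w']
  have gm: "case_prod (g m) \<in> borel_measurable (borel \<Otimes>\<^sub>M borel)"
    "case_prod (g' m) \<in> borel_measurable (borel \<Otimes>\<^sub>M borel)" for m
    using vm[of m] wm unfolding g_def g'_def case_prod_beta'
    by (auto intro!: borel_measurable_abs borel_measurable_diff)
  have gb: "0 \<le> g m x y" "g m x y \<le> 2" "0 \<le> g' m x y" "g' m x y \<le> 2" for m x y
    using v(2)[of m x y] v'(2)[of m x y] borel_kernelD(3)[OF w, of x y] borel_kernelD(3)[OF w', of x y]
    unfolding g_def g'_def by auto
  have gi: "(\<integral>z. g m (fst z) (snd z) \<partial>square_borel) \<le> (1/4) ^ m / 32"
    "(\<integral>z. g' m (fst z) (snd z) \<partial>square_borel) \<le> (1/4) ^ m / 32" for m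
    unfolding g_def g'_def by (rule v(3) v'(3))+
  have "\<exists>t \<sigma>. (\<forall>i\<in>{1..Suc n}. t i \<in> {0..1}) \<and>
      sample_badness (Suc n) step_test c g w (\<lambda>i. hilbert_curve 0 (t i)) \<sigma> < 1 \<and>
      sample_badness (Suc n) step_test c g' w' (\<lambda>i. hilbert_curve 1 (t i)) \<sigma> < 1" for n
  proof -
    note B = expected_badness[where n="Suc n" and e=step_test and c=c, OF w zero_less_Suc step_test_props(4,2,3) c_def gm(1) gb(1,2) gi(1)]
    note B' = expected_badness[where n="Suc n" and e=step_test and c=c, OF w' zero_less_Suc step_test_props(4,2,3) c_def gm(2) gb(3,4) gi(2)]
    have "\<exists>x x' \<sigma>. \<sigma> \<in> sign_functions (vertex_pairs (Suc n)) \<and>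
        (\<forall>i\<in>{1..Suc n}. x i \<in> {0..1}) \<and> (\<forall>i\<in>{1..Suc n}. x' i \<in> {0..1}) \<and>
        sample_badness (Suc n) step_test c g w x \<sigma> < 1 \<and> sample_badness (Suc n) step_test c g' w' x' \<sigma> < 1"
      by (rule select_samples[OF w w' eq B(2) B'(2) B(1) B'(1) B(3) B'(3)])
    then obtain x x' \<sigma> where x: "\<forall>i\<in>{1..Suc n}. x i \<in> {0..1}" "\<forall>i\<in>{1..Suc n}. x' i \<in> {0..1}"
      and b: "sample_badness (Suc n) step_test c g w x \<sigma> < 1" "sample_badness (Suc n) step_test c g' w' x' \<sigma> < 1"
      by blast
    \<comment> \<open>Coordinates 0 and 1 carry the two samples; the rest of the sequence is filled
      with 0.\<close>
    define y where "y i k = (if k = 0 then x i else if k = 1 then x' i else 0)" for i and k :: nat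
    define t where "t i = hilbert_code (y i)" for i
    have y: "0 \<le> y i k" "y i k \<le> 1" if "i \<in> {1..Suc n}" for i k
      using x that unfolding y_def by auto
    have "t i \<in> {0..1}" if "i \<in> {1..Suc n}" for i
      unfolding t_def using hilbert_code_bounds[of "y i"] y[OF that] by auto
    moreover have h: "hilbert_curve 0 (t i) = x i" "hilbert_curve 1 (t i) = x' i" if "i \<in> {1..Suc n}" for i
      unfolding t_def using hilbert_curve_code[of "y i"] y[OF that] by (auto simp: y_def)
    moreover have "sample_badness (Suc n) step_test c g w (\<lambda>i. hilbert_curve 0 (t i)) \<sigma> < 1"
      using b(1) sample_badness_cong[OF w, of "Suc n" x "\<lambda>i. hilbert_curve 0 (t i)"] h by simp
    moreover have "sample_badness (Suc n) step_test c g' w' (\<lambda>i. hilbert_curve 1 (t i)) \<sigma> < 1"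
      using b(2) sample_badness_cong[OF w', of "Suc n" x' "\<lambda>i. hilbert_curve 1 (t i)"] h by simp
    ultimately show ?thesis by blast
  qed
  then obtain t \<sigma> where t: "\<And>n i. i \<in> {1..Suc n} \<Longrightarrow> t n i \<in> {0..1}"
    and b: "\<And>n. sample_badness (Suc n) step_test c g w (\<lambda>i. hilbert_curve 0 (t n i)) (\<sigma> n) < 1"
      "\<And>n. sample_badness (Suc n) step_test c g' w' (\<lambda>i. hilbert_curve 1 (t n i)) (\<sigma> n) < 1"
    by metis
  obtain r \<mu> where r: "strict_mono r" and \<mu>: "real_distribution \<mu>"
    and one: "\<And>F b. continuous_on UNIV F \<Longrightarrow> (\<And>x. \<bar>F x\<bar> \<le> b) \<Longrightarrow>
      (\<lambda>n. (\<Sum>i=1..Suc (r n). F (t (r n) i)) / real (Suc (r n))) \<longlonglongrightarrow> (\<integral>x. F x \<partial>\<mu>)"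
    and two: "\<And>K b. continuous_on UNIV K \<Longrightarrow> (\<And>z. \<bar>K z\<bar> \<le> b) \<Longrightarrow>
      (\<lambda>n. (\<Sum>i=1..Suc (r n). \<Sum>j=1..Suc (r n). K (t (r n) i, t (r n) j)) / (real (Suc (r n)))\<^sup>2)
        \<longlonglongrightarrow> (\<integral>z. K z \<partial>(\<mu> \<Otimes>\<^sub>M \<mu>))"
    using empirical_weak_limit[of t, OF t] by blast
  interpret \<mu>: real_distribution \<mu> by (rule \<mu>)
  interpret \<mu>2: pair_prob_space \<mu> \<mu> ..
  have r_ge: "eventually (\<lambda>n. k < Suc (r n)) sequentially" for k
    using seq_suble[OF r] by (intro eventually_sequentiallyI[of k]) (metis le_trans le_imp_less_Suc)
  have inv: "(\<lambda>n. a / real (Suc (r n))) \<longlonglongrightarrow> 0" for a :: real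
    using LIMSEQ_subseq_LIMSEQ[OF LIMSEQ_Suc[OF lim_const_over_n[of a]] r] by (simp add: comp_def)
  \<comment> \<open>The averages of a test converge to its integral under the limit, by weak
    convergence, and to its uniform mean, by the discrepancy bound.\<close>
  have marginal: "distr \<mu> borel (hilbert_curve k) = unit_borel"
    if sq: "\<And>n j. j < Suc n \<Longrightarrow>
      ((\<Sum>i=1..Suc n. step_test j (hilbert_curve k (t n i))) / real (Suc n) - c j)\<^sup>2 \<le> 64 * 2 ^ j / real (Suc n)" for k
  proof (rule eq_of_step_tests)
    show "real_distribution (distr \<mu> borel (hilbert_curve k))"
      by (simp add: \<mu>.real_distribution_distr)
    show "real_distribution unit_borel" by (rule real_distribution_unit_borel)
    fix j
    let ?F = "\<lambda>s. step_test j (hilbert_curve k s)"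
    have "(\<lambda>n. (\<Sum>i=1..Suc (r n). ?F (t (r n) i)) / real (Suc (r n))) \<longlonglongrightarrow> (\<integral>s. ?F s \<partial>\<mu>)"
      by (rule one[where b=1])
        (auto simp: abs_of_nonneg step_test_props intro: continuous_on_compose2[OF step_test_props(1) continuous_hilbert_curve])
    moreover have "(\<lambda>n. (\<Sum>i=1..Suc (r n). ?F (t (r n) i)) / real (Suc (r n))) \<longlonglongrightarrow> c j"
    proof -
      have "(\<lambda>n. ((\<Sum>i=1..Suc (r n). ?F (t (r n) i)) / real (Suc (r n)) - c j)\<^sup>2) \<longlonglongrightarrow> 0"
      proof (rule tendsto_sandwich[OF _ _ tendsto_const inv[of "64 * 2 ^ j"]])
        show "\<forall>\<^sub>F n in sequentially. ((\<Sum>i=1..Suc (r n). ?F (t (r n) i)) / real (Suc (r n)) - c j)\<^sup>2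
            \<le> 64 * 2 ^ j / real (Suc (r n))"
          using r_ge[of j] by eventually_elim (rule sq)
      qed simp
      then have "(\<lambda>n. (\<Sum>i=1..Suc (r n). ?F (t (r n) i)) / real (Suc (r n)) - c j) \<longlonglongrightarrow> 0"
        by (simp only: power_tendsto_0_iff zero_less_numeral)
      then show ?thesis by (simp only: LIM_zero_iff)
    qed
    ultimately have "(\<integral>s. ?F s \<partial>\<mu>) = c j" by (rule LIMSEQ_unique)
    then show "(\<integral>x. step_test j x \<partial>distr \<mu> borel (hilbert_curve k)) = (\<integral>x. step_test j x \<partial>unit_borel)"
      by (subst integral_distr) (auto simp: c_def step_test_props(4))
  qed
  note bw = badness_lt_1[OF b(1) zero_less_Suc gb(1)] and bw' = badness_lt_1[OF b(2) zero_less_Suc gb(3)]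
  have m0: "distr \<mu> borel (hilbert_curve 0) = unit_borel"
    by (rule marginal) (rule bw(1))
  have m1: "distr \<mu> borel (hilbert_curve 1) = unit_borel"
    by (rule marginal) (rule bw'(1))
  \<comment> \<open>\<open>?D\<close> is to vanish, \<open>?E m\<close> is its continuous
    substitute, to which weak convergence applies, and \<open>?G m\<close> dominates the error of
    the substitution.\<close>
  let ?D = "\<lambda>z. w (hilbert_curve 0 (fst z)) (hilbert_curve 0 (snd z))
      - w' (hilbert_curve 1 (fst z)) (hilbert_curve 1 (snd z))"
  let ?E = "\<lambda>m z. v m (hilbert_curve 0 (fst z)) (hilbert_curve 0 (snd z))
      - v' m (hilbert_curve 1 (fst z)) (hilbert_curve 1 (snd z))"
  let ?G = "\<lambda>m z. g m (hilbert_curve 0 (fst z)) (hilbert_curve 0 (snd z))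
      + g' m (hilbert_curve 1 (fst z)) (hilbert_curve 1 (snd z))"
  have hm[measurable]: "(\<lambda>z. (hilbert_curve k (fst z), hilbert_curve k (snd z)))
      \<in> borel \<Otimes>\<^sub>M borel \<rightarrow>\<^sub>M borel \<Otimes>\<^sub>M borel" for k
    by measurable
  have Dm[measurable]: "?D \<in> borel_measurable (borel \<Otimes>\<^sub>M borel)"
    by (intro borel_measurable_diff borel_kernel_measurable[OF w] borel_kernel_measurable[OF w']) measurable
  have Em[measurable]: "?E m \<in> borel_measurable (borel \<Otimes>\<^sub>M borel)" for m
    using measurable_compose[OF hm vm(1)] measurable_compose[OF hm vm(2)]
    by (intro borel_measurable_diff) auto
  have gm': "(\<lambda>z. g m (hilbert_curve 0 (fst z)) (hilbert_curve 0 (snd z))) \<in> borel_measurable (borel \<Otimes>\<^sub>M borel)"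
      "(\<lambda>z. g' m (hilbert_curve 1 (fst z)) (hilbert_curve 1 (snd z))) \<in> borel_measurable (borel \<Otimes>\<^sub>M borel)" for m
    using measurable_compose[OF hm gm(1)] measurable_compose[OF hm gm(2)] by auto
  have Db: "\<bar>?D z\<bar> \<le> 2" for z
    using borel_kernelD(3)[OF w, of "hilbert_curve 0 (fst z)" "hilbert_curve 0 (snd z)"]
      borel_kernelD(3)[OF w', of "hilbert_curve 1 (fst z)" "hilbert_curve 1 (snd z)"] by linarith
  have Eb: "\<bar>?E m z\<bar> \<le> 2" for m z
    using v(2)[of m "hilbert_curve 0 (fst z)" "hilbert_curve 0 (snd z)"]
      v'(2)[of m "hilbert_curve 1 (fst z)" "hilbert_curve 1 (snd z)"] by linarith
  have gint: "integrable (\<mu> \<Otimes>\<^sub>M \<mu>) (\<lambda>z. g m (hilbert_curve 0 (fst z)) (hilbert_curve 0 (snd z)))"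
    "integrable (\<mu> \<Otimes>\<^sub>M \<mu>) (\<lambda>z. g' m (hilbert_curve 1 (fst z)) (hilbert_curve 1 (snd z)))" for m
    using gm' by (auto intro!: \<mu>2.integrable_const_bound[where B=2] simp: gb)
  have Gint: "integrable (\<mu> \<Otimes>\<^sub>M \<mu>) (?G m)" for m
    by (intro Bochner_Integration.integrable_add gint)
  \<comment> \<open>Both coordinates of the limit are uniform, so the two integrals are the L1
    errors of the approximations of \<open>w\<close> and \<open>w'\<close>.\<close>
  have Gi: "(\<integral>z. ?G m z \<partial>(\<mu> \<Otimes>\<^sub>M \<mu>)) \<le> (1/2) ^ m" for m
  proof -
    have "(\<integral>z. ?G m z \<partial>(\<mu> \<Otimes>\<^sub>M \<mu>))
        = (\<integral>z. g m (hilbert_curve 0 (fst z)) (hilbert_curve 0 (snd z)) \<partial>(\<mu> \<Otimes>\<^sub>M \<mu>))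
        + (\<integral>z. g' m (hilbert_curve 1 (fst z)) (hilbert_curve 1 (snd z)) \<partial>(\<mu> \<Otimes>\<^sub>M \<mu>))"
      by (intro Bochner_Integration.integral_add gint)
    also have "\<dots> = (\<integral>z. g m (fst z) (snd z) \<partial>square_borel)
        + (\<integral>z. g' m (fst z) (snd z) \<partial>square_borel)"
      using integral_pair_map[of "hilbert_curve 0" \<mu> borel, OF _ m0 \<mu>.prob_space_axioms, of "case_prod (g m)"]
        integral_pair_map[of "hilbert_curve 1" \<mu> borel, OF _ m1 \<mu>.prob_space_axioms, of "case_prod (g' m)"] gm
      by (simp add: case_prod_beta')
    also have "\<dots> \<le> (1/4) ^ m / 32 + (1/4) ^ m / 32" by (intro add_mono gi)
    also have "\<dots> \<le> (1/4) ^ m" by simp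
    also have "\<dots> \<le> (1/2) ^ m" by (intro power_mono) auto
    finally show ?thesis .
  qed
  have DE: "\<bar>?D z - ?E m z\<bar> \<le> ?G m z" for m z
    unfolding g_def g'_def by linarith
  have "AE z in \<mu> \<Otimes>\<^sub>M \<mu>. ?D z = 0"
  proof (rule AE_zero_of_continuous_tests[OF \<mu> Dm Db])
    fix a b' :: "real \<Rightarrow> real"
    assume a: "continuous_on UNIV a" "\<And>x. 0 \<le> a x \<and> a x \<le> 1"
      and b': "continuous_on UNIV b'" "\<And>x. 0 \<le> b' x \<and> b' x \<le> 1"
    have [measurable]: "a \<in> borel_measurable borel" "b' \<in> borel_measurable borel"
      by (auto intro: borel_measurable_continuous_onI a b')
    let ?ab = "\<lambda>z. a (fst z) * b' (snd z)"
    have ab: "0 \<le> ?ab z" "?ab z \<le> 1" for z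
      using a(2)[of "fst z"] b'(2)[of "snd z"] by (auto intro: mult_le_one)
    let ?L = "\<lambda>m. \<integral>z. ?ab z * ?E m z \<partial>(\<mu> \<Otimes>\<^sub>M \<mu>)"
    have abs1: "\<bar>?ab z * y\<bar> \<le> \<bar>y\<bar>" for z y
      using mult_right_mono[OF ab(2)[of z], of "\<bar>y\<bar>"] ab(1)[of z]
      by (simp only: abs_mult[of "?ab z" y] abs_of_nonneg) simp
    \<comment> \<open>The sample estimate with \<open>p = (1/2) ^ m\<close> applies as soon as the
      sample size exceeds \<open>m\<close>; its other two terms tend to 0 along the
      subsequence.\<close>
    have L: "\<bar>?L m\<bar> \<le> 2 * (1/2) ^ m" for m
    proof (rule LIMSEQ_le)
      let ?K = "\<lambda>z. ?ab z * ?E m z"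
      let ?S = "\<lambda>n. (\<Sum>i=1..Suc (r n). \<Sum>j=1..Suc (r n). ?K (t (r n) i, t (r n) j)) / (real (Suc (r n)))\<^sup>2"
      have cont: "continuous_on UNIV (\<lambda>z. u (hilbert_curve k (fst z)) (hilbert_curve k (snd z)) :: real)"
        if "continuous_on UNIV (case_prod u)" for u k
      proof -
        have "continuous_on UNIV (\<lambda>z. case_prod u (hilbert_curve k (fst z), hilbert_curve k (snd z)))"
          by (intro continuous_on_compose2[OF that] continuous_intros
              continuous_on_compose2[OF continuous_hilbert_curve]) auto
        then show ?thesis by simp
      qed
      have "?S \<longlonglongrightarrow> ?L m"
      proof (rule two[of ?K 2])
        show "continuous_on UNIV ?K"
          by (intro continuous_intros cont v v' continuous_on_compose2[OF a(1)] continuous_on_compose2[OF b'(1)]) auto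
        show "\<bar>?K z\<bar> \<le> 2" for z
          using abs1[of z "?E m z"] Eb[of m z] by linarith
      qed
      then show "(\<lambda>n. \<bar>?S n\<bar>) \<longlonglongrightarrow> \<bar>?L m\<bar>" by (rule tendsto_rabs)
      have "(\<lambda>n. 2 * (1/2) ^ m + 2 / real (Suc (r n)) + 2 * root 4 (256 / real (Suc (r n))))
          \<longlonglongrightarrow> 2 * (1/2) ^ m + 0 + 2 * root 4 0"
        by (intro tendsto_intros inv)
      then show "(\<lambda>n. 2 * (1/2) ^ m + 2 / real (Suc (r n)) + 2 * root 4 (256 / real (Suc (r n))))
          \<longlonglongrightarrow> 2 * (1/2) ^ m" by simp
      have "eventually (\<lambda>n. \<bar>?S n\<bar> \<le> 2 * (1/2) ^ m + 2 / real (Suc (r n)) + 2 * root 4 (256 / real (Suc (r n)))) sequentially"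
        using r_ge[of m]
      proof eventually_elim
        case (elim n)
        let ?h = "\<lambda>k i. hilbert_curve k (t (r n) i)"
        have "\<bar>(\<Sum>i=1..Suc (r n). \<Sum>j=1..Suc (r n). a (t (r n) i) * b' (t (r n) j) *
            (v m (?h 0 i) (?h 0 j) - v' m (?h 1 i) (?h 1 j))) / (real (Suc (r n)))\<^sup>2\<bar>
          \<le> 2 * (1/2) ^ m + 2 / real (Suc (r n)) + 2 * root 4 (256 / real (Suc (r n)))"
        proof (rule sample_estimate)
          show "cycle_sum (Suc (r n)) (\<lambda>i j. if i = j then 0 else \<sigma> (r n) {i, j} - w (?h 0 i) (?h 0 j))
              \<le> 256 * real (Suc (r n)) ^ 3"
            using bw(3)[of "r n"] by (simp only: sign_error_edge_value[OF w, abs_def])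
          show "cycle_sum (Suc (r n)) (\<lambda>i j. if i = j then 0 else \<sigma> (r n) {i, j} - w' (?h 1 i) (?h 1 j))
              \<le> 256 * real (Suc (r n)) ^ 3"
            using bw'(3)[of "r n"] by (simp only: sign_error_edge_value[OF w', abs_def])
          show "(\<Sum>i=1..Suc (r n). \<Sum>j\<in>{1..Suc (r n)} - {i}. \<bar>w (?h 0 i) (?h 0 j) - v m (?h 0 i) (?h 0 j)\<bar>)
              / (real (Suc (r n)))\<^sup>2 \<le> (1/2) ^ m"
            using bw(2)[OF elim] unfolding pair_average_def g_def .
          show "(\<Sum>i=1..Suc (r n). \<Sum>j\<in>{1..Suc (r n)} - {i}. \<bar>w' (?h 1 i) (?h 1 j) - v' m (?h 1 i) (?h 1 j)\<bar>)
              / (real (Suc (r n)))\<^sup>2 \<le> (1/2) ^ m"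
            using bw'(2)[OF elim] unfolding pair_average_def g'_def .
        qed (use a(2) b'(2) v(2) v'(2) in \<open>auto simp: abs_of_nonneg\<close>)
        then show ?case by simp
      qed
      then show "\<exists>N. \<forall>n\<ge>N. \<bar>?S n\<bar> \<le> 2 * (1/2) ^ m + 2 / real (Suc (r n)) + 2 * root 4 (256 / real (Suc (r n)))"
        by (simp only: eventually_sequentially)
    qed
    have abm: "?ab \<in> borel_measurable (borel \<Otimes>\<^sub>M borel)" by measurable
    have mc: "borel_measurable (\<mu> \<Otimes>\<^sub>M \<mu>) = borel_measurable (borel \<Otimes>\<^sub>M borel)"
      by (intro measurable_cong_sets sets_pair_measure_cong) auto
    have intD: "integrable (\<mu> \<Otimes>\<^sub>M \<mu>) (\<lambda>z. ?ab z * ?D z)"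
    proof (rule \<mu>2.integrable_const_bound[where B=2])
      show "AE z in \<mu> \<Otimes>\<^sub>M \<mu>. norm (?ab z * ?D z) \<le> 2"
        unfolding real_norm_def by (intro AE_I2 order_trans[OF abs1] Db)
      show "(\<lambda>z. ?ab z * ?D z) \<in> borel_measurable (\<mu> \<Otimes>\<^sub>M \<mu>)"
        unfolding mc by (rule borel_measurable_times[OF abm Dm])
    qed
    have intE: "integrable (\<mu> \<Otimes>\<^sub>M \<mu>) (\<lambda>z. ?ab z * ?E m z)" for m
    proof (rule \<mu>2.integrable_const_bound[where B=2])
      show "AE z in \<mu> \<Otimes>\<^sub>M \<mu>. norm (?ab z * ?E m z) \<le> 2"
        unfolding real_norm_def by (intro AE_I2 order_trans[OF abs1] Eb)
      show "(\<lambda>z. ?ab z * ?E m z) \<in> borel_measurable (\<mu> \<Otimes>\<^sub>M \<mu>)"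
        unfolding mc by (rule borel_measurable_times[OF abm Em])
    qed
    \<comment> \<open>The weak limit was taken for fixed \<open>m\<close>; only now may
      \<open>m\<close> grow. The factor 3 is 2 from the limit and 1 from the substitution
      error.\<close>
    have bound: "\<bar>\<integral>z. ?ab z * ?D z \<partial>(\<mu> \<Otimes>\<^sub>M \<mu>)\<bar> \<le> 3 * (1/2) ^ m" for m
    proof -
      have "\<bar>(\<integral>z. ?ab z * ?D z \<partial>(\<mu> \<Otimes>\<^sub>M \<mu>)) - ?L m\<bar> = \<bar>\<integral>z. ?ab z * ?D z - ?ab z * ?E m z \<partial>(\<mu> \<Otimes>\<^sub>M \<mu>)\<bar>"
        by (subst Bochner_Integration.integral_diff[OF intD intE]) simp
      also have "\<dots> \<le> (\<integral>z. ?G m z \<partial>(\<mu> \<Otimes>\<^sub>M \<mu>))"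
      proof (rule integral_abs_bound_integral)
        show "integrable (\<mu> \<Otimes>\<^sub>M \<mu>) (\<lambda>z. ?ab z * ?D z - ?ab z * ?E m z)"
          by (intro Bochner_Integration.integrable_diff intD intE)
        show "\<bar>?ab z * ?D z - ?ab z * ?E m z\<bar> \<le> ?G m z" for z
          unfolding right_diff_distrib[symmetric] by (rule order_trans[OF abs1 DE])
      qed (rule Gint)
      finally show ?thesis using L[of m] Gi[of m] by linarith
    qed
    have lim: "(\<lambda>m. 3 * (1/2::real) ^ m) \<longlonglongrightarrow> 0"
      using tendsto_mult[OF tendsto_const[of 3] LIMSEQ_power_zero[of "1/2::real"]] by simp
    have "\<bar>\<integral>z. ?ab z * ?D z \<partial>(\<mu> \<Otimes>\<^sub>M \<mu>)\<bar> \<le> 0"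
      by (rule LIMSEQ_le_const[OF lim]) (use bound in blast)
    then show "(\<integral>z. a (fst z) * b' (snd z) * ?D z \<partial>(\<mu> \<Otimes>\<^sub>M \<mu>)) = 0" by simp
  qed
  \<comment> \<open>The limit is the image of the uniform law under \<open>Q\<close>, so each of the
    two coordinates of the curve, composed with \<open>Q\<close>, preserves the uniform law.\<close>
  obtain Q where Q[measurable]: "Q \<in> borel_measurable borel" and dQ: "distr unit_borel borel Q = \<mu>"
    using ex_quantile_function[OF \<mu>] by blast
  have distr_Q: "distr unit_borel borel (\<lambda>s. hilbert_curve k (Q s)) = distr \<mu> borel (hilbert_curve k)" for k
    unfolding dQ[symmetric] by (subst distr_distr) (auto simp: comp_def)
  have Q': "Q \<in> unit_borel \<rightarrow>\<^sub>M borel" by measurable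
  have "AE z in square_borel. ?D (Q (fst z), Q (snd z)) = 0"
    using AE_pair_map[OF Q' dQ prob_unit_borel \<mu>.events_eq_borel, of "\<lambda>x y. ?D (x, y) = 0"]
      \<open>AE z in \<mu> \<Otimes>\<^sub>M \<mu>. ?D z = 0\<close> by simp
  then show ?thesis
    using distr_Q[of 0] distr_Q[of 1] m0 m1
    by (intro exI[of _ "\<lambda>s. hilbert_curve 1 (Q s)"] exI[of _ "\<lambda>s. hilbert_curve 0 (Q s)"]) auto
qed

section \<open>Uniform ranks\<close>

lemma measure_unit_borel_Ioc:
  "x \<le> y \<Longrightarrow> measure unit_borel {x<..y} \<le> y - x"
proof -
  assume xy: "x \<le> y"
  have "emeasure unit_borel {x<..y} = emeasure lborel ({0..1} \<inter> {x<..y})"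
    by (simp add: emeasure_unit_borel)
  also have "\<dots> \<le> emeasure lborel {x<..y}" by (intro emeasure_mono) auto
  also have "\<dots> = ennreal (y - x)" using xy by simp
  finally show ?thesis
    unfolding measure_def using xy by (simp add: enn2real_leI)
qed

lemma AE_unit_borel_neq: "AE x in unit_borel. x \<noteq> a"
  unfolding AE_unit_borel using AE_lborel_singleton[of a] by eventually_elim simp

text \<open>The mass of \<open>A\<close> up to \<open>x\<close> is 1-Lipschitz in \<open>x\<close>,
  so it attains \<open>\<delta>\<close>. The points of smaller value are those to the left of the
  first point where this happens, and that point itself is null.\<close>

lemma measure_unit_borel_below:
  assumes A[measurable]: "A \<in> sets borel" and \<delta>: "0 \<le> \<delta>" "\<delta> \<le> measure unit_borel A"
  shows "measure unit_borel (A \<inter> {x. measure unit_borel (A \<inter> {..x}) < \<delta>}) = \<delta>"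
proof (cases "\<delta> = 0")
  case True
  then have "A \<inter> {x. measure unit_borel (A \<inter> {..x}) < \<delta>} = {}"
    by (auto simp: not_less)
  then show ?thesis using True by simp
next
  case False
  define H where "H x = measure unit_borel (A \<inter> {..x})" for x
  have mono: "H x \<le> H y" if "x \<le> y" for x y
    unfolding H_def using that by (intro unit_borel.finite_measure_mono) auto
  have lip: "H y \<le> H x + (y - x)" if "x \<le> y" for x y
  proof -
    have "H y \<le> measure unit_borel ((A \<inter> {..x}) \<union> {x<..y})"
      unfolding H_def by (intro unit_borel.finite_measure_mono) auto
    also have "\<dots> \<le> measure unit_borel (A \<inter> {..x}) + measure unit_borel {x<..y}"
      by (intro measure_Un_le) auto
    finally show ?thesis using measure_unit_borel_Ioc[OF that] unfolding H_def by simp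
  qed
  have abs: "\<bar>H x - H y\<bar> \<le> \<bar>x - y\<bar>" for x y
    using mono[of x y] mono[of y x] lip[of x y] lip[of y x] by (cases "x \<le> y") auto
  have cont: "continuous_on UNIV H"
    by (rule lipschitz_on_continuous_on[of 1]) (auto intro!: lipschitz_onI simp: dist_real_def abs)
  have H0: "H x = 0" if "x \<le> 0" for x
  proof -
    have "AE y in unit_borel. y \<notin> A \<inter> {..x}"
      using AE_unit_borel_neq[of 0] AE_unit_borel_Icc by eventually_elim (use that in auto)
    then show ?thesis unfolding H_def by (subst unit_borel.prob_eq_0) auto
  qed
  have H1: "H 1 = measure unit_borel A"
    unfolding H_def using AE_unit_borel_Icc by (intro measure_eq_AE) (auto elim: eventually_mono)
  \<comment> \<open>The condition \<open>0 \<le> x\<close> bounds the set from below. It cuts off no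
    point with \<open>\<delta> \<le> H x\<close>, except possibly to the left of 0, where the mass
    is 0 and \<open>\<delta>\<close> is positive.\<close>
  define S where "S = {x. 0 \<le> x \<and> \<delta> \<le> H x}"
  have S1: "1 \<in> S" using \<delta> H1 unfolding S_def by simp
  have Scl: "closed S"
    unfolding S_def by (intro closed_Collect_conj closed_Collect_le continuous_intros cont)
  define x0 where "x0 = Inf S"
  have bdd: "bdd_below S" unfolding S_def by (auto intro: bdd_belowI[of _ 0])
  have x0: "x0 \<in> S" unfolding x0_def using S1 bdd Scl by (intro closed_contains_Inf) auto
  have less: "H x < \<delta> \<longleftrightarrow> x < x0" for x
  proof
    assume "H x < \<delta>"
    then show "x < x0" using mono[of x0 x] x0 unfolding S_def by (cases "x < x0") auto
  next
    assume "x < x0"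
    then have "x \<notin> S" unfolding x0_def using bdd by (meson cInf_lower not_le)
    then show "H x < \<delta>" using H0[of x] False \<delta>(1) unfolding S_def by (cases "0 \<le> x") auto
  qed
  have "(H \<longlongrightarrow> H x0) (at_left x0)"
    using cont by (simp add: continuous_on_eq_continuous_within continuous_within filterlim_at_split)
  moreover have "eventually (\<lambda>x. H x \<le> \<delta>) (at_left x0)"
    using less by (auto simp: eventually_at_filter less_imp_le)
  ultimately have "H x0 \<le> \<delta>"
    by (intro tendsto_upperbound[of H _ "at_left x0"]) auto
  then have Hx0: "H x0 = \<delta>" using x0 unfolding S_def by auto
  have "measure unit_borel (A \<inter> {x. H x < \<delta>}) = measure unit_borel (A \<inter> {..x0})"
    unfolding less using AE_unit_borel_neq[of x0]
    by (intro measure_eq_AE) (auto elim!: eventually_mono)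
  then show ?thesis using Hx0 unfolding H_def by simp
qed

text \<open>Breaking ties by position makes the rank uniform even if \<open>p\<close> has atoms.\<close>

definition lex_below :: "(real \<Rightarrow> real) \<Rightarrow> real \<Rightarrow> real set" where
  "lex_below p x = {y. p y < p x \<or> (p y = p x \<and> y \<le> x)}"

definition lex_rank :: "(real \<Rightarrow> real) \<Rightarrow> real \<Rightarrow> real" where
  "lex_rank p x = measure unit_borel (lex_below p x)"

lemma lex_below_sets [measurable]:
  assumes [measurable]: "p \<in> borel_measurable borel"
  shows "lex_below p x \<in> sets borel"
  unfolding lex_below_def by measurable

text \<open>The rank is the mass of a section of one Borel subset of the plane.\<close>

lemma lex_rank_measurable [measurable]:
  assumes [measurable]: "p \<in> borel_measurable borel"
  shows "lex_rank p \<in> borel_measurable borel"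
proof -
  let ?R = "{z::real \<times> real. p (snd z) < p (fst z) \<or> (p (snd z) = p (fst z) \<and> snd z \<le> fst z)}"
  have "{z \<in> space (borel \<Otimes>\<^sub>M unit_borel). p (snd z) < p (fst z) \<or> (p (snd z) = p (fst z) \<and> snd z \<le> fst z)}
      \<in> sets (borel \<Otimes>\<^sub>M unit_borel)"
    by measurable
  then have R: "?R \<in> sets (borel \<Otimes>\<^sub>M unit_borel)"
    by (simp add: space_pair_measure)
  have "Pair x -` ?R = lex_below p x" for x
    by (auto simp: lex_below_def)
  then have [measurable]: "(\<lambda>x. emeasure unit_borel (lex_below p x)) \<in> borel_measurable borel"
    using unit_borel.measurable_emeasure_Pair[OF R] by (simp only:)
  show ?thesis
    unfolding lex_rank_def[abs_def] measure_def by measurable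
qed

text \<open>The points of rank below \<open>s\<close> are those where \<open>p\<close> is below the
  quantile \<open>Q s\<close>, together with an initial piece of the level set at \<open>Q s\<close>
  that brings the mass to \<open>s\<close>. For the second claim, the rank of \<open>x\<close> is at
  most \<open>cdf \<kappa> (p x)\<close> and at least \<open>cdf \<kappa> r\<close> for every
  \<open>r < p x\<close>, which pins down its quantile outside a null set.\<close>

lemma lex_rank:
  assumes p[measurable]: "p \<in> borel_measurable borel"
    and \<kappa>: "\<kappa> = distr unit_borel borel p"
    and Q: "\<And>s x. 0 < s \<Longrightarrow> s < 1 \<Longrightarrow> (s \<le> cdf \<kappa> x \<longleftrightarrow> Q s \<le> x)"
  shows "distr unit_borel borel (lex_rank p) = unit_borel"
    and "AE x in unit_borel. Q (lex_rank p x) = p x"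
proof -
  interpret \<kappa>: real_distribution \<kappa>
    unfolding \<kappa> by (rule unit_borel.real_distribution_distr) measurable
  have F: "cdf \<kappa> x = measure unit_borel {y. p y \<le> x}" for x
    unfolding \<kappa> cdf_def by (subst measure_distr) (auto intro!: arg_cong[where f="measure unit_borel"])
  have Fm: "measure \<kappa> {..<x} = measure unit_borel {y. p y < x}" for x
    unfolding \<kappa> by (subst measure_distr) (auto intro!: arg_cong[where f="measure unit_borel"])
  have rank_le: "lex_rank p x \<le> cdf \<kappa> (p x)" for x
    unfolding lex_rank_def F lex_below_def by (intro unit_borel.finite_measure_mono) auto
  have rank_ge: "cdf \<kappa> r \<le> lex_rank p x" if "r < p x" for r x
    unfolding lex_rank_def F lex_below_def using that by (intro unit_borel.finite_measure_mono) auto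
  have law: "measure unit_borel {x. lex_rank p x < s} = s" if s: "0 < s" "s < 1" for s
  proof -
    define q where "q = Q s"
    define A where "A = {y. p y = q}"
    have Am[measurable]: "A \<in> sets borel" unfolding A_def by measurable
    \<comment> \<open>The mass that the level set has to contribute to reach \<open>s\<close>. That
      it lies between 0 and the mass of the level set is the quantile property of
      \<open>q\<close>.\<close>
    define \<delta> where "\<delta> = s - measure unit_borel {y. p y < q}"
    have below: "cdf \<kappa> r < s" if "r < q" for r
      using Q[OF s, of r] that unfolding q_def by auto
    have above: "s \<le> cdf \<kappa> q"
      using Q[OF s, of q] unfolding q_def by auto
    have split: "measure unit_borel ({y. p y < q} \<union> (A \<inter> B)) = measure unit_borel {y. p y < q} + measure unit_borel (A \<inter> B)"
      if [measurable]: "B \<in> sets borel" for B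
      by (rule unit_borel.finite_measure_Union) (auto simp: A_def)
    have "measure \<kappa> {..<q} \<le> s"
    proof (rule tendsto_upperbound[OF \<kappa>.cdf_at_left])
      show "eventually (\<lambda>r. cdf \<kappa> r \<le> s) (at_left q)"
        using below by (auto simp: eventually_at_filter less_imp_le)
    qed simp
    then have \<delta>0: "0 \<le> \<delta>" unfolding \<delta>_def Fm by simp
    have "cdf \<kappa> q = measure unit_borel ({y. p y < q} \<union> (A \<inter> UNIV))"
      unfolding F by (intro arg_cong[where f="measure unit_borel"]) (auto simp: A_def)
    then have \<delta>1: "\<delta> \<le> measure unit_borel A"
      using above split[of UNIV] unfolding \<delta>_def by simp
    have in_A: "lex_rank p x = measure unit_borel {y. p y < q} + measure unit_borel (A \<inter> {..x})" if "x \<in> A" for x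
    proof -
      have "lex_below p x = {y. p y < q} \<union> (A \<inter> {..x})"
        using that unfolding lex_below_def A_def by auto
      then show ?thesis unfolding lex_rank_def using split[of "{..x}"] by simp
    qed
    have "lex_rank p x < s \<longleftrightarrow> x \<in> {y. p y < q} \<union> (A \<inter> {x. measure unit_borel (A \<inter> {..x}) < \<delta>})" for x
    proof (cases "p x < q")
      case True
      then show ?thesis using rank_le[of x] below[of "p x"] by auto
    next
      case False
      show ?thesis
      proof (cases "x \<in> A")
        case True
        then show ?thesis using False in_A[OF True] unfolding \<delta>_def by auto
      next
        case F2: False
        then have "q < p x" using False unfolding A_def by auto
        then show ?thesis using rank_ge[of q x] above False F2 by auto
      qed
    qed
    then have eq: "{x. lex_rank p x < s} = {y. p y < q} \<union> (A \<inter> {x. measure unit_borel (A \<inter> {..x}) < \<delta>})"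
      by blast
    have "mono (\<lambda>x. measure unit_borel (A \<inter> {..x}))"
      by (intro monoI unit_borel.finite_measure_mono) auto
    then have [measurable]: "(\<lambda>x. measure unit_borel (A \<inter> {..x})) \<in> borel_measurable borel"
      by (rule borel_measurable_mono)
    have "measure unit_borel {x. lex_rank p x < s}
        = measure unit_borel {y. p y < q} + measure unit_borel (A \<inter> {x. measure unit_borel (A \<inter> {..x}) < \<delta>})"
      unfolding eq by (rule split) measurable
    also have "\<dots> = s"
      unfolding measure_unit_borel_below[OF Am \<delta>0 \<delta>1] by (simp add: \<delta>_def)
    finally show ?thesis .
  qed
  have [measurable]: "lex_rank p \<in> borel_measurable borel" by measurable
  have rd1: "real_distribution (distr unit_borel borel (lex_rank p))"
    by (rule unit_borel.real_distribution_distr) measurable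
  show distr: "distr unit_borel borel (lex_rank p) = unit_borel"
  proof (rule cdf_unique[OF rd1 real_distribution_unit_borel], rule ext)
    interpret D: real_distribution "distr unit_borel borel (lex_rank p)" by (rule rd1)
    interpret U: real_distribution unit_borel by (rule real_distribution_unit_borel)
    have m: "measure (distr unit_borel borel (lex_rank p)) {..<s} = s" if "0 < s" "s < 1" for s
      by (subst measure_distr) (auto simp: law[OF that, unfolded vimage_def] vimage_def)
    have u: "cdf unit_borel s = (if s < 0 then 0 else if s \<le> 1 then s else 1)" for s
    proof -
      have "{0..1} \<inter> {..s} = (if s < 0 then {} else if s \<le> 1 then {0..s} else {0..1})" by auto
      then show ?thesis
        unfolding cdf_def measure_def by (simp add: emeasure_unit_borel)
    qed
    fix s :: real
    show "cdf (distr unit_borel borel (lex_rank p)) s = cdf unit_borel s"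
    proof (cases "0 \<le> s \<and> s < 1")
      case True
      have "s' \<ge> cdf (distr unit_borel borel (lex_rank p)) s" if "s < s'" "s' < 1" for s'
        unfolding cdf_def using that True
        by (subst m[of s', symmetric]) (auto intro!: D.finite_measure_mono)
      then have "cdf (distr unit_borel borel (lex_rank p)) s \<le> s"
        using True by (intro dense_ge_bounded[of s 1]) auto
      moreover have "s \<le> cdf (distr unit_borel borel (lex_rank p)) s"
      proof (cases "s = 0")
        case False
        have "measure (distr unit_borel borel (lex_rank p)) {..<s} \<le> measure (distr unit_borel borel (lex_rank p)) {..s}"
          by (intro D.finite_measure_mono) auto
        then show ?thesis
          unfolding cdf_def using True False m[of s] by auto
      qed (simp add: cdf_def)
      ultimately show ?thesis using u True by simp
    next
      case False
      have rng: "0 \<le> lex_rank p x" "lex_rank p x \<le> 1" for x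
        unfolding lex_rank_def by auto
      have "cdf (distr unit_borel borel (lex_rank p)) s = measure unit_borel {x. lex_rank p x \<le> s}"
        unfolding cdf_def by (subst measure_distr) (auto intro!: arg_cong[where f="measure unit_borel"])
      also have "{x. lex_rank p x \<le> s} = (if s < 0 then {} else UNIV)"
      proof (cases "s < 0")
        case True
        then show ?thesis using rng(1) by (auto simp: not_le intro: less_le_trans)
      next
        case F2: False
        then have "1 \<le> s" using False by auto
        then show ?thesis using F2 rng(2) by (auto intro: order_trans)
      qed
      finally show ?thesis using False u unit_borel.prob_space by auto
    qed
  qed
  have neq: "AE x in unit_borel. lex_rank p x \<noteq> a" for a
  proof (rule AE_distrD[of "lex_rank p" unit_borel borel "\<lambda>y. y \<noteq> a"])
    show "AE y in distr unit_borel borel (lex_rank p). y \<noteq> a"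
      unfolding distr by (rule AE_unit_borel_neq)
  qed measurable
  \<comment> \<open>If \<open>Q\<close> fell below \<open>p x\<close>, a rational \<open>r\<close>
    between them would force the rank to equal \<open>cdf \<kappa> r\<close>; these are countably
    many values of a uniform variable.\<close>
  have "AE x in unit_borel. \<forall>r::rat. lex_rank p x \<noteq> cdf \<kappa> (of_rat r)"
    by (intro AE_all_countable[THEN iffD2] allI neq)
  moreover have "AE x in unit_borel. lex_rank p x \<in> {0..1}"
  proof (rule AE_distrD[of "lex_rank p" unit_borel borel "\<lambda>y. y \<in> {0..1}"])
    show "AE y in distr unit_borel borel (lex_rank p). y \<in> {0..1}"
      unfolding distr by (rule AE_unit_borel_Icc)
  qed measurable
  ultimately show "AE x in unit_borel. Q (lex_rank p x) = p x"
    using neq[of 0] neq[of 1]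
  proof eventually_elim
    case (elim x)
    let ?s = "lex_rank p x"
    have s: "0 < ?s" "?s < 1" using elim by auto
    have le: "Q ?s \<le> p x" using Q[OF s, of "p x"] rank_le by simp
    have "\<not> Q ?s < p x"
    proof
      assume "Q ?s < p x"
      then obtain r where r: "Q ?s < of_rat r" "of_rat r < p x" using of_rat_dense by blast
      then have "?s \<le> cdf \<kappa> (of_rat r)" using Q[OF s, of "of_rat r"] by simp
      moreover have "cdf \<kappa> (of_rat r) \<le> ?s" using rank_ge r by simp
      ultimately show False using elim(1) by (meson antisym)
    qed
    with le show ?case by simp
  qed
qed

section \<open>Factorization of kernels\<close>

lemma measure_eqI_rectangles:
  assumes sets: "sets M = sets (borel \<Otimes>\<^sub>M borel)" "sets N = sets (borel \<Otimes>\<^sub>M borel)"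
    and fin: "emeasure M UNIV \<noteq> \<infinity>"
    and eq: "\<And>A B. A \<in> sets borel \<Longrightarrow> B \<in> sets borel \<Longrightarrow> emeasure M (A \<times> B) = emeasure N (A \<times> B)"
  shows "M = (N :: (real \<times> real) measure)"
proof (rule measure_eqI_generator_eq)
  let ?E = "{A \<times> B | A B. A \<in> sets (borel :: real measure) \<and> B \<in> sets (borel :: real measure)}"
  show "Int_stable ?E" by (rule Int_stable_pair_measure_generator)
  show "?E \<subseteq> Pow UNIV" by simp
  show "emeasure M X = emeasure N X" if "X \<in> ?E" for X using that eq by auto
  show "sets M = sigma_sets UNIV ?E" "sets N = sigma_sets UNIV ?E"
    unfolding sets by (simp_all add: sets_pair_measure)
  show "range (\<lambda>_::nat. UNIV :: (real \<times> real) set) \<subseteq> ?E"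
    by (auto intro!: exI[of _ UNIV])
  show "(\<Union>i::nat. UNIV :: (real \<times> real) set) = UNIV" by simp
  show "emeasure M UNIV \<noteq> \<infinity>" for i :: nat by (rule fin)
qed

lemma borel_eq_rat_atMost:
  "borel = sigma UNIV (range (\<lambda>k. {..of_rat (from_nat k) :: real}))"
proof (rule borel_eq_sigmaI1[OF borel_eq_atMost])
  let ?S = "sigma UNIV (range (\<lambda>k. {..of_rat (from_nat k) :: real}))"
  fix X assume "X \<in> range (\<lambda>a::real. {..a})"
  then obtain a where X: "X = {..a}" by auto
  have "{..a} = (\<Inter>k\<in>{k. a < of_rat (from_nat k)}. {..of_rat (from_nat k)})"
  proof (intro antisym subsetI)
    fix x :: real assume x: "x \<in> (\<Inter>k\<in>{k. a < of_rat (from_nat k)}. {..of_rat (from_nat k)})"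
    show "x \<in> {..a}"
    proof (rule ccontr)
      assume "x \<notin> {..a}"
      then obtain r where r: "a < of_rat r" "of_rat r < x" using of_rat_dense[of a x] by auto
      then have "x \<in> {..of_rat (from_nat (to_nat r))}" using x by (intro INT_D[OF x]) auto
      then show False using r by simp
    qed
  qed auto
  also have "\<dots> \<in> sets ?S"
  proof (rule sets.countable_INT')
    obtain r where "a < of_rat r" using of_rat_dense[of a "a + 1"] by auto
    then show "{k. a < of_rat (from_nat k)} \<noteq> {}"
      by (auto intro!: exI[of _ "to_nat r"])
  qed auto
  finally show "X \<in> sets ?S" unfolding X .
qed auto

text \<open>Measurability of the relation permits the descent from pulled-back points to the points
  themselves, the direction needed to return from a common space.\<close>

lemma AE_pair_map_iff:
  assumes f: "f \<in> borel_measurable borel" "distr unit_borel borel f = unit_borel"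
    and P: "{z. P (fst z) (snd z)} \<in> sets (borel \<Otimes>\<^sub>M borel)"
  shows "(AE z in square_borel. P (f (fst z)) (f (snd z)))
    \<longleftrightarrow> (AE z in square_borel. P (fst z) (snd z))"
proof -
  have f': "f \<in> unit_borel \<rightarrow>\<^sub>M borel" using f(1) by measurable
  have m: "(\<lambda>z. (f (fst z), f (snd z))) \<in> square_borel \<rightarrow>\<^sub>M square_borel"
    using f(1) by measurable
  have d: "distr square_borel square_borel (\<lambda>z. (f (fst z), f (snd z)))
      = square_borel"
    by (rule distr_pair_same[OF f' f(2) prob_unit_borel]) simp
  have s: "sets square_borel = sets (borel \<Otimes>\<^sub>M borel)"
    by (intro sets_pair_measure_cong) auto
  have "(AE z in distr square_borel square_borel (\<lambda>z. (f (fst z), f (snd z))).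
      P (fst z) (snd z)) \<longleftrightarrow> (AE z in square_borel. P (f (fst z)) (f (snd z)))"
    using P by (subst AE_distr_iff[OF m]) (auto simp: s space_pair_measure)
  then show ?thesis unfolding d by simp
qed

lemma AE_unit_borel_pair_both:
  assumes "AE x in unit_borel. P x"
  shows "AE z in square_borel. P (fst z) \<and> P (snd z)"
proof -
  obtain N where N: "N \<in> null_sets unit_borel" "{x. \<not> P x} \<subseteq> N"
    using assms unfolding eventually_ae_filter by auto
  have "AE x in unit_borel. x \<notin> N" by (rule AE_not_in[OF N(1)])
  then have *: "AE x in unit_borel. AE y in unit_borel. x \<notin> N \<and> y \<notin> N"
    by (auto elim: eventually_mono)
  have Nm[measurable]: "N \<in> sets borel" using N(1) by (auto dest: null_setsD2)
  have "{z \<in> space square_borel. fst z \<notin> N \<and> snd z \<notin> N} \<in> sets square_borel"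
    by measurable
  then have "AE z in square_borel. fst z \<notin> N \<and> snd z \<notin> N"
    by (rule unit_borel2.AE_pair_measure) (use * in simp)
  then show ?thesis by (rule eventually_mono) (use N(2) in blast)
qed

text \<open>
  The hypothesis says that the sections of \<open>V\<close> over a countable generator of the Borel sets are
  functions of \<open>p\<close>; by symmetry \<open>V\<close> is then a function of \<open>p\<close> in each of its arguments.
\<close>

lemma kernel_factorization:
  fixes V :: "real \<Rightarrow> real \<Rightarrow> real" and p :: "real \<Rightarrow> real"
  assumes V: "case_prod V \<in> borel_measurable (borel \<Otimes>\<^sub>M borel)"
    and V01: "\<And>x y. 0 \<le> V x y" "\<And>x y. V x y \<le> 1" and sym: "\<And>x y. V x y = V y x"
    and p[measurable]: "p \<in> borel_measurable borel"
    and G0: "\<And>k. \<exists>G\<in>borel_measurable borel. AE x in unit_borel.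
      (\<integral>\<^sup>+y\<in>{..of_rat (from_nat k)}. ennreal (V x y) \<partial>unit_borel) = G (p x)"
  shows "\<exists>u. case_prod u \<in> borel_measurable (borel \<Otimes>\<^sub>M borel) \<and> (\<forall>r s. 0 \<le> u r s \<and> u r s \<le> 1) \<and>
    (\<forall>r s. u r s = u s r) \<and>
    (AE z in square_borel. V (fst z) (snd z) = u (p (fst z)) (p (snd z)))"
proof -
  let ?M = unit_borel and ?M2 = square_borel
  define v where "v z = ennreal (V (fst z) (snd z))" for z
  have vm[measurable]: "v \<in> borel_measurable (borel \<Otimes>\<^sub>M borel)"
    using V unfolding v_def by (simp add: case_prod_beta')
  have v1: "v z \<le> 1" for z using V01(2) unfolding v_def by simp
  define c where "c A x = (\<integral>\<^sup>+y\<in>A. v (x, y) \<partial>?M)" for A x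
  have c_em: "c A x = emeasure (density ?M (\<lambda>y. v (x, y))) A" if "A \<in> sets borel" for A x
    unfolding c_def using that by (subst emeasure_density) auto
  have c_le: "c A x \<le> 1" if [measurable]: "A \<in> sets borel" for A x
  proof -
    have "c A x \<le> (\<integral>\<^sup>+y. 1 \<partial>?M)"
      unfolding c_def by (intro nn_integral_mono) (auto simp: indicator_def v1)
    then show ?thesis using unit_borel.emeasure_space_1 by simp
  qed
  have c_fin: "finite_measure (density ?M (\<lambda>y. v (x, y)))" for x
    using c_le[of UNIV x] c_em[of UNIV x]
    by (intro finite_measureI) (auto simp: top_unique)
  have c_fact: "\<exists>G\<in>borel_measurable borel. AE x in ?M. c A x = G (p x)" if A: "A \<in> sets borel" for A
  proof -
    let ?E = "range (\<lambda>k. {..of_rat (from_nat k) :: real})"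
    \<comment> \<open>The ray up to 1 has full measure, so \<open>GU\<close> describes the total
      mass of a section, from which the step for complements subtracts.\<close>
    obtain GU where GU[measurable]: "GU \<in> borel_measurable borel"
      and GUe: "AE x in ?M. c {..1} x = GU (p x)"
      using G0[of "to_nat (1::rat)"] unfolding c_def v_def by auto
    have cU: "c UNIV x = c {..1} x" for x
      unfolding c_def
    proof (rule nn_integral_cong_AE)
      show "AE y in ?M. v (x, y) * indicator UNIV y = v (x, y) * indicator {..1} y"
        using AE_unit_borel_Icc by eventually_elim auto
    qed
    have b: "sets borel = sigma_sets UNIV ?E"
      by (subst borel_eq_rat_atMost) simp
    have "Int_stable ?E"
    proof (rule Int_stableI)
      fix A B assume "A \<in> ?E" "B \<in> ?E"
      then obtain i j where "A = {..of_rat (from_nat i)}" "B = {..of_rat (from_nat j)}" by auto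
      then have "A \<inter> B = A \<or> A \<inter> B = B" by auto
      then show "A \<inter> B \<in> ?E" using \<open>A \<in> ?E\<close> \<open>B \<in> ?E\<close> by metis
    qed
    moreover have "?E \<subseteq> Pow UNIV" by simp
    moreover have "A \<in> sigma_sets UNIV ?E" using A unfolding b .
    ultimately show ?thesis
    proof (induction rule: sigma_sets_induct_disjoint)
      case (basic A)
      then show ?case using G0 unfolding c_def v_def by auto
    next
      case empty
      show ?case by (intro bexI[of _ "\<lambda>_. 0"]) (auto simp: c_def)
    next
      case (compl A)
      then obtain G where G[measurable]: "G \<in> borel_measurable borel" and Ge: "AE x in ?M. c A x = G (p x)"
        by blast
      have A: "A \<in> sets borel" using compl b by simp
      have cc: "c (UNIV - A) x = c UNIV x - c A x" for x
      proof -
        interpret F: finite_measure "density ?M (\<lambda>y. v (x, y))" by (rule c_fin)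
        show ?thesis using A emeasure_compl[of A "density ?M (\<lambda>y. v (x, y))"] F.emeasure_finite[of A]
          by (simp add: c_em)
      qed
      show ?case
      proof (rule bexI[of _ "\<lambda>r. GU r - G r"])
        show "AE x in ?M. c (UNIV - A) x = GU (p x) - G (p x)"
          using GUe Ge by eventually_elim (simp add: cc cU)
      qed measurable
    next
      case (union A)
      then have "\<forall>i. \<exists>G\<in>borel_measurable borel. AE x in ?M. c (A i) x = G (p x)" by blast
      then obtain G where G[measurable]: "\<And>i. G i \<in> borel_measurable borel"
        and Ge: "\<And>i. AE x in ?M. c (A i) x = G i (p x)" by metis
      have A: "A i \<in> sets borel" for i using union b by auto
      have cc: "c (\<Union>i. A i) x = (\<Sum>i. c (A i) x)" for x
        using A union(1) suminf_emeasure[of A "density ?M (\<lambda>y. v (x, y))"] by (simp add: c_em image_subset_iff)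
      show ?case
      proof (rule bexI[of _ "\<lambda>r. \<Sum>i. G i r"])
        have "AE x in ?M. \<forall>i. c (A i) x = G i (p x)"
          using Ge by (simp add: AE_all_countable)
        then show "AE x in ?M. c (\<Union>i. A i) x = (\<Sum>i. G i (p x))"
          by eventually_elim (simp add: cc)
      qed measurable
    qed
  qed
  define \<kappa> where "\<kappa> = distr ?M borel p"
  interpret \<kappa>: prob_space \<kappa>
    unfolding \<kappa>_def by (rule unit_borel.prob_space_distr) measurable
  interpret \<kappa>2: pair_prob_space \<kappa> \<kappa> ..
  have \<kappa>s[simp, measurable_cong]: "sets \<kappa> = sets borel" unfolding \<kappa>_def by simp
  let ?p2 = "\<lambda>z. (p (fst z), p (snd z))"
  have p2: "?p2 \<in> ?M2 \<rightarrow>\<^sub>M \<kappa> \<Otimes>\<^sub>M \<kappa>" by measurable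
  have d\<kappa>2: "distr ?M2 (\<kappa> \<Otimes>\<^sub>M \<kappa>) ?p2 = \<kappa> \<Otimes>\<^sub>M \<kappa>"
    by (rule distr_pair_same[of p ?M borel]) (auto simp: \<kappa>_def prob_unit_borel)
  \<comment> \<open>The density of this image measure, read at \<open>(p x, p y)\<close>, is the
    conditional expectation of \<open>V\<close> given \<open>p\<close> in both variables. The rest
    shows that conditioning changes nothing.\<close>
  define N where "N = distr (density ?M2 v) (\<kappa> \<Otimes>\<^sub>M \<kappa>) ?p2"
  have ac: "absolutely_continuous (\<kappa> \<Otimes>\<^sub>M \<kappa>) N"
    unfolding absolutely_continuous_def
  proof
    fix X assume X: "X \<in> null_sets (\<kappa> \<Otimes>\<^sub>M \<kappa>)"
    then have Xs: "X \<in> sets (\<kappa> \<Otimes>\<^sub>M \<kappa>)" by auto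
    have "emeasure ?M2 (?p2 -` X \<inter> space ?M2) = 0"
      using X Xs p2 by (subst emeasure_distr[OF p2 Xs, symmetric]) (auto simp: d\<kappa>2)
    then have "?p2 -` X \<inter> space ?M2 \<in> null_sets ?M2"
      using measurable_sets[OF p2 Xs] by auto
    then have "?p2 -` X \<inter> space ?M2 \<in> null_sets (density ?M2 v)"
      by (auto intro!: absolutely_continuousI_density[unfolded absolutely_continuous_def, THEN subsetD])
    then show "X \<in> null_sets N"
      unfolding N_def using Xs p2 by (subst null_sets_distr_iff) auto
  qed
  define f where "f = RN_deriv (\<kappa> \<Otimes>\<^sub>M \<kappa>) N"
  have fm0: "f \<in> borel_measurable (\<kappa> \<Otimes>\<^sub>M \<kappa>)" unfolding f_def by simp
  have s\<kappa>2: "sets (\<kappa> \<Otimes>\<^sub>M \<kappa>) = sets (borel \<Otimes>\<^sub>M borel)" by (intro sets_pair_measure_cong) auto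
  have sM2: "sets ?M2 = sets (borel \<Otimes>\<^sub>M borel)" by (intro sets_pair_measure_cong) auto
  have fm[measurable]: "f \<in> borel_measurable (borel \<Otimes>\<^sub>M borel)"
    using fm0 by (simp add: measurable_cong_sets[OF s\<kappa>2 refl])
  have fN: "density (\<kappa> \<Otimes>\<^sub>M \<kappa>) f = N"
    unfolding f_def by (rule \<kappa>2.density_RN_deriv[OF ac]) (simp add: N_def)
  define h where "h z = f (p (fst z), p (snd z))" for z
  have hm[measurable]: "h \<in> borel_measurable (borel \<Otimes>\<^sub>M borel)" unfolding h_def by measurable
  have base: "(\<integral>\<^sup>+z. v z * indicator (p -` A \<times> p -` B) z \<partial>?M2) = (\<integral>\<^sup>+z. h z * indicator (p -` A \<times> p -` B) z \<partial>?M2)"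
    if [measurable]: "A \<in> sets borel" "B \<in> sets borel" for A B
  proof -
    have AB: "A \<times> B \<in> sets (\<kappa> \<Otimes>\<^sub>M \<kappa>)" by measurable
    have pm: "p -` A \<times> p -` B \<in> sets ?M2"
      using measurable_sets[OF p, of A] measurable_sets[OF p, of B] that by (auto intro!: pair_measureI)
    have pre: "?p2 -` (A \<times> B) \<inter> space ?M2 = p -` A \<times> p -` B" by (auto simp: space_pair_measure)
    have "emeasure N (A \<times> B) = (\<integral>\<^sup>+z. v z * indicator (p -` A \<times> p -` B) z \<partial>?M2)"
      unfolding N_def using AB p2 pm
      by (subst emeasure_distr) (auto simp: emeasure_density pre)
    moreover have "emeasure N (A \<times> B) = (\<integral>\<^sup>+z. h z * indicator (p -` A \<times> p -` B) z \<partial>?M2)"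
    proof -
      have "emeasure N (A \<times> B) = (\<integral>\<^sup>+z. f z * indicator (A \<times> B) z \<partial>(\<kappa> \<Otimes>\<^sub>M \<kappa>))"
        unfolding fN[symmetric] using AB fm0 by (simp add: emeasure_density)
      also have "\<dots> = (\<integral>\<^sup>+z. f z * indicator (A \<times> B) z \<partial>distr ?M2 (\<kappa> \<Otimes>\<^sub>M \<kappa>) ?p2)"
        by (simp only: d\<kappa>2)
      also have "\<dots> = (\<integral>\<^sup>+z. f (?p2 z) * indicator (A \<times> B) (?p2 z) \<partial>?M2)"
        using AB fm0 by (intro nn_integral_distr p2) auto
      also have "\<dots> = (\<integral>\<^sup>+z. h z * indicator (p -` A \<times> p -` B) z \<partial>?M2)"
        unfolding h_def by (intro nn_integral_cong) (auto simp: indicator_def)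
      finally show ?thesis .
    qed
    ultimately show ?thesis by simp
  qed
  have iter: "(\<integral>\<^sup>+z. k z * indicator (A \<times> B) z \<partial>?M2) = (\<integral>\<^sup>+x\<in>A. (\<integral>\<^sup>+y\<in>B. k (x, y) \<partial>?M) \<partial>?M)"
    if [measurable]: "A \<in> sets borel" "B \<in> sets borel" "k \<in> borel_measurable (borel \<Otimes>\<^sub>M borel)"
    for A B and k :: "real \<times> real \<Rightarrow> ennreal"
  proof -
    have "(\<integral>\<^sup>+z. k z * indicator (A \<times> B) z \<partial>?M2) = (\<integral>\<^sup>+x. \<integral>\<^sup>+y. k (x, y) * indicator (A \<times> B) (x, y) \<partial>?M \<partial>?M)"
      by (subst unit_borel.nn_integral_fst[symmetric]) auto
    also have "\<dots> = (\<integral>\<^sup>+x. \<integral>\<^sup>+y. (k (x, y) * indicator B y) * indicator A x \<partial>?M \<partial>?M)"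
      by (intro nn_integral_cong) (auto simp: indicator_def)
    also have "\<dots> = (\<integral>\<^sup>+x\<in>A. (\<integral>\<^sup>+y\<in>B. k (x, y) \<partial>?M) \<partial>?M)"
      by (subst nn_integral_multc) auto
    finally show ?thesis .
  qed
  have iter2: "(\<integral>\<^sup>+z. k z * indicator (A \<times> B) z \<partial>?M2) = (\<integral>\<^sup>+y\<in>B. (\<integral>\<^sup>+x\<in>A. k (y, x) \<partial>?M) \<partial>?M)"
    if AB[measurable]: "A \<in> sets borel" "B \<in> sets borel" and k[measurable]: "k \<in> borel_measurable (borel \<Otimes>\<^sub>M borel)"
      and ks: "\<And>x y. k (x, y) = k (y, x)"
    for A B and k :: "real \<times> real \<Rightarrow> ennreal"
  proof -
    have "(\<integral>\<^sup>+z. k z * indicator (A \<times> B) z \<partial>?M2) = (\<integral>\<^sup>+y. \<integral>\<^sup>+x. k (x, y) * indicator (A \<times> B) (x, y) \<partial>?M \<partial>?M)"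
      by (subst unit_borel2.nn_integral_snd[symmetric]) auto
    also have "\<dots> = (\<integral>\<^sup>+y. \<integral>\<^sup>+x. (k (y, x) * indicator A x) * indicator B y \<partial>?M \<partial>?M)"
      by (intro nn_integral_cong) (auto simp: indicator_def ks)
    also have "\<dots> = (\<integral>\<^sup>+y\<in>B. (\<integral>\<^sup>+x\<in>A. k (y, x) \<partial>?M) \<partial>?M)"
      by (subst nn_integral_multc) auto
    finally show ?thesis .
  qed
  \<comment> \<open>A function of \<open>p\<close> is determined almost everywhere by its integrals
    over preimages under \<open>p\<close>.\<close>
  have uniq: "AE x in ?M. G (p x) = K (p x)"
    if [measurable]: "G \<in> borel_measurable borel" "K \<in> borel_measurable borel"
      and eq: "\<And>A. A \<in> sets borel \<Longrightarrow> (\<integral>\<^sup>+x\<in>p -` A. G (p x) \<partial>?M) = (\<integral>\<^sup>+x\<in>p -` A. K (p x) \<partial>?M)"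
    for G K :: "real \<Rightarrow> ennreal"
  proof -
    have i: "(\<integral>\<^sup>+r. J r * indicator A r \<partial>\<kappa>) = (\<integral>\<^sup>+x\<in>p -` A. J (p x) \<partial>?M)"
      if [measurable]: "J \<in> borel_measurable borel" "A \<in> sets borel" for J :: "real \<Rightarrow> ennreal" and A
      unfolding \<kappa>_def by (subst nn_integral_distr) (auto simp: indicator_def vimage_def)
    have "density \<kappa> G = density \<kappa> K"
      by (intro measure_eqI) (auto simp: emeasure_density i eq)
    then have "AE r in \<kappa>. G r = K r"
      by (subst (asm) \<kappa>.density_unique_iff) auto
    then show ?thesis unfolding \<kappa>_def by (rule AE_distrD[rotated]) measurable
  qed
  have hs: "(\<integral>\<^sup>+y\<in>A. h (x, y) \<partial>?M) = (\<lambda>r. \<integral>\<^sup>+y\<in>A. f (r, p y) \<partial>?M) (p x)" for A x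
    unfolding h_def by simp
  have hsm[measurable]: "(\<lambda>r. \<integral>\<^sup>+y\<in>A. f (r, p y) \<partial>?M) \<in> borel_measurable borel"
    if [measurable]: "A \<in> sets borel" for A by measurable
  have vs: "v (x, y) = v (y, x)" for x y unfolding v_def using sym by simp
  have pA: "p -` A \<in> sets borel" if "A \<in> sets borel" for A
    using measurable_sets[OF p that] by simp
  \<comment> \<open>Both sides are functions of \<open>p x\<close>, the left one by
    \<open>c_fact\<close>, so testing on preimages suffices. This frees the set of the
    \<open>x\<close> from being a preimage.\<close>
  have step1: "AE x in ?M. c (p -` B) x = (\<integral>\<^sup>+y\<in>p -` B. h (x, y) \<partial>?M)" if B: "B \<in> sets borel" for B
  proof -
    obtain G where G[measurable]: "G \<in> borel_measurable borel" and Ge: "AE x in ?M. c (p -` B) x = G (p x)"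
      using c_fact[OF pA[OF B]] by blast
    have "AE x in ?M. G (p x) = (\<lambda>r. \<integral>\<^sup>+y\<in>p -` B. f (r, p y) \<partial>?M) (p x)"
    proof (rule uniq[OF G hsm[OF pA[OF B]]])
      fix A :: "real set" assume A: "A \<in> sets borel"
      have "(\<integral>\<^sup>+x\<in>p -` A. G (p x) \<partial>?M) = (\<integral>\<^sup>+x\<in>p -` A. c (p -` B) x \<partial>?M)"
        using Ge by (intro nn_integral_cong_AE) (auto elim!: eventually_mono)
      also have "\<dots> = (\<integral>\<^sup>+z. v z * indicator (p -` A \<times> p -` B) z \<partial>?M2)"
        unfolding c_def by (rule iter[OF pA[OF A] pA[OF B] vm, symmetric])
      also have "\<dots> = (\<integral>\<^sup>+x\<in>p -` A. (\<integral>\<^sup>+y\<in>p -` B. h (x, y) \<partial>?M) \<partial>?M)"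
        unfolding base[OF A B] by (rule iter[OF pA[OF A] pA[OF B] hm])
      finally show "(\<integral>\<^sup>+x\<in>p -` A. G (p x) \<partial>?M)
          = (\<integral>\<^sup>+x\<in>p -` A. (\<integral>\<^sup>+y\<in>p -` B. f (p x, p y) \<partial>?M) \<partial>?M)"
        unfolding h_def by simp
    qed
    with Ge show ?thesis by eventually_elim (simp add: h_def)
  qed
  \<comment> \<open>Symmetry exchanges the variables: the section over an arbitrary \<open>A\<close>
    is a function of \<open>p y\<close>, and \<open>step1\<close> supplies the test integrals. Thus
    the other side of the rectangle is freed as well.\<close>
  have step2: "AE y in ?M. c A y = (\<integral>\<^sup>+x\<in>A. h (x, y) \<partial>?M)" if A[measurable]: "A \<in> sets borel" for A
  proof -
    obtain G where G[measurable]: "G \<in> borel_measurable borel" and Ge: "AE x in ?M. c A x = G (p x)"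
      using c_fact[OF A] by blast
    let ?K = "\<lambda>s. \<integral>\<^sup>+x\<in>A. f (p x, s) \<partial>?M"
    have K[measurable]: "?K \<in> borel_measurable borel" by measurable
    have "AE y in ?M. G (p y) = ?K (p y)"
    proof (rule uniq[OF G K])
      fix B :: "real set" assume B: "B \<in> sets borel"
      have [measurable]: "p -` B \<in> sets borel" by (rule pA[OF B])
      have "(\<integral>\<^sup>+y\<in>p -` B. G (p y) \<partial>?M) = (\<integral>\<^sup>+y\<in>p -` B. c A y \<partial>?M)"
        using Ge by (intro nn_integral_cong_AE) (auto elim!: eventually_mono)
      also have "\<dots> = (\<integral>\<^sup>+z. v z * indicator (A \<times> p -` B) z \<partial>?M2)"
        unfolding c_def by (rule iter2[symmetric]) (auto intro: vs)
      also have "\<dots> = (\<integral>\<^sup>+x\<in>A. c (p -` B) x \<partial>?M)"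
        unfolding c_def by (rule iter) measurable
      also have "\<dots> = (\<integral>\<^sup>+x\<in>A. (\<integral>\<^sup>+y\<in>p -` B. h (x, y) \<partial>?M) \<partial>?M)"
        using step1[OF B] by (intro nn_integral_cong_AE) (auto elim!: eventually_mono)
      also have "\<dots> = (\<integral>\<^sup>+z. h z * indicator (A \<times> p -` B) z \<partial>?M2)"
        by (rule iter[symmetric]) measurable
      also have "\<dots> = (\<integral>\<^sup>+y. \<integral>\<^sup>+x. h (x, y) * indicator (A \<times> p -` B) (x, y) \<partial>?M \<partial>?M)"
        by (subst unit_borel2.nn_integral_snd[symmetric]) auto
      also have "\<dots> = (\<integral>\<^sup>+y. \<integral>\<^sup>+x. (h (x, y) * indicator A x) * indicator (p -` B) y \<partial>?M \<partial>?M)"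
        by (intro nn_integral_cong) (auto simp: indicator_def)
      also have "\<dots> = (\<integral>\<^sup>+y\<in>p -` B. (\<integral>\<^sup>+x\<in>A. h (x, y) \<partial>?M) \<partial>?M)"
        by (subst nn_integral_multc) auto
      finally show "(\<integral>\<^sup>+y\<in>p -` B. G (p y) \<partial>?M) = (\<integral>\<^sup>+y\<in>p -` B. (\<integral>\<^sup>+x\<in>A. f (p x, p y) \<partial>?M) \<partial>?M)"
        unfolding h_def by simp
    qed
    with Ge show ?thesis by eventually_elim (simp add: h_def)
  qed
  have "density ?M2 v = density ?M2 h"
  proof (rule measure_eqI_rectangles)
    show "sets (density ?M2 v) = sets (borel \<Otimes>\<^sub>M borel)" "sets (density ?M2 h) = sets (borel \<Otimes>\<^sub>M borel)"
      using sM2 by simp_all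
    have "UNIV \<in> sets ?M2" using sets.top[of ?M2] by (simp add: space_pair_measure)
    then have "emeasure (density ?M2 v) UNIV \<le> (\<integral>\<^sup>+z. 1 \<partial>?M2)"
      by (subst emeasure_density) (auto intro!: nn_integral_mono v1 simp: space_pair_measure
          simp del: nn_integral_const)
    then show "emeasure (density ?M2 v) UNIV \<noteq> \<infinity>"
      using unit_borel2.emeasure_space_1 by (auto simp: top_unique)
    fix A B :: "real set" assume AB[measurable]: "A \<in> sets borel" "B \<in> sets borel"
    have s: "A \<times> B \<in> sets ?M2" by measurable
    have "emeasure (density ?M2 v) (A \<times> B) = (\<integral>\<^sup>+z. v z * indicator (A \<times> B) z \<partial>?M2)"
      using s by (simp add: emeasure_density)
    also have "\<dots> = (\<integral>\<^sup>+y\<in>B. c A y \<partial>?M)"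
      unfolding c_def by (rule iter2) (auto intro: vs)
    also have "\<dots> = (\<integral>\<^sup>+y\<in>B. (\<integral>\<^sup>+x\<in>A. h (x, y) \<partial>?M) \<partial>?M)"
      using step2[OF AB(1)] by (intro nn_integral_cong_AE) (auto elim!: eventually_mono)
    also have "\<dots> = (\<integral>\<^sup>+y. \<integral>\<^sup>+x. (h (x, y) * indicator A x) * indicator B y \<partial>?M \<partial>?M)"
      by (subst nn_integral_multc) auto
    also have "\<dots> = (\<integral>\<^sup>+y. \<integral>\<^sup>+x. h (x, y) * indicator (A \<times> B) (x, y) \<partial>?M \<partial>?M)"
      by (intro nn_integral_cong) (auto simp: indicator_def)
    also have "\<dots> = (\<integral>\<^sup>+z. h z * indicator (A \<times> B) z \<partial>?M2)"
      by (subst unit_borel2.nn_integral_snd[symmetric]) auto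
    also have "\<dots> = emeasure (density ?M2 h) (A \<times> B)"
      using s by (simp add: emeasure_density)
    finally show "emeasure (density ?M2 v) (A \<times> B) = emeasure (density ?M2 h) (A \<times> B)" .
  qed
  then have vh: "AE z in ?M2. v z = h z"
    by (subst (asm) unit_borel2.density_unique_iff) auto
  \<comment> \<open>The derivative \<open>f\<close> may fail to be symmetric; it represents
    \<open>V\<close> in either order, so the symmetric average does so too.\<close>
  then have hv: "AE z in ?M2. v z = h (snd z, fst z)"
  proof -
    have sw: "(\<lambda>(x, y). (y, x)) \<in> ?M2 \<rightarrow>\<^sub>M ?M2" by measurable
    have "AE z in ?M2. v ((\<lambda>(x, y). (y, x)) z) = h ((\<lambda>(x, y). (y, x)) z)"
      by (rule AE_distrD[OF sw]) (use vh in \<open>simp only: unit_borel2.distr_pair_swap[symmetric]\<close>)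
    then show ?thesis by eventually_elim (auto simp: vs)
  qed
  \<comment> \<open>Truncation keeps the values in [0, 1] also on the null set where
    \<open>f\<close> is out of range; an infinite value becomes 0 under
    \<open>enn2real\<close>.\<close>
  define u where "u r s = (min 1 (enn2real (f (r, s))) + min 1 (enn2real (f (s, r)))) / 2" for r s
  have "AE z in ?M2. V (fst z) (snd z) = u (p (fst z)) (p (snd z))"
    using vh hv
  proof eventually_elim
    case (elim z)
    have "enn2real (v z) = V (fst z) (snd z)" unfolding v_def using V01 by simp
    with elim have "enn2real (f (p (fst z), p (snd z))) = V (fst z) (snd z)"
      "enn2real (f (p (snd z), p (fst z))) = V (fst z) (snd z)"
      unfolding h_def by simp_all
    then show ?case unfolding u_def using V01(2)[of "fst z" "snd z"] by simp
  qed
  moreover have "case_prod u \<in> borel_measurable (borel \<Otimes>\<^sub>M borel)"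
    unfolding u_def by measurable
  moreover have "0 \<le> u r s \<and> u r s \<le> 1" "u r s = u s r" for r s
    unfolding u_def by (auto simp: min_def)
  ultimately show ?thesis by blast
qed

section \<open>Codes of sections and a common quotient of two kernels\<close>

text \<open>The affine change puts the values into [0, 1], as \<open>hilbert_code\<close> requires.
  Only the second argument is composed with \<open>f\<close>, so the code is a function on the space
  of the kernel itself and becomes one on the common space by composition.\<close>

definition section_mean :: "(real \<Rightarrow> real \<Rightarrow> real) \<Rightarrow> (real \<Rightarrow> real) \<Rightarrow> nat \<Rightarrow> real \<Rightarrow> real" where
  "section_mean w f k x =
     (\<integral>y. (w x (f y) + 1) / 2 * indicator {..of_rat (from_nat k)} y \<partial>unit_borel)"

definition section_code :: "(real \<Rightarrow> real \<Rightarrow> real) \<Rightarrow> (real \<Rightarrow> real) \<Rightarrow> real \<Rightarrow> real" where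
  "section_code w f x = hilbert_code (\<lambda>k. section_mean w f k x)"

lemma section_mean:
  assumes w: "borel_kernel w" and f[measurable]: "f \<in> borel_measurable borel"
  shows "section_mean w f k \<in> borel_measurable borel"
    and "0 \<le> section_mean w f k x" "section_mean w f k x \<le> 1"
    and "ennreal (section_mean w f k x)
      = (\<integral>\<^sup>+y\<in>{..of_rat (from_nat k)}. ennreal ((w x (f y) + 1) / 2) \<partial>unit_borel)"
proof -
  let ?A = "{..of_rat (from_nat k) :: real}"
  have b: "0 \<le> (w x y + 1) / 2" "(w x y + 1) / 2 \<le> 1" for x y
    using borel_kernelD(3)[OF w, of x y] by (auto simp: abs_le_iff)
  have [measurable]: "(\<lambda>z. w (fst z) (f (snd z))) \<in> borel_measurable (borel \<Otimes>\<^sub>M borel)"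
    by (rule borel_kernel_measurable[OF w]) measurable
  have wx[measurable]: "(\<lambda>y. w x (f y)) \<in> borel_measurable borel" for x
    by (rule borel_kernel_measurable[OF w]) measurable
  have "(\<lambda>x. \<integral>y. (\<lambda>z. (w (fst z) (f (snd z)) + 1) / 2 * indicator ?A (snd z)) (x, y) \<partial>unit_borel) \<in> borel_measurable borel"
    by measurable
  then show "section_mean w f k \<in> borel_measurable borel"
    unfolding section_mean_def[abs_def] by simp
  have int: "integrable unit_borel (\<lambda>y. (w x (f y) + 1) / 2 * indicator ?A y)" for x
    by (rule unit_borel.integrable_const_bound[where B=1])
      (use b in \<open>auto simp: indicator_def abs_of_nonneg\<close>)
  show "0 \<le> section_mean w f k x"
    unfolding section_mean_def using b by (intro Bochner_Integration.integral_nonneg) auto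
  show "section_mean w f k x \<le> 1"
    unfolding section_mean_def using b
    by (intro unit_borel.integral_le_const int) (auto simp: indicator_def)
  show "ennreal (section_mean w f k x) = (\<integral>\<^sup>+y\<in>?A. ennreal ((w x (f y) + 1) / 2) \<partial>unit_borel)"
    unfolding section_mean_def using b int
    by (subst nn_integral_eq_integral[symmetric]) (auto intro!: nn_integral_cong simp: indicator_def)
qed

lemma section_code_measurable:
  assumes "borel_kernel w" "f \<in> borel_measurable borel"
  shows "section_code w f \<in> borel_measurable borel"
  unfolding section_code_def[abs_def]
  by (rule hilbert_code_measurable) (rule section_mean(1)[OF assms])

text \<open>The curve decodes: every mean is a Borel function of the code, which is the form the
  factorization asks for.\<close>

lemma section_code_curve:
  assumes "borel_kernel w" "f \<in> borel_measurable borel"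
  shows "hilbert_curve k (section_code w f x) = section_mean w f k x"
  unfolding section_code_def by (rule hilbert_curve_code) (rule section_mean[OF assms])+

text \<open>The pulled-back kernels agree, so \<open>q (\<psi> x)\<close> and
  \<open>q' (\<phi> x)\<close> agree almost everywhere. A factorization of the pull-back through
  this common function descends to \<open>w\<close> through \<open>q\<close> and to
  \<open>w'\<close> through \<open>q'\<close>, with the same \<open>u0\<close>. As \<open>q\<close>
  and \<open>q'\<close> have the same law, one quantile function inverts both ranks, and
  \<open>u0\<close> composed with it is the common kernel.\<close>

lemma kernels_common_quotient:
  assumes w: "borel_kernel w" and w': "borel_kernel w'"
    and \<phi>[measurable]: "\<phi> \<in> borel_measurable borel" and d\<phi>: "distr unit_borel borel \<phi> = unit_borel"
    and \<psi>[measurable]: "\<psi> \<in> borel_measurable borel" and d\<psi>: "distr unit_borel borel \<psi> = unit_borel"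
    and eq: "AE z in square_borel. w (\<psi> (fst z)) (\<psi> (snd z)) = w' (\<phi> (fst z)) (\<phi> (snd z))"
  shows "\<exists>u \<alpha> \<beta>. borel_kernel u \<and> \<alpha> \<in> borel_measurable borel \<and> \<beta> \<in> borel_measurable borel \<and>
    distr unit_borel borel \<alpha> = unit_borel \<and> distr unit_borel borel \<beta> = unit_borel \<and>
    (AE z in square_borel. w (fst z) (snd z) = u (\<alpha> (fst z)) (\<alpha> (snd z))) \<and>
    (AE z in square_borel. w' (fst z) (snd z) = u (\<beta> (fst z)) (\<beta> (snd z)))"
proof -
  define q where "q = section_code w \<psi>"
  define q' where "q' = section_code w' \<phi>"
  have [measurable]: "q \<in> borel_measurable borel" "q' \<in> borel_measurable borel"
    unfolding q_def q'_def by (intro section_code_measurable w w' \<phi> \<psi>)+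
  define p where "p x = q (\<psi> x)" for x
  have p[measurable]: "p \<in> borel_measurable borel" unfolding p_def by measurable
  have pq': "AE x in unit_borel. p x = q' (\<phi> x)"
    using unit_borel2.AE_pair[OF eq]
  proof eventually_elim
    case (elim x)
    have "section_mean w \<psi> k (\<psi> x) = section_mean w' \<phi> k (\<phi> x)" for k
      unfolding section_mean_def
    proof (rule integral_cong_AE)
      show "AE y in unit_borel. (w (\<psi> x) (\<psi> y) + 1) / 2 * indicator {..of_rat (from_nat k)} y =
          (w' (\<phi> x) (\<phi> y) + 1) / 2 * indicator {..of_rat (from_nat k)} y"
        using elim by eventually_elim simp
      have [measurable]: "(\<lambda>y. w (\<psi> x) (\<psi> y)) \<in> borel_measurable borel" "(\<lambda>y. w' (\<phi> x) (\<phi> y)) \<in> borel_measurable borel"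
        by (rule borel_kernel_measurable[OF w] borel_kernel_measurable[OF w']; measurable)+
      show "(\<lambda>y. (w (\<psi> x) (\<psi> y) + 1) / 2 * indicator {..of_rat (from_nat k)} y) \<in> borel_measurable unit_borel"
        "(\<lambda>y. (w' (\<phi> x) (\<phi> y) + 1) / 2 * indicator {..of_rat (from_nat k)} y) \<in> borel_measurable unit_borel"
        by measurable
    qed
    then show ?case unfolding p_def q_def q'_def section_code_def by simp
  qed
  define V where "V x y = (w (\<psi> x) (\<psi> y) + 1) / 2" for x y
  have "(\<lambda>z. w (\<psi> (fst z)) (\<psi> (snd z))) \<in> borel_measurable (borel \<Otimes>\<^sub>M borel)"
    by (rule borel_kernel_measurable[OF w]) measurable
  then have Vm: "case_prod V \<in> borel_measurable (borel \<Otimes>\<^sub>M borel)"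
    unfolding V_def case_prod_beta' by measurable
  have V01: "0 \<le> V x y" "V x y \<le> 1" and Vs: "V x y = V y x" for x y
    using borel_kernelD(3)[OF w, of "\<psi> x" "\<psi> y"] borel_kernelD(2)[OF w, of "\<psi> x" "\<psi> y"]
    unfolding V_def by (auto simp: abs_le_iff)
  have "\<exists>G\<in>borel_measurable borel. AE x in unit_borel.
      (\<integral>\<^sup>+y\<in>{..of_rat (from_nat k)}. ennreal (V x y) \<partial>unit_borel) = G (p x)" for k
  proof (rule bexI[of _ "\<lambda>r. ennreal (hilbert_curve k r)"])
    show "AE x in unit_borel. (\<integral>\<^sup>+y\<in>{..of_rat (from_nat k)}. ennreal (V x y) \<partial>unit_borel) = ennreal (hilbert_curve k (p x))"
      unfolding p_def q_def section_code_curve[OF w \<psi>] section_mean(4)[OF w \<psi>] V_def by simp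
  qed measurable
  from kernel_factorization[OF Vm V01 Vs p this]
  obtain u0 where u0: "case_prod u0 \<in> borel_measurable (borel \<Otimes>\<^sub>M borel)"
    "\<And>r s. 0 \<le> u0 r s \<and> u0 r s \<le> 1" "\<And>r s. u0 r s = u0 s r"
    and Vu: "AE z in square_borel. V (fst z) (snd z) = u0 (p (fst z)) (p (snd z))"
    by blast
  have u0m: "(\<lambda>z. u0 (k (fst z)) (k (snd z))) \<in> borel_measurable (borel \<Otimes>\<^sub>M borel)"
    if [measurable]: "k \<in> borel_measurable borel" for k
  proof -
    have "(\<lambda>z. (k (fst z), k (snd z))) \<in> borel \<Otimes>\<^sub>M borel \<rightarrow>\<^sub>M borel \<Otimes>\<^sub>M borel" by measurable
    from measurable_compose[OF this u0(1)] show ?thesis by simp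
  qed
  have meas: "{z. v (fst z) (snd z) = 2 * u0 (k (fst z)) (k (snd z)) - 1} \<in> sets (borel \<Otimes>\<^sub>M borel)"
    if v: "borel_kernel v" and k: "k \<in> borel_measurable borel" for v k
  proof -
    have [measurable]: "(\<lambda>z. v (fst z) (snd z)) \<in> borel_measurable (borel \<Otimes>\<^sub>M borel)"
      by (rule borel_kernel_measurable[OF v]) measurable
    note [measurable] = u0m[OF k]
    have "{z \<in> space (borel \<Otimes>\<^sub>M borel). v (fst z) (snd z) = 2 * u0 (k (fst z)) (k (snd z)) - 1}
        \<in> sets (borel \<Otimes>\<^sub>M borel)" by measurable
    then show ?thesis by (simp add: space_pair_measure)
  qed
  have wq: "AE z in square_borel. w (fst z) (snd z) = 2 * u0 (q (fst z)) (q (snd z)) - 1"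
  proof (subst AE_pair_map_iff[OF \<psi> d\<psi>, symmetric])
    show "AE z in square_borel. w (\<psi> (fst z)) (\<psi> (snd z)) = 2 * u0 (q (\<psi> (fst z))) (q (\<psi> (snd z))) - 1"
      using Vu by eventually_elim (simp add: V_def p_def field_simps)
  qed (rule meas[OF w], measurable)
  have wq': "AE z in square_borel. w' (fst z) (snd z) = 2 * u0 (q' (fst z)) (q' (snd z)) - 1"
  proof (subst AE_pair_map_iff[OF \<phi> d\<phi>, symmetric])
    show "AE z in square_borel. w' (\<phi> (fst z)) (\<phi> (snd z)) = 2 * u0 (q' (\<phi> (fst z))) (q' (\<phi> (snd z))) - 1"
      using Vu eq AE_unit_borel_pair_both[OF pq'] by eventually_elim (simp add: V_def field_simps)
  qed (rule meas[OF w'], measurable)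
  define \<kappa> where "\<kappa> = distr unit_borel borel q"
  have \<kappa>p: "\<kappa> = distr unit_borel borel p"
  proof -
    have "\<kappa> = distr (distr unit_borel borel \<psi>) borel q" unfolding \<kappa>_def d\<psi> ..
    then show ?thesis by (simp add: distr_distr comp_def p_def[abs_def])
  qed
  have \<kappa>q': "\<kappa> = distr unit_borel borel q'"
  proof -
    have "\<kappa> = distr unit_borel borel (\<lambda>x. q' (\<phi> x))"
      unfolding \<kappa>p using pq' by (intro distr_cong_AE) auto
    also have "\<dots> = distr (distr unit_borel borel \<phi>) borel q'"
      by (simp add: distr_distr comp_def)
    finally show ?thesis unfolding d\<phi> .
  qed
  have "real_distribution \<kappa>"
    unfolding \<kappa>_def by (rule unit_borel.real_distribution_distr) measurable
  from ex_quantile_function[OF this] obtain Q where Q[measurable]: "Q \<in> borel_measurable borel"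
    and Qi: "\<And>s x. 0 < s \<Longrightarrow> s < 1 \<Longrightarrow> (s \<le> cdf \<kappa> x \<longleftrightarrow> Q s \<le> x)" by blast
  have r: "distr unit_borel borel (lex_rank q) = unit_borel" "AE x in unit_borel. Q (lex_rank q x) = q x"
    by (rule lex_rank[OF _ \<kappa>_def Qi]; measurable)+
  have r': "distr unit_borel borel (lex_rank q') = unit_borel" "AE x in unit_borel. Q (lex_rank q' x) = q' x"
    by (rule lex_rank[OF _ \<kappa>q' Qi]; measurable)+
  define u where "u s t = 2 * u0 (Q s) (Q t) - 1" for s t
  have "borel_kernel u"
    unfolding borel_kernel_def
  proof (intro conjI allI)
    show "case_prod u \<in> borel_measurable (borel \<Otimes>\<^sub>M borel)"
      unfolding u_def case_prod_beta' using u0m[OF Q] by measurable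
    show "u x y = u y x" for x y unfolding u_def using u0(3) by simp
    show "\<bar>u x y\<bar> \<le> 1" for x y unfolding u_def using u0(2)[of "Q x" "Q y"] by (auto simp: abs_le_iff)
  qed
  moreover have "AE z in square_borel. w (fst z) (snd z) = u (lex_rank q (fst z)) (lex_rank q (snd z))"
    using wq AE_unit_borel_pair_both[OF r(2)] by eventually_elim (simp add: u_def)
  moreover have "AE z in square_borel. w' (fst z) (snd z) = u (lex_rank q' (fst z)) (lex_rank q' (snd z))"
    using wq' AE_unit_borel_pair_both[OF r'(2)] by eventually_elim (simp add: u_def)
  ultimately show ?thesis using r(1) r'(1)
    by (intro exI[of _ u] exI[of _ "lex_rank q"] exI[of _ "lex_rank q'"]) simp
qed

section \<open>Lebesgue kernels\<close>

text \<open>A Borel function equal to \<open>W\<close> almost everywhere may violate symmetry or the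
  bound on a null set; averaging with its transpose and clamping repair this. As \<open>W\<close> is
  constrained on the square only, it is extended by 0 beforehand.\<close>

lemma kernel_borel_version:
  assumes W: "W \<in> kernels" and M: "0 < M" "\<And>x y. x \<in> {0..1} \<Longrightarrow> y \<in> {0..1} \<Longrightarrow> \<bar>W x y\<bar> \<le> M"
  shows "\<exists>w. borel_kernel w \<and> (AE z in square_borel. W (fst z) (snd z) = M * w (fst z) (snd z))"
proof -
  let ?S = "{0..1::real} \<times> {0..1::real}"
  have S: "?S \<in> sets lebesgue" by (intro sets_completionI_sets) (simp add: borel_Times)
  define f where "f z = (if z \<in> ?S then case_prod W z else 0)" for z
  have "case_prod W \<in> borel_measurable square_lebesgue"
    and symW: "\<And>x y. x \<in> {0..1} \<Longrightarrow> y \<in> {0..1} \<Longrightarrow> W x y = W y x"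
    using W unfolding kernels_def by auto
  then have "f \<in> borel_measurable lebesgue"
    unfolding f_def using S by (subst (asm) measurable_restrict_space_iff[where c=0]) auto
  then obtain g where gm: "g \<in> borel_measurable lborel" and fg: "AE z in lborel. f z = g z"
    using completion_ex_borel_measurable_real by blast
  have gm'[measurable]: "g \<in> borel_measurable (borel \<Otimes>\<^sub>M borel)"
    using gm by (simp add: borel_prod)
  have Wg: "AE z in square_borel. z \<in> ?S \<and> W (fst z) (snd z) = g z"
    unfolding AE_unit_borel_pair using fg by eventually_elim (auto simp: f_def)
  have sw: "(\<lambda>(x, y). (y, x)) \<in> square_borel \<rightarrow>\<^sub>M square_borel" by measurable
  have "AE z in square_borel. (\<lambda>(x, y). (y, x)) z \<in> ?S \<and>
      W (fst ((\<lambda>(x, y). (y, x)) z)) (snd ((\<lambda>(x, y). (y, x)) z)) = g ((\<lambda>(x, y). (y, x)) z)"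
    by (rule AE_distrD[OF sw]) (use Wg in \<open>simp only: unit_borel2.distr_pair_swap[symmetric]\<close>)
  then have Wg': "AE z in square_borel. W (snd z) (fst z) = g (snd z, fst z)"
    by eventually_elim (simp add: case_prod_beta)
  define w where "w x y = max (-1) (min 1 ((g (x, y) + g (y, x)) / (2 * M)))" for x y
  have "borel_kernel w"
    unfolding borel_kernel_def
  proof (intro conjI allI)
    show "case_prod w \<in> borel_measurable (borel \<Otimes>\<^sub>M borel)"
      unfolding w_def by measurable
  qed (auto simp: w_def add.commute abs_le_iff)
  moreover have "AE z in square_borel. W (fst z) (snd z) = M * w (fst z) (snd z)"
    using Wg Wg'
  proof eventually_elim
    case (elim z)
    then have z: "fst z \<in> {0..1}" "snd z \<in> {0..1}" by auto
    have "(g (fst z, snd z) + g (snd z, fst z)) / (2 * M) = W (fst z) (snd z) / M"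
      using elim symW[OF z] by simp
    moreover have "- 1 \<le> W (fst z) (snd z) / M" "W (fst z) (snd z) / M \<le> 1"
      using M(2)[OF z] M(1) by (auto simp: field_simps abs_le_iff)
    ultimately have "w (fst z) (snd z) = W (fst z) (snd z) / M"
      unfolding w_def by (simp only: min_absorb2 max_absorb2)
    then show ?case using M(1) by simp
  qed
  ultimately show ?thesis by blast
qed

section \<open>Measure preserving maps for Borel and for Lebesgue sets\<close>

lemma measure_preserving_borel_version:
  assumes \<phi>: "measure_preserving \<phi>"
  shows "\<exists>\<phi>0. \<phi>0 \<in> borel_measurable borel \<and> distr unit_borel borel \<phi>0 = unit_borel \<and>
    (AE x in unit_borel. \<phi> x = \<phi>0 x)"
proof -
  have \<phi>m: "\<phi> \<in> unit_lebesgue \<rightarrow>\<^sub>M unit_lebesgue" and d: "distr unit_lebesgue unit_lebesgue \<phi> = unit_lebesgue"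
    using \<phi> unfolding measure_preserving_def by auto
  have \<phi>b[measurable]: "\<phi> \<in> borel_measurable unit_lebesgue"
    using measurable_compose[OF \<phi>m measurable_unit_lebesgue_id] by simp
  have "(\<lambda>x. if x \<in> {0..1} then \<phi> x else 0) \<in> borel_measurable lebesgue"
    using \<phi>b by (subst (asm) measurable_restrict_space_iff[where c=0]) auto
  then obtain \<phi>0 where \<phi>0: "\<phi>0 \<in> borel_measurable lborel"
    and AE0: "AE x in lborel. (if x \<in> {0..1} then \<phi> x else 0) = \<phi>0 x"
    using completion_ex_borel_measurable_real by blast
  have \<phi>0m[measurable]: "\<phi>0 \<in> borel_measurable borel" using \<phi>0 by simp
  have AE: "AE x in unit_borel. \<phi> x = \<phi>0 x"
    unfolding AE_unit_borel using AE0 by eventually_elim auto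
  note id = measurable_unit_lebesgue_id
  have \<phi>0u: "\<phi>0 \<in> borel_measurable unit_lebesgue"
    using measurable_compose[OF id \<phi>0m] by simp
  have "distr unit_borel borel \<phi>0 = distr (distr unit_lebesgue borel (\<lambda>x. x)) borel \<phi>0"
    by (simp only: distr_unit_lebesgue_id)
  also have "\<dots> = distr unit_lebesgue borel \<phi>0"
    by (subst distr_distr[OF \<phi>0m id]) (simp add: comp_def)
  also have "\<dots> = distr unit_lebesgue borel \<phi>"
    using AE \<phi>0u by (intro distr_cong_AE) (auto simp: AE_unit_lebesgue elim: eventually_mono)
  also have "\<dots> = distr (distr unit_lebesgue unit_lebesgue \<phi>) borel (\<lambda>x. x)"
    by (subst distr_distr[OF id \<phi>m]) (simp add: comp_def)
  also have "\<dots> = unit_borel" unfolding d by (rule distr_unit_lebesgue_id)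
  finally show ?thesis using AE \<phi>0m by blast
qed

text \<open>A Borel map that preserves the uniform law pulls null sets back to null sets, hence
  Lebesgue sets back to Lebesgue sets of the same measure.\<close>

lemma measure_preserving_of_borel:
  assumes [measurable]: "\<phi>0 \<in> borel_measurable borel" and d0: "distr unit_borel borel \<phi>0 = unit_borel"
  shows "\<exists>\<phi>. measure_preserving \<phi> \<and> (AE x in unit_borel. \<phi> x = \<phi>0 x)"
proof -
  \<comment> \<open>Values outside the unit interval occur on a null set and are sent to 0, since a
    map into \<open>unit_lebesgue\<close> has to stay in its space.\<close>
  define \<phi> where "\<phi> x = (if \<phi>0 x \<in> {0..1} then \<phi>0 x else 0)" for x
  have \<phi>m[measurable]: "\<phi> \<in> borel_measurable borel" unfolding \<phi>_def by measurable
  have "AE x in unit_borel. \<phi>0 x \<in> {0..1}"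
  proof (rule AE_distrD[of \<phi>0 unit_borel borel "\<lambda>y. y \<in> {0..1}"])
    show "AE y in distr unit_borel borel \<phi>0. y \<in> {0..1}"
      unfolding d0 by (rule AE_unit_borel_Icc)
  qed measurable
  then have AE: "AE x in unit_borel. \<phi> x = \<phi>0 x"
    by eventually_elim (simp add: \<phi>_def)
  have d: "distr unit_borel borel \<phi> = unit_borel"
  proof -
    have "distr unit_borel borel \<phi> = distr unit_borel borel \<phi>0"
      using AE by (intro distr_cong_AE) auto
    then show ?thesis using d0 by simp
  qed
  have rng: "\<phi> x \<in> {0..1}" for x unfolding \<phi>_def by auto
  have em: "emeasure lborel ({0..1} \<inter> \<phi> -` B) = emeasure lborel ({0..1} \<inter> B)" if B[measurable]: "B \<in> sets borel" for B
  proof -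
    have "\<phi> -` B \<in> sets borel" using measurable_sets[OF \<phi>m B] by simp
    then have "emeasure lborel ({0..1} \<inter> \<phi> -` B) = emeasure (distr unit_borel borel \<phi>) B"
      by (subst emeasure_distr) (auto simp: emeasure_unit_borel)
    then show ?thesis unfolding d by (simp add: emeasure_unit_borel)
  qed
  have pre: "{0..1} \<inter> \<phi> -` A \<in> sets lebesgue \<and>
      emeasure lebesgue ({0..1} \<inter> \<phi> -` A) = emeasure lebesgue A"
    if A: "A \<in> sets lebesgue" "A \<subseteq> {0..1}" for A
  proof -
    obtain S N N' where SN: "A = S \<union> N" "N \<subseteq> N'" "N' \<in> null_sets lborel" "S \<in> sets lborel"
      using A(1) by (rule sets_completionE)
    have S[measurable]: "S \<in> sets borel" and N'[measurable]: "N' \<in> sets borel"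
      using SN by (auto dest: null_setsD2)
    have S': "\<phi> -` S \<in> sets borel" "\<phi> -` N' \<in> sets borel"
      using measurable_sets[OF \<phi>m S] measurable_sets[OF \<phi>m N'] by simp_all
    have "emeasure lborel ({0..1} \<inter> \<phi> -` N') \<le> emeasure lborel N'"
      unfolding em[OF N'] by (intro emeasure_mono) auto
    then have null: "{0..1} \<inter> \<phi> -` N' \<in> null_sets lborel"
      using S' SN(3) by (auto simp: null_sets_def)
    have eq: "{0..1} \<inter> \<phi> -` A = ({0..1} \<inter> \<phi> -` S) \<union> ({0..1} \<inter> \<phi> -` N)"
      using SN(1) by auto
    have s1: "{0..1} \<inter> \<phi> -` A \<in> sets lebesgue"
      by (rule sets_completionI[OF eq _ null]) (use SN(2) S' in auto)
    have ae1: "AE x in lebesgue. x \<in> {0..1} \<inter> \<phi> -` A \<longleftrightarrow> x \<in> {0..1} \<inter> \<phi> -` S"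
      using AE_completion[OF AE_not_in[OF null]] by eventually_elim (use SN(1,2) in auto)
    have ae2: "AE x in lebesgue. x \<in> A \<longleftrightarrow> x \<in> {0..1} \<inter> S"
      using AE_completion[OF AE_not_in[OF SN(3)]] by eventually_elim (use SN(1,2) A(2) in auto)
    have "emeasure lebesgue ({0..1} \<inter> \<phi> -` A) = emeasure lebesgue ({0..1} \<inter> \<phi> -` S)"
      using s1 S' by (intro emeasure_eq_AE ae1) auto
    also have "\<dots> = emeasure lborel ({0..1} \<inter> \<phi> -` S)"
      by simp
    also have "\<dots> = emeasure lborel ({0..1} \<inter> S)" by (rule em[OF S])
    also have "\<dots> = emeasure lebesgue ({0..1} \<inter> S)" by simp
    also have "\<dots> = emeasure lebesgue A"
      using A by (intro emeasure_eq_AE[OF ae2, symmetric]) auto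
    finally show ?thesis using s1 by simp
  qed
  have \<phi>u: "\<phi> \<in> unit_lebesgue \<rightarrow>\<^sub>M unit_lebesgue"
  proof (rule measurableI)
    show "\<phi> x \<in> space unit_lebesgue" for x using rng by (simp add: space_restrict_space)
    fix A assume "A \<in> sets unit_lebesgue"
    then have "A \<in> sets lebesgue" "A \<subseteq> {0..1}" by (auto simp: sets_restrict_space_iff)
    from pre[OF this] show "\<phi> -` A \<inter> space unit_lebesgue \<in> sets unit_lebesgue"
      by (auto simp: sets_restrict_space_iff space_restrict_space Int_commute)
  qed
  have "distr unit_lebesgue unit_lebesgue \<phi> = unit_lebesgue"
  proof (rule measure_eqI)
    fix A assume "A \<in> sets (distr unit_lebesgue unit_lebesgue \<phi>)"
    then have Au: "A \<in> sets unit_lebesgue" by simp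
    then have A: "A \<in> sets lebesgue" "A \<subseteq> {0..1}" by (auto simp: sets_restrict_space_iff)
    have "emeasure (distr unit_lebesgue unit_lebesgue \<phi>) A = emeasure unit_lebesgue ({0..1} \<inter> \<phi> -` A)"
      using Au by (subst emeasure_distr[OF \<phi>u]) (auto simp: space_restrict_space Int_commute)
    also have "\<dots> = emeasure lebesgue ({0..1} \<inter> \<phi> -` A)"
      by (subst emeasure_restrict_space) auto
    also have "\<dots> = emeasure unit_lebesgue A"
      using pre[OF A] A by (subst emeasure_restrict_space) auto
    finally show "emeasure (distr unit_lebesgue unit_lebesgue \<phi>) A = emeasure unit_lebesgue A" .
  qed simp
  then show ?thesis using \<phi>u AE unfolding measure_preserving_def by blast
qed

section \<open>Densities computed from Borel versions\<close>

lemma borel_measurable_completion_AE: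
  fixes f g :: "'a \<Rightarrow> real"
  assumes g: "g \<in> borel_measurable M" and AE: "AE x in M. f x = g x"
  shows "f \<in> borel_measurable (completion M)"
proof (rule measurableI)
  fix A :: "real set" assume A: "A \<in> sets borel"
  obtain N where N: "N \<in> null_sets M" "{x \<in> space M. f x \<noteq> g x} \<subseteq> N"
    using AE unfolding eventually_ae_filter by auto
  have "f -` A \<inter> space (completion M) = ((g -` A \<inter> space M) - N) \<union> (f -` A \<inter> space M \<inter> N)"
    using N(2) by auto
  moreover have "(g -` A \<inter> space M) - N \<in> sets M"
    using measurable_sets[OF g A] N(1) by auto
  ultimately show "f -` A \<inter> space (completion M) \<in> sets (completion M)"
    using N(1) by (intro sets_completionI[of _ "(g -` A \<inter> space M) - N" "f -` A \<inter> space M \<inter> N" N]) auto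
qed simp

lemma prod_mset_measurable:
  assumes "\<And>e. e \<in># E \<Longrightarrow> f e \<in> borel_measurable M"
  shows "(\<lambda>x. \<Prod>e\<in>#E. f e x :: real) \<in> borel_measurable M"
  using assms by (induction E) auto

lemma edge_product_measurable:
  assumes v: "(\<lambda>z. v (fst z) (snd z)) \<in> borel_measurable (N \<Otimes>\<^sub>M N)" and E: "multigraph k E"
  shows "(\<lambda>x. \<Prod>e\<in>#E. v (x (Min e)) (x (Max e)) :: real) \<in> borel_measurable (\<Pi>\<^sub>M i\<in>{1..k}. N)"
proof (rule prod_mset_measurable)
  fix e assume "e \<in># E"
  then have e: "Min e \<in> {1..k}" "Max e \<in> {1..k}"
    using E two_set_Min_Max[of e] unfolding multigraph_def by blast+
  have "(\<lambda>x. (x (Min e), x (Max e))) \<in> (\<Pi>\<^sub>M i\<in>{1..k}. N) \<rightarrow>\<^sub>M N \<Otimes>\<^sub>M N"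
    using e by measurable
  from measurable_compose[OF this v]
  show "(\<lambda>x. v (x (Min e)) (x (Max e))) \<in> borel_measurable (\<Pi>\<^sub>M i\<in>{1..k}. N)" by simp
qed

text \<open>An edge joins two distinct vertices, so its points are distributed as two independent
  points and inherit the identity. At a loop they would meet the diagonal, about which the
  hypothesis says nothing.\<close>

lemma AE_edge_product:
  assumes N: "prob_space N" and AE: "AE z in N \<Otimes>\<^sub>M N. v (fst z) (snd z) = v' (fst z) (snd z)"
    and E: "multigraph k E"
  shows "AE x in \<Pi>\<^sub>M i\<in>{1..k}. N.
    (\<Prod>e\<in>#E. v (x (Min e)) (x (Max e)) :: real) = (\<Prod>e\<in>#E. v' (x (Min e)) (x (Max e)))"
proof -
  have "AE x in \<Pi>\<^sub>M i\<in>{1..k}. N. \<forall>e\<in>set_mset E. v (x (Min e)) (x (Max e)) = v' (x (Min e)) (x (Max e))"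
  proof (intro AE_finite_allI)
    fix e assume "e \<in># E"
    then have "e \<subseteq> {1..k}" "card e = 2" using E unfolding multigraph_def by auto
    then have e: "Min e \<in> {1..k}" "Max e \<in> {1..k}" "Min e \<noteq> Max e"
      using two_set_Min_Max[of e] by auto
    show "AE x in \<Pi>\<^sub>M i\<in>{1..k}. N. v (x (Min e)) (x (Max e)) = v' (x (Min e)) (x (Max e))"
      using AE_PiM_pair[OF N e AE] by simp
  qed simp
  then show ?thesis
    by eventually_elim (auto intro!: arg_cong[where f=prod_mset] image_mset_cong)
qed

text \<open>Invariance under any map with uniform law: it covers the passage to Lebesgue sets,
  pull-backs of kernels and the two projections of a coupling.\<close>

lemma integral_edge_product_map:
  assumes N: "prob_space N" and f: "f \<in> N \<rightarrow>\<^sub>M borel" "distr N borel f = unit_borel"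
    and v: "(\<lambda>z. v (fst z) (snd z)) \<in> borel_measurable (borel \<Otimes>\<^sub>M borel)" and E: "multigraph k E"
  shows "(\<integral>x. (\<Prod>e\<in>#E. v (f (x (Min e))) (f (x (Max e))) :: real) \<partial>(\<Pi>\<^sub>M i\<in>{1..k}. N))
    = (\<integral>x. (\<Prod>e\<in>#E. v (x (Min e)) (x (Max e))) \<partial>cube_borel k)"
proof -
  have fu: "f \<in> N \<rightarrow>\<^sub>M unit_borel" using f(1) by (simp cong: measurable_cong_sets)
  have "distr N unit_borel f = unit_borel"
    using f(2) by (metis distr_cong sets_unit_borel)
  then have d: "distr (\<Pi>\<^sub>M i\<in>{1..k}. N) (cube_borel k) (compose {1..k} f) = cube_borel k"
    using distr_PiM_finite_prob_space'[of "{1..k}" "\<lambda>_. N" "\<lambda>_. unit_borel" f] N prob_unit_borel fu by simp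
  have "compose {1..k} f \<in> (\<Pi>\<^sub>M i\<in>{1..k}. N) \<rightarrow>\<^sub>M cube_borel k"
    unfolding compose_def using fu by measurable
  then have "(\<integral>x. (\<Prod>e\<in>#E. v (x (Min e)) (x (Max e))) \<partial>distr (\<Pi>\<^sub>M i\<in>{1..k}. N) (cube_borel k) (compose {1..k} f))
      = (\<integral>x. (\<Prod>e\<in>#E. v (compose {1..k} f x (Min e)) (compose {1..k} f x (Max e))) \<partial>(\<Pi>\<^sub>M i\<in>{1..k}. N))"
    using v E by (intro integral_distr edge_product_measurable)
      (auto simp: measurable_cong_sets[OF sets_pair_measure_cong[OF sets_unit_borel sets_unit_borel] refl])
  also have "\<dots> = (\<integral>x. (\<Prod>e\<in>#E. v (f (x (Min e))) (f (x (Max e)))) \<partial>(\<Pi>\<^sub>M i\<in>{1..k}. N))"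
  proof (intro Bochner_Integration.integral_cong refl arg_cong[where f=prod_mset] image_mset_cong)
    fix x e assume "e \<in># E"
    then have "Min e \<in> {1..k}" "Max e \<in> {1..k}"
      using E two_set_Min_Max[of e] unfolding multigraph_def by blast+
    then show "v (compose {1..k} f x (Min e)) (compose {1..k} f x (Max e)) = v (f (x (Min e))) (f (x (Max e)))"
      by (simp add: compose_def)
  qed
  finally show ?thesis unfolding d by simp
qed

text \<open>The integrand equals a Borel expression outside a null set of the product. It is
  therefore measurable for the completion, and the integral over the completion reduces to that of
  the Borel version.\<close>

lemma hom_density_borel_version:
  assumes v: "(\<lambda>z. v (fst z) (snd z)) \<in> borel_measurable (borel \<Otimes>\<^sub>M borel)"
    and AE: "AE z in square_borel. W (fst z) (snd z) = v (fst z) (snd z)"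
    and E: "multigraph k E"
  shows "hom_density k E W = (\<integral>x. (\<Prod>e\<in>#E. v (x (Min e)) (x (Max e))) \<partial>cube_borel k)"
proof -
  let ?C = "\<Pi>\<^sub>M i\<in>{1..k}. unit_lebesgue"
  note id = measurable_unit_lebesgue_id
  have "(\<lambda>z. (fst z, snd z)) \<in> unit_lebesgue \<Otimes>\<^sub>M unit_lebesgue \<rightarrow>\<^sub>M borel \<Otimes>\<^sub>M borel"
    using measurable_compose[OF measurable_fst id] measurable_compose[OF measurable_snd id]
    by (intro measurable_Pair) auto
  from measurable_compose[OF this v] have
    "(\<lambda>z. v (fst z) (snd z)) \<in> borel_measurable (unit_lebesgue \<Otimes>\<^sub>M unit_lebesgue)" by simp
  from edge_product_measurable[OF this E]
  have vm: "(\<lambda>x. \<Prod>e\<in>#E. v (x (Min e)) (x (Max e))) \<in> borel_measurable ?C" .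
  have "AE z in unit_lebesgue \<Otimes>\<^sub>M unit_lebesgue. W (fst z) (snd z) = v (fst z) (snd z)"
    by (rule AE_pair_map[OF id distr_unit_lebesgue_id prob_unit_lebesgue sets_unit_borel AE])
  from AE_edge_product[OF prob_unit_lebesgue this E]
  have ae: "AE x in ?C. (\<Prod>e\<in>#E. W (x (Min e)) (x (Max e))) = (\<Prod>e\<in>#E. v (x (Min e)) (x (Max e)))" .
  have "hom_density k E W = (\<integral>x. (\<Prod>e\<in>#E. v (x (Min e)) (x (Max e))) \<partial>completion ?C)"
    unfolding hom_density_def
    by (rule integral_cong_AE[OF borel_measurable_completion_AE[OF vm ae] measurable_completion[OF vm] AE_completion[OF ae]])
  also have "\<dots> = (\<integral>x. (\<Prod>e\<in>#E. v (x (Min e)) (x (Max e))) \<partial>?C)"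
    by (rule integral_completion[OF vm])
  also have "\<dots> = (\<integral>x. (\<Prod>e\<in>#E. v (x (Min e)) (x (Max e))) \<partial>cube_borel k)"
    by (rule integral_edge_product_map[OF prob_unit_lebesgue id distr_unit_lebesgue_id v E])
  finally show ?thesis .
qed

lemma kernel_bound:
  assumes "W \<in> kernels"
  shows "\<exists>M. \<forall>x\<in>{0..1}. \<forall>y\<in>{0..1}. \<bar>W x y\<bar> \<le> M"
proof -
  obtain M where "\<forall>r\<in>case_prod W ` ({0..1} \<times> {0..1}). \<bar>r\<bar> \<le> M"
    using assms unfolding kernels_def bounded_iff by auto
  then show ?thesis by force
qed

lemma scaled_borel_kernel_measurable:
  assumes "borel_kernel w" and [measurable]: "f \<in> borel_measurable N"
  shows "(\<lambda>z. M * w (f (fst z)) (f (snd z))) \<in> borel_measurable (N \<Otimes>\<^sub>M N)"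
proof -
  have [measurable]: "(\<lambda>z. w (f (fst z)) (f (snd z))) \<in> borel_measurable (N \<Otimes>\<^sub>M N)"
    by (rule borel_kernel_measurable[OF assms(1)]) measurable
  show ?thesis by measurable
qed

lemma prod_mset_scale: "(\<Prod>e\<in>#E. M * f e :: real) = M ^ size E * (\<Prod>e\<in>#E. f e)"
  by (induction E) auto

text \<open>Joins invariance under pull-back with scaling, which contributes \<open>M\<close> once
  per edge counted with multiplicity.\<close>

lemma hom_density_scaled:
  assumes w: "borel_kernel w" and f: "f \<in> borel_measurable borel" "distr unit_borel borel f = unit_borel"
    and AE: "AE z in square_borel. W (fst z) (snd z) = M * w (f (fst z)) (f (snd z))"
    and E: "multigraph k E"
  shows "hom_density k E W = M ^ size E * borel_hom_density k E w"
proof -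
  have fu: "f \<in> unit_borel \<rightarrow>\<^sub>M borel" using f(1) by (simp cong: measurable_cong_sets)
  have "hom_density k E W = (\<integral>x. (\<Prod>e\<in>#E. M * w (f (x (Min e))) (f (x (Max e)))) \<partial>cube_borel k)"
    by (rule hom_density_borel_version[OF _ AE E]) (rule scaled_borel_kernel_measurable[OF w f(1)])
  also have "\<dots> = (\<integral>x. (\<Prod>e\<in>#E. M * w (x (Min e)) (x (Max e))) \<partial>cube_borel k)"
    by (rule integral_edge_product_map[OF prob_unit_borel fu f(2) _ E, of "\<lambda>x y. M * w x y"])
      (use scaled_borel_kernel_measurable[OF w, of "\<lambda>x. x" borel M] in simp)
  finally show ?thesis
    by (simp add: prod_mset_scale borel_hom_density_def edge_value_def)
qed

section \<open>Marginals of couplings and the equivalences\<close>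

lemma marginal_to_borel:
  assumes "k \<in> N \<rightarrow>\<^sub>M unit_lebesgue" "distr N unit_lebesgue k = unit_lebesgue"
  shows "k \<in> borel_measurable N" "distr N borel k = unit_borel"
proof -
  show "k \<in> borel_measurable N"
    using measurable_compose[OF assms(1) measurable_unit_lebesgue_id] by simp
  have "distr N borel k = distr (distr N unit_lebesgue k) borel (\<lambda>x. x)"
    by (subst distr_distr[OF measurable_unit_lebesgue_id assms(1)]) (simp add: comp_def)
  then show "distr N borel k = unit_borel"
    unfolding assms(2) by (simp only: distr_unit_lebesgue_id)
qed

lemma AE_pair_marginal:
  assumes N: "prob_space N" and k: "k \<in> N \<rightarrow>\<^sub>M unit_lebesgue" "distr N unit_lebesgue k = unit_lebesgue"
    and AE: "AE z in square_borel. P (fst z) (snd z)"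
  shows "AE z in N \<Otimes>\<^sub>M N. P (k (fst z)) (k (snd z))"
  by (rule AE_pair_map[OF marginal_to_borel[OF k] N sets_unit_borel AE])

lemma AE_coupling_iff:
  "(AE ((x, x'), (y, y')) in \<gamma> \<Otimes>\<^sub>M \<gamma>. W x y = W' x' y') \<longleftrightarrow>
   (AE z in \<gamma> \<Otimes>\<^sub>M \<gamma>. W (fst (fst z)) (fst (snd z)) = W' (snd (fst z)) (snd (snd z)))"
  by (simp add: case_prod_beta)

text \<open>The implications form two cycles: (b) gives (a), (a) gives (d), (d) gives both (c) and
  (e), and each of these gives (b) back.\<close>

theorem corollary2p2:
  fixes W W' :: "real \<Rightarrow> real \<Rightarrow> real"
  assumes "W \<in> kernels" and "W' \<in> kernels"
  shows "let
      a = (\<forall>k E. simple_graph k E \<longrightarrow> hom_density k E W' = hom_density k E W);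
      b = (\<forall>k E. multigraph k E \<longrightarrow> hom_density k E W' = hom_density k E W);
      c = (\<exists>U \<phi> \<psi>. U \<in> kernels \<and> measure_preserving \<phi> \<and> measure_preserving \<psi>
             \<and> ae_equal W (pullback U \<phi>) \<and> ae_equal W' (pullback U \<psi>));
      d = (\<exists>\<phi> \<psi>. measure_preserving \<phi> \<and> measure_preserving \<psi>
             \<and> ae_equal (pullback W' \<phi>) (pullback W \<psi>));
      e = (\<exists>\<gamma>. lebesgue_coupling \<gamma>
             \<and> (AE ((x, x'), (y, y')) in \<gamma> \<Otimes>\<^sub>M \<gamma>. W x y = W' x' y'))
    in (a \<longleftrightarrow> b) \<and> (b \<longleftrightarrow> c) \<and> (c \<longleftrightarrow> d) \<and> (d \<longleftrightarrow> e)"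
proof -
  let ?B = "square_borel" and ?L = "unit_lebesgue \<Otimes>\<^sub>M unit_lebesgue"
  obtain M1 M2 where "\<forall>x\<in>{0..1}. \<forall>y\<in>{0..1}. \<bar>W x y\<bar> \<le> M1" "\<forall>x\<in>{0..1}. \<forall>y\<in>{0..1}. \<bar>W' x y\<bar> \<le> M2"
    using kernel_bound assms by metis
  then have bd: "\<And>x y. x \<in> {0..1} \<Longrightarrow> y \<in> {0..1} \<Longrightarrow> \<bar>W x y\<bar> \<le> max 1 (max M1 M2)"
      "\<And>x y. x \<in> {0..1} \<Longrightarrow> y \<in> {0..1} \<Longrightarrow> \<bar>W' x y\<bar> \<le> max 1 (max M1 M2)"
    by (meson max.coboundedI1 max.coboundedI2)+
  \<comment> \<open>One bound serves both kernels, so that the factor \<open>M ^ size E\<close>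
    cancels when densities are compared; the 1 keeps it positive.\<close>
  define M where "M = max 1 (max M1 M2)"
  have M: "0 < M" unfolding M_def by simp
  obtain w where w: "borel_kernel w" and Ww: "AE z in ?B. W (fst z) (snd z) = M * w (fst z) (snd z)"
    using kernel_borel_version[OF assms(1) M] bd unfolding M_def by blast
  obtain w' where w': "borel_kernel w'" and Ww': "AE z in ?B. W' (fst z) (snd z) = M * w' (fst z) (snd z)"
    using kernel_borel_version[OF assms(2) M] bd unfolding M_def by blast
  have id_borel: "(\<lambda>x. x) \<in> borel_measurable borel" "distr unit_borel borel (\<lambda>x. x) = unit_borel"
    by (simp, rule measure_eqI) (auto simp: emeasure_distr)
  have t: "hom_density k E W = M ^ size E * borel_hom_density k E w"
    "hom_density k E W' = M ^ size E * borel_hom_density k E w'" if "multigraph k E" for k E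
    by (rule hom_density_scaled[OF w id_borel Ww that] hom_density_scaled[OF w' id_borel Ww' that])+
  have aeq: "ae_equal X Y \<longleftrightarrow> (AE z in ?B. X (fst z) (snd z) = Y (fst z) (snd z))" for X Y
    unfolding ae_equal_def AE_square_lebesgue by (simp add: case_prod_beta)
  have pull: "AE z in ?B. X (f (fst z)) (f (snd z)) = M * x (f (fst z)) (f (snd z))"
    if "AE z in ?B. X (fst z) (snd z) = M * x (fst z) (snd z)"
      "f \<in> borel_measurable borel" "distr unit_borel borel f = unit_borel" for X x f and M :: real
    using that by (intro AE_pair_map[OF _ that(3) prob_unit_borel, where P="\<lambda>r s. X r s = M * x r s"])
      (auto cong: measurable_cong_sets)
  define a where "a = (\<forall>k E. simple_graph k E \<longrightarrow> hom_density k E W' = hom_density k E W)"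
  define b where "b = (\<forall>k E. multigraph k E \<longrightarrow> hom_density k E W' = hom_density k E W)"
  define c where "c = (\<exists>U \<phi> \<psi>. U \<in> kernels \<and> measure_preserving \<phi> \<and> measure_preserving \<psi>
             \<and> ae_equal W (pullback U \<phi>) \<and> ae_equal W' (pullback U \<psi>))"
  define d where "d = (\<exists>\<phi> \<psi>. measure_preserving \<phi> \<and> measure_preserving \<psi>
             \<and> ae_equal (pullback W' \<phi>) (pullback W \<psi>))"
  define e where "e = (\<exists>\<gamma>. lebesgue_coupling \<gamma>
             \<and> (AE ((x, x'), (y, y')) in \<gamma> \<Otimes>\<^sub>M \<gamma>. W x y = W' x' y'))"
  have "a" if "b"
    using that unfolding a_def b_def simple_graph_def by blast
  moreover have "d" if "a"
  proof -
    have "borel_hom_density k E w = borel_hom_density k E w'" if "simple_graph k E" for k E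
    proof -
      have "multigraph k E" using that by (simp add: simple_graph_def)
      with t[OF this] \<open>a\<close> that M show ?thesis unfolding a_def by auto
    qed
    from kernels_realign[OF w w' this]
    obtain \<phi>0 \<psi>0 where 0: "\<phi>0 \<in> borel_measurable borel" "distr unit_borel borel \<phi>0 = unit_borel"
        "\<psi>0 \<in> borel_measurable borel" "distr unit_borel borel \<psi>0 = unit_borel"
      and eq: "AE z in ?B. w (\<psi>0 (fst z)) (\<psi>0 (snd z)) = w' (\<phi>0 (fst z)) (\<phi>0 (snd z))"
      by blast
    obtain \<phi> where \<phi>: "measure_preserving \<phi>" "AE x in unit_borel. \<phi> x = \<phi>0 x"
      using measure_preserving_of_borel[OF 0(1,2)] by blast
    obtain \<psi> where \<psi>: "measure_preserving \<psi>" "AE x in unit_borel. \<psi> x = \<psi>0 x"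
      using measure_preserving_of_borel[OF 0(3,4)] by blast
    have "AE z in ?B. W' (\<phi> (fst z)) (\<phi> (snd z)) = W (\<psi> (fst z)) (\<psi> (snd z))"
      using eq AE_unit_borel_pair_both[OF \<phi>(2)] AE_unit_borel_pair_both[OF \<psi>(2)]
        pull[OF Ww' 0(1,2)] pull[OF Ww 0(3,4)]
      by eventually_elim simp
    then show ?thesis
      unfolding d_def aeq pullback_def using \<phi>(1) \<psi>(1) by (intro exI[of _ \<phi>] exI[of _ \<psi>] conjI)
  qed
  moreover have "c \<and> e" if "d"
  proof -
    obtain \<phi> \<psi> where *: "measure_preserving \<phi> \<and> measure_preserving \<psi> \<and>
        (AE z in ?B. W' (\<phi> (fst z)) (\<phi> (snd z)) = W (\<psi> (fst z)) (\<psi> (snd z)))"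
      using \<open>d\<close> unfolding d_def aeq pullback_def by (elim exE)
    note \<phi> = *[THEN conjunct1] and \<psi> = *[THEN conjunct2, THEN conjunct1] and dd = *[THEN conjunct2, THEN conjunct2]
    obtain \<phi>0 where \<phi>0: "\<phi>0 \<in> borel_measurable borel" "distr unit_borel borel \<phi>0 = unit_borel"
        "AE x in unit_borel. \<phi> x = \<phi>0 x" using measure_preserving_borel_version[OF \<phi>] by blast
    obtain \<psi>0 where \<psi>0: "\<psi>0 \<in> borel_measurable borel" "distr unit_borel borel \<psi>0 = unit_borel"
        "AE x in unit_borel. \<psi> x = \<psi>0 x" using measure_preserving_borel_version[OF \<psi>] by blast
    have eq: "AE z in ?B. w (\<psi>0 (fst z)) (\<psi>0 (snd z)) = w' (\<phi>0 (fst z)) (\<phi>0 (snd z))"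
      using dd AE_unit_borel_pair_both[OF \<phi>0(3)] AE_unit_borel_pair_both[OF \<psi>0(3)]
        pull[OF Ww' \<phi>0(1,2)] pull[OF Ww \<psi>0(1,2)]
      by eventually_elim (use M in simp)
    have "c"
    proof -
      from kernels_common_quotient[OF w w' \<phi>0(1,2) \<psi>0(1,2) eq]
      obtain u \<alpha>0 \<beta>0 where u: "borel_kernel u"
        and \<alpha>0: "\<alpha>0 \<in> borel_measurable borel" "distr unit_borel borel \<alpha>0 = unit_borel"
        and \<beta>0: "\<beta>0 \<in> borel_measurable borel" "distr unit_borel borel \<beta>0 = unit_borel"
        and wu: "AE z in ?B. w (fst z) (snd z) = u (\<alpha>0 (fst z)) (\<alpha>0 (snd z))"
        and wu': "AE z in ?B. w' (fst z) (snd z) = u (\<beta>0 (fst z)) (\<beta>0 (snd z))"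
        by blast
      obtain \<alpha> where \<alpha>: "measure_preserving \<alpha>" "AE x in unit_borel. \<alpha> x = \<alpha>0 x"
        using measure_preserving_of_borel[OF \<alpha>0] by blast
      obtain \<beta> where \<beta>: "measure_preserving \<beta>" "AE x in unit_borel. \<beta> x = \<beta>0 x"
        using measure_preserving_of_borel[OF \<beta>0] by blast
      define U where "U x y = M * u x y" for x y
      have "U \<in> kernels"
        unfolding kernels_def
      proof (intro CollectI conjI ballI)
        show "bounded (case_prod U ` ({0..1} \<times> {0..1}))"
          unfolding bounded_iff
          using borel_kernelD(3)[OF u] M by (intro exI[of _ M]) (auto simp: U_def abs_mult)
        show "U x y = U y x" for x y unfolding U_def using borel_kernelD(2)[OF u] by simp
        have "case_prod U \<in> borel_measurable borel"
          unfolding U_def case_prod_beta'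
          using scaled_borel_kernel_measurable[OF u, of "\<lambda>x. x" borel M] by (simp add: borel_prod)
        then show "case_prod U \<in> borel_measurable square_lebesgue"
          by (intro measurable_restrict_space1 measurable_completion) simp
      qed
      moreover have "ae_equal W (pullback U \<alpha>)"
        unfolding aeq pullback_def U_def
        using Ww wu AE_unit_borel_pair_both[OF \<alpha>(2)] by eventually_elim simp
      moreover have "ae_equal W' (pullback U \<beta>)"
        unfolding aeq pullback_def U_def
        using Ww' wu' AE_unit_borel_pair_both[OF \<beta>(2)] by eventually_elim simp
      ultimately show ?thesis unfolding c_def using \<alpha>(1) \<beta>(1) by blast
    qed
    moreover have "e"
    proof -
      have \<phi>m[measurable]: "\<phi> \<in> unit_lebesgue \<rightarrow>\<^sub>M unit_lebesgue" and d\<phi>: "distr unit_lebesgue unit_lebesgue \<phi> = unit_lebesgue"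
        using \<phi> unfolding measure_preserving_def by auto
      have \<psi>m[measurable]: "\<psi> \<in> unit_lebesgue \<rightarrow>\<^sub>M unit_lebesgue" and d\<psi>: "distr unit_lebesgue unit_lebesgue \<psi> = unit_lebesgue"
        using \<psi> unfolding measure_preserving_def by auto
      \<comment> \<open>Both maps read at one uniform point give the coupling; \<open>\<psi>\<close>
        comes first because it is applied to \<open>W\<close>.\<close>
      let ?h = "\<lambda>s. (\<psi> s, \<phi> s)"
      define \<gamma> where "\<gamma> = distr unit_lebesgue ?L ?h"
      have h[measurable]: "?h \<in> unit_lebesgue \<rightarrow>\<^sub>M ?L" by measurable
      have p\<gamma>: "prob_space \<gamma>" unfolding \<gamma>_def by (rule unit_lebesgue.prob_space_distr[OF h])
      have s\<gamma>: "sets \<gamma> = sets ?L" unfolding \<gamma>_def by simp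
      have f\<gamma>: "distr \<gamma> unit_lebesgue fst = unit_lebesgue"
        unfolding \<gamma>_def by (subst distr_distr[OF measurable_fst h]) (simp add: comp_def d\<psi>)
      have g\<gamma>: "distr \<gamma> unit_lebesgue snd = unit_lebesgue"
        unfolding \<gamma>_def by (subst distr_distr[OF measurable_snd h]) (simp add: comp_def d\<phi>)
      have "AE z in ?L. W' (\<phi> (fst z)) (\<phi> (snd z)) = W (\<psi> (fst z)) (\<psi> (snd z))"
        by (rule AE_pair_map[OF measurable_unit_lebesgue_id distr_unit_lebesgue_id prob_unit_lebesgue sets_unit_borel dd])
      \<comment> \<open>Passing to the image measure uses measurability of the set of agreement for
        the product sigma-algebra. The Borel versions provide it and are exchanged for
        \<open>W\<close> and \<open>W'\<close> afterwards through the marginals.\<close>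
      then have "AE z in ?L. w (\<psi> (fst z)) (\<psi> (snd z)) = w' (\<phi> (fst z)) (\<phi> (snd z))"
        using AE_pair_marginal[OF prob_unit_lebesgue \<psi>m d\<psi> Ww] AE_pair_marginal[OF prob_unit_lebesgue \<phi>m d\<phi> Ww']
        by eventually_elim (use M in simp)
      then have AEh: "AE z in ?L. w (fst (?h (fst z))) (fst (?h (snd z))) = w' (snd (?h (fst z))) (snd (?h (snd z)))"
        by simp
      have "sigma_finite_measure (distr unit_lebesgue ?L ?h)"
        using p\<gamma> unfolding \<gamma>_def by (simp add: prob_space_imp_sigma_finite)
      then have \<gamma>\<gamma>: "\<gamma> \<Otimes>\<^sub>M \<gamma> = distr ?L (?L \<Otimes>\<^sub>M ?L) (\<lambda>(x, y). (?h x, ?h y))"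
        unfolding \<gamma>_def by (rule pair_measure_distr[OF h h])
      have c1: "(\<lambda>z. fst (k z)) \<in> borel_measurable (?L \<Otimes>\<^sub>M ?L)" "(\<lambda>z. snd (k z)) \<in> borel_measurable (?L \<Otimes>\<^sub>M ?L)"
        if "k \<in> ?L \<Otimes>\<^sub>M ?L \<rightarrow>\<^sub>M ?L" for k
        using measurable_compose[OF measurable_compose[OF that measurable_fst] measurable_unit_lebesgue_id]
          measurable_compose[OF measurable_compose[OF that measurable_snd] measurable_unit_lebesgue_id] by auto
      have [measurable]: "(\<lambda>z. w (fst (fst z)) (fst (snd z))) \<in> borel_measurable (?L \<Otimes>\<^sub>M ?L)"
        "(\<lambda>z. w' (snd (fst z)) (snd (snd z))) \<in> borel_measurable (?L \<Otimes>\<^sub>M ?L)"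
        by (rule borel_kernel_measurable[OF w] borel_kernel_measurable[OF w']; rule c1; measurable)+
      have hh: "(\<lambda>(x, y). (?h x, ?h y)) \<in> ?L \<rightarrow>\<^sub>M ?L \<Otimes>\<^sub>M ?L" by measurable
      have "{z \<in> space (?L \<Otimes>\<^sub>M ?L). w (fst (fst z)) (fst (snd z)) = w' (snd (fst z)) (snd (snd z))} \<in> sets (?L \<Otimes>\<^sub>M ?L)"
        by measurable
      then have "AE z in \<gamma> \<Otimes>\<^sub>M \<gamma>. w (fst (fst z)) (fst (snd z)) = w' (snd (fst z)) (snd (snd z))"
        unfolding \<gamma>\<gamma> using AEh by (subst AE_distr_iff[OF hh]) (auto simp: case_prod_beta)
      moreover have "fst \<in> \<gamma> \<rightarrow>\<^sub>M unit_lebesgue" "snd \<in> \<gamma> \<rightarrow>\<^sub>M unit_lebesgue"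
        using measurable_cong_sets[OF s\<gamma> refl] by auto
      ultimately have "AE z in \<gamma> \<Otimes>\<^sub>M \<gamma>. W (fst (fst z)) (fst (snd z)) = W' (snd (fst z)) (snd (snd z))"
        using AE_pair_marginal[OF p\<gamma> _ f\<gamma> Ww] AE_pair_marginal[OF p\<gamma> _ g\<gamma> Ww']
        by (auto elim!: eventually_elim2)
      then show ?thesis
        unfolding e_def AE_coupling_iff lebesgue_coupling_def using p\<gamma> s\<gamma> f\<gamma> g\<gamma> by blast
    qed
    ultimately show ?thesis ..
  qed
  moreover have "b" if "c"
  proof -
    obtain U \<phi> \<psi> where *: "U \<in> kernels \<and> measure_preserving \<phi> \<and> measure_preserving \<psi> \<and>
        (AE z in ?B. W (fst z) (snd z) = U (\<phi> (fst z)) (\<phi> (snd z))) \<and>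
        (AE z in ?B. W' (fst z) (snd z) = U (\<psi> (fst z)) (\<psi> (snd z)))"
      using \<open>c\<close> unfolding c_def aeq pullback_def by (elim exE)
    note U = *[THEN conjunct1] and \<phi> = *[THEN conjunct2, THEN conjunct1]
      and \<psi> = *[THEN conjunct2, THEN conjunct2, THEN conjunct1]
      and WU = *[THEN conjunct2, THEN conjunct2, THEN conjunct2, THEN conjunct1]
      and WU' = *[THEN conjunct2, THEN conjunct2, THEN conjunct2, THEN conjunct2]
    obtain K where K: "\<forall>x\<in>{0..1}. \<forall>y\<in>{0..1}. \<bar>U x y\<bar> \<le> K" using kernel_bound[OF U] by blast
    obtain u where u: "borel_kernel u" and Uu: "AE z in ?B. U (fst z) (snd z) = max 1 K * u (fst z) (snd z)"
    proof -
      have "0 < max 1 K" by simp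
      moreover have "\<bar>U x y\<bar> \<le> max 1 K" if "x \<in> {0..1}" "y \<in> {0..1}" for x y
        using K that by (simp add: le_max_iff_disj)
      ultimately show thesis using kernel_borel_version[OF U] that by blast
    qed
    \<comment> \<open>Both densities reduce to that of one Borel version of \<open>U\<close> with
      the same scaling factor.\<close>
    have dens: "hom_density k E X = max 1 K ^ size E * borel_hom_density k E u"
      if E: "multigraph k E" and f: "measure_preserving f"
        and X: "AE z in ?B. X (fst z) (snd z) = U (f (fst z)) (f (snd z))" for k E X f
    proof -
      obtain f0 where f0: "f0 \<in> borel_measurable borel" "distr unit_borel borel f0 = unit_borel"
        "AE x in unit_borel. f x = f0 x" using measure_preserving_borel_version[OF f] by blast
      have "AE z in ?B. X (fst z) (snd z) = max 1 K * u (f0 (fst z)) (f0 (snd z))"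
        using X AE_unit_borel_pair_both[OF f0(3)] pull[OF Uu f0(1,2)] by eventually_elim simp
      from hom_density_scaled[OF u f0(1,2) this E] show ?thesis .
    qed
    show ?thesis
      unfolding b_def using dens[OF _ \<phi> WU] dens[OF _ \<psi> WU'] by simp
  qed
  moreover have "b" if "e"
  proof -
    obtain \<gamma> where p\<gamma>: "prob_space \<gamma>" and s\<gamma>: "sets \<gamma> = sets ?L"
      and f\<gamma>: "distr \<gamma> unit_lebesgue fst = unit_lebesgue" and g\<gamma>: "distr \<gamma> unit_lebesgue snd = unit_lebesgue"
      and AE: "AE z in \<gamma> \<Otimes>\<^sub>M \<gamma>. W (fst (fst z)) (fst (snd z)) = W' (snd (fst z)) (snd (snd z))"
      using \<open>e\<close> unfolding e_def AE_coupling_iff lebesgue_coupling_def by blast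
    have m: "fst \<in> \<gamma> \<rightarrow>\<^sub>M unit_lebesgue" "snd \<in> \<gamma> \<rightarrow>\<^sub>M unit_lebesgue"
      using measurable_cong_sets[OF s\<gamma> refl] by auto
    note f = marginal_to_borel[OF m(1) f\<gamma>] and g = marginal_to_borel[OF m(2) g\<gamma>]
    have ww: "AE z in \<gamma> \<Otimes>\<^sub>M \<gamma>. w (fst (fst z)) (fst (snd z)) = w' (snd (fst z)) (snd (snd z))"
      using AE AE_pair_marginal[OF p\<gamma> m(1) f\<gamma> Ww] AE_pair_marginal[OF p\<gamma> m(2) g\<gamma> Ww']
      by eventually_elim (use M in simp)
    have vm: "(\<lambda>z. w (fst (fst z)) (fst (snd z))) \<in> borel_measurable (\<gamma> \<Otimes>\<^sub>M \<gamma>)"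
      "(\<lambda>z. w' (snd (fst z)) (snd (snd z))) \<in> borel_measurable (\<gamma> \<Otimes>\<^sub>M \<gamma>)"
      using scaled_borel_kernel_measurable[OF w f(1), of 1] scaled_borel_kernel_measurable[OF w' g(1), of 1]
      by simp_all
    have bm: "(\<lambda>z. w (fst z) (snd z)) \<in> borel_measurable (borel \<Otimes>\<^sub>M borel)"
      "(\<lambda>z. w' (fst z) (snd z)) \<in> borel_measurable (borel \<Otimes>\<^sub>M borel)"
      using scaled_borel_kernel_measurable[OF w id_borel(1), of 1] scaled_borel_kernel_measurable[OF w' id_borel(1), of 1]
      by simp_all
    have "borel_hom_density k E w = borel_hom_density k E w'" if E: "multigraph k E" for k E
    proof -
      \<comment> \<open>Both densities are integrals over \<open>k\<close> independent samples of
        the coupling, and the integrands agree almost everywhere, edge by edge.\<close>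
      have "borel_hom_density k E w
          = (\<integral>x. (\<Prod>e\<in>#E. w (fst (x (Min e))) (fst (x (Max e)))) \<partial>(\<Pi>\<^sub>M i\<in>{1..k}. \<gamma>))"
        unfolding borel_hom_density_def edge_value_def
        by (rule integral_edge_product_map[OF p\<gamma> f bm(1) E, symmetric])
      also have "\<dots> = (\<integral>x. (\<Prod>e\<in>#E. w' (snd (x (Min e))) (snd (x (Max e)))) \<partial>(\<Pi>\<^sub>M i\<in>{1..k}. \<gamma>))"
        by (intro integral_cong_AE edge_product_measurable[OF vm(1) E] edge_product_measurable[OF vm(2) E]
            AE_edge_product[OF p\<gamma> ww E])
      also have "\<dots> = borel_hom_density k E w'"
        unfolding borel_hom_density_def edge_value_def
        by (rule integral_edge_product_map[OF p\<gamma> g bm(2) E])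
      finally show ?thesis .
    qed
    then show ?thesis unfolding b_def using t by simp
  qed
  ultimately have "(a \<longleftrightarrow> b) \<and> (b \<longleftrightarrow> c) \<and> (c \<longleftrightarrow> d) \<and> (d \<longleftrightarrow> e)" by blast
  then show ?thesis
    unfolding Let_def a_def b_def c_def d_def e_def .
qed

end
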